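(* For $i\in\{0,1,2\}$ let $1\le p_i,q_i,r_i\le\infty$ and $\beta_i\in\mathbb{R}$, and assume $$\tfrac1{p_0}=\tfrac1{p_1}+\tfrac1{p_2},\quad \tfrac1{q_0}=\tfrac1{q_1}+\tfrac1{q_2},\quad \tfrac1{r_0}=\tfrac1{r_1}+\tfrac1{r_2},\quad \beta_0=\beta_1+\beta_2$$ (with $1/\infty=0$). Then $T^{p_2,r_2}_{q_2,\beta_2}=M(T^{p_1,r_1}_{q_1,\beta_1},T^{p_0,r_0}_{q_0,\beta_0})$ with equivalent norms.
   Context: Let $\mathbb{R}^{n+1}_+=\mathbb{R}^n\times(0,\infty)$; functions are complex-valued measurable, identified a.e. $B(y,t)=\{z:|z-y|<t\}$, $\Gamma(x)=\{(y,t):|y-x|<t\}$, $\widehat{B}=\{(y,t):B(y,t)\subset B\}$ for an open ball $B\subset\mathbb{R}^n$. Fix Whitney parameters $0<\alpha_1<\alpha_2^{-1}<1$, $W(y,t)=\{(z,s):|z-y|<\alpha_1t,\ \alpha_2^{-1}t<s<\alpha_2t\}$, $\mathcal{W}_r(f)(y,t)=|W(y,t)|^{-1/r}\|f\|_{L^r(W(y,t))}$ ($r<\infty$), $\mathcal{W}_\infty(f)(y,t)=\operatorname{ess\,sup}_{W(y,t)}|f|$. Tent spaces $T^p_q$: (A) $p,q<\infty$: $\|g\|=\|(\iint_{\Gamma(x)}|g|^q\,dy\,dt/t^{n+1})^{1/q}\|_{L^p(dx)}$; (B) $q<p=\infty$: $\|g\|=\sup_x\sup_{B\ni x}|B|^{-1/q}(\iint_{\widehat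 B}|g|^q\,dy\,dt/t)^{1/q}$; (C) $p<q=\infty$: $\|g\|=\|\sup_{(y,t)\in\Gamma(x)}|g(y,t)|\|_{L^p(dx)}$; (D) $T^\infty_\infty=L^\infty$. $T^{p,r}_{q,\beta}$ is the space of $f$ with $\|f\|_{T^{p,r}_{q,\beta}}=\|\mathcal{W}_r(f(z,s)s^{-\beta})\|_{T^p_q}<\infty$. For Banach function lattices $X_1,X_0$, $M(X_1,X_0)$ is the set of measurable $w$ such that $\|w\|_{M(X_1,X_0)}=\sup_{v\in X_1,v\ne0}\|vw\|_{X_0}/\|v\|_{X_1}<\infty$. *)

theory Defs
  imports "HOL-Analysis.Analysis"
begin

text \<open>Points of the upper half space are pairs (y,t) with y in an n-dimensional
 Euclidean space 'a (n = DIM('a)) and t > 0.  Functions are complex-valued on 'a \<times> real;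
 only their values on t > 0 matter.  Norms take values in ennreal (infinity allowed).
 Exponents p,q,r range over [1,\<infinity>] as ennreal values.\<close>

definition epow :: "ennreal \<Rightarrow> real \<Rightarrow> ennreal" where
  "epow x a = (if x = \<infinity> then \<infinity> else ennreal (enn2real x powr a))"

definition ess_sup_on :: "('b::euclidean_space) set \<Rightarrow> ('b \<Rightarrow> ennreal) \<Rightarrow> ennreal" where
  "ess_sup_on S g = Inf {c. AE x in lborel. x \<in> S \<longrightarrow> g x \<le> c}"

definition upper_half :: "('a::euclidean_space \<times> real) set" where
  "upper_half = {(y, t). t > 0}"

definition cone :: "'a::euclidean_space \<Rightarrow> ('a \<times> real) set" where
  "cone x = {(y, t). t > 0 \<and> dist y x < t}"

definition tent :: "'a::euclidean_space set \<Rightarrow> ('a \<times> real) set" where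
  "tent B = {(y, t). t > 0 \<and> ball y t \<subseteq> B}"

definition whitney :: "real \<Rightarrow> real \<Rightarrow> 'a::euclidean_space \<times> real \<Rightarrow> ('a \<times> real) set" where
  "whitney \<alpha>1 \<alpha>2 yt = {(z, s). dist z (fst yt) < \<alpha>1 * snd yt \<and>
       snd yt / \<alpha>2 < s \<and> s < \<alpha>2 * snd yt}"

definition whitney_avg :: "real \<Rightarrow> real \<Rightarrow> ennreal \<Rightarrow> ('a::euclidean_space \<times> real \<Rightarrow> complex)
    \<Rightarrow> 'a \<times> real \<Rightarrow> ennreal" where
  "whitney_avg \<alpha>1 \<alpha>2 r f yt =
     (if r = \<infinity> then ess_sup_on (whitney \<alpha>1 \<alpha>2 yt) (\<lambda>x. ennreal (cmod (f x)))
      else epow (inverse (emeasure lborel (whitney \<alpha>1 \<alpha>2 yt)) *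
             (\<integral>\<^sup>+ x. indicator (whitney \<alpha>1 \<alpha>2 yt) x * ennreal (cmod (f x) powr enn2real r) \<partial>lborel))
           (1 / enn2real r))"

definition tent_norm :: "ennreal \<Rightarrow> ennreal \<Rightarrow> ('a::euclidean_space \<times> real \<Rightarrow> ennreal) \<Rightarrow> ennreal" where
  "tent_norm p q g =
    (if p \<noteq> \<infinity> \<and> q \<noteq> \<infinity> then
       epow (\<integral>\<^sup>+ x. epow (\<integral>\<^sup>+ yt. indicator (cone x) yt * epow (g yt) (enn2real q)
                   * ennreal (1 / snd yt ^ (DIM('a) + 1)) \<partial>lborel) (enn2real p / enn2real q) \<partial>lborel)
            (1 / enn2real p)
     else if q \<noteq> \<infinity> \<and> p = \<infinity> then
       (SUP x. SUP B \<in> {ball c \<rho> | c \<rho>. \<rho> > 0 \<and> x \<in> ball c \<rho>}.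
          epow (inverse (emeasure lborel B) *
             (\<integral>\<^sup>+ yt. indicator (tent B) yt * epow (g yt) (enn2real q) * ennreal (1 / snd yt) \<partial>lborel))
             (1 / enn2real q))
     else if p \<noteq> \<infinity> \<and> q = \<infinity> then
       epow (\<integral>\<^sup>+ x. epow (SUP yt \<in> cone x. g yt) (enn2real p) \<partial>lborel) (1 / enn2real p)
     else ess_sup_on upper_half g)"

definition wtent_norm :: "real \<Rightarrow> real \<Rightarrow> ennreal \<Rightarrow> ennreal \<Rightarrow> ennreal \<Rightarrow> real
     \<Rightarrow> ('a::euclidean_space \<times> real \<Rightarrow> complex) \<Rightarrow> ennreal" where
  "wtent_norm \<alpha>1 \<alpha>2 p q r \<beta> f =
     tent_norm p q (whitney_avg \<alpha>1 \<alpha>2 r (\<lambda>(z, s). f (z, s) * complex_of_real (s powr (- \<beta>))))"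

definition wtent :: "real \<Rightarrow> real \<Rightarrow> ennreal \<Rightarrow> ennreal \<Rightarrow> ennreal \<Rightarrow> real
     \<Rightarrow> ('a::euclidean_space \<times> real \<Rightarrow> complex) set" where
  "wtent \<alpha>1 \<alpha>2 p q r \<beta> =
     {f. f \<in> borel_measurable lebesgue \<and> wtent_norm \<alpha>1 \<alpha>2 p q r \<beta> f < \<infinity>}"

definition mult_norm :: "(('b::euclidean_space) \<Rightarrow> complex) set \<Rightarrow> (('b \<Rightarrow> complex) \<Rightarrow> ennreal)
     \<Rightarrow> (('b \<Rightarrow> complex) \<Rightarrow> ennreal) \<Rightarrow> ('b \<Rightarrow> complex) \<Rightarrow> ennreal" where
  "mult_norm X1 N1 N0 w =
     (SUP v \<in> {v \<in> X1. N1 v \<noteq> 0}. N0 (\<lambda>x. v x * w x) / N1 v)"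

definition mult_space :: "(('b::euclidean_space) \<Rightarrow> complex) set \<Rightarrow> (('b \<Rightarrow> complex) \<Rightarrow> ennreal)
     \<Rightarrow> (('b \<Rightarrow> complex) \<Rightarrow> ennreal) \<Rightarrow> ('b \<Rightarrow> complex) set" where
  "mult_space X1 N1 N0 =
     {w. w \<in> borel_measurable lebesgue \<and> mult_norm X1 N1 N0 w < \<infinity>}"

end

theory Submission
  imports Defs
begin

text \<open>
  A partition of the upper half space into Whitney boxes, each the shadow of a ball \<open>B\<^sub>i\<close>, turns
  \<open>T\<^bsup>p,r\<^esup>\<^bsub>q,\<beta>\<^esub>\<close> into a space of sequences \<open>a\<^sub>i\<close>, namely the \<open>L\<^sup>r\<close> averages of \<open>|f| s\<^bsup>-\<beta>\<^esup>\<close> over the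
  boxes, with the norm of \<open>(a\<^sub>i 1\<^bsub>B\<^sub>i\<^esub>)\<^sub>i\<close> in \<open>L\<^sup>p(\<ell>\<^sup>q)\<close> (a Carleson condition if \<open>p = \<infinity>\<close>).
  The key fact is that this norm is comparable to the norm of \<open>(a\<^sub>i 1\<^bsub>E\<^sub>i\<^esub>)\<^sub>i\<close> for sets
  \<open>E\<^sub>i \<subseteq> B\<^sub>i\<close> of proportional measure: it is dominated by it for every choice of the \<open>E\<^sub>i\<close>, and
  dominates it for a suitable choice. Hence Hoelder's inequality holds pointwise up to the choice of
  the \<open>E\<^sub>i\<close>, the Carleson case included. Conversely, testing a multiplier \<open>b\<close> against
  \<open>a\<^sub>i = b\<^sub>i\<^bsup>q2/q1\<^esup> m\<^sub>i\<^bsup>\<gamma>\<^esup>\<close>, where \<open>m\<^sub>i\<close> is a median over \<open>B\<^sub>i\<close> of the \<open>\<ell>\<^bsup>q2\<^esup>\<close> norm of \<open>b\<close>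
  (or against a greedily selected subsequence when \<open>q2 = \<infinity>\<close>), recovers the norm of \<open>b\<close>.
\<close>

section \<open>Powers and Lebesgue norms of extended nonnegative functions\<close>

text \<open>The obstacle is the Carleson end point: for \<open>p = top\<close> and finite
  \<open>q\<close> the norm is no \<open>L^p\<close> norm of a pointwise functional, so neither
  Hoelder's inequality nor an extremal function is available point by point. Shrinking the balls
  repairs this; the way back to whole balls is a maximal function estimate whose constant depends
  only on the proportion kept.

  The median arises as follows. If \<open>S\<close> is the sum of the \<open>b_j^q2\<close> over the
  balls containing x, the natural extremiser is \<open>b_i^(q2/q1) S(x)^\<gamma>\<close>, which
  varies inside a ball. A median of \<open>S\<close> freezes it, and each of the two inequalities
  between \<open>S\<close> and its median holds on half of the ball, an admissible set. For
  \<open>p2 = top\<close> and finite \<open>q2\<close> the median power is replaced by restriction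
  to a ball that nearly attains the Carleson supremum.

  The exponent \<open>r\<close> is local: Hoelder's inequality and its converse hold box by box, and
  gluing local extremisers turns multipliers of functions into multipliers of sequences. Several
  estimates absorb a power of the quantity being estimated; this forces finite sums with finite
  coefficients first and monotone convergence afterwards.\<close>

lemma epow_ennreal [simp]: "0 \<le> x \<Longrightarrow> epow (ennreal x) a = ennreal (x powr a)"
  by (simp add: epow_def)

text \<open>\<open>0\<close> and \<open>top\<close> are fixed by every exponent, zero and negative
  ones included. With this convention the laws for products, sums of exponents and iterated powers
  need no side conditions; only the order laws look at the sign.\<close>

lemma epow_top [simp]: "epow top a = top"
  by (simp add: epow_def)

lemma epow_0 [simp]: "epow 0 a = 0"
  by (simp add: epow_def)

lemma epow_1 [simp]: "epow 1 a = 1"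
  by (simp add: epow_def)

lemma epow_eq_0 [simp]: "epow x a = 0 \<longleftrightarrow> x = 0"
  by (cases x) (auto simp: epow_def)

lemma epow_eq_top [simp]: "epow x a = top \<longleftrightarrow> x = top"
  by (cases x) (auto simp: epow_def)

lemma epow_less_top [simp]: "epow x a < top \<longleftrightarrow> x < top"
  by (simp add: less_top[symmetric])

lemma epow_one_exp [simp]: "epow x 1 = x"
  by (cases x) (auto simp: epow_def)

lemma epow_mono: "x \<le> y \<Longrightarrow> 0 \<le> a \<Longrightarrow> epow x a \<le> epow y a"
  by (cases x; cases y) (auto intro!: powr_mono2 simp: top_unique)

lemma epow_antimono: "0 < x \<Longrightarrow> x \<le> y \<Longrightarrow> y < top \<Longrightarrow> a \<le> 0 \<Longrightarrow> epow y a \<le> epow x a"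
  by (cases x; cases y) (auto intro!: powr_mono2')

lemma epow_mult: "epow (x * y) a = epow x a * epow y a"
proof (cases x)
  case (real r)
  show ?thesis
  proof (cases y)
    case (real s)
    with \<open>x = ennreal r\<close> \<open>0 \<le> r\<close> show ?thesis
      by (simp add: powr_mult ennreal_mult[symmetric])
  next
    case top
    with real show ?thesis by (cases "r = 0") (auto simp: ennreal_mult_top)
  qed
next
  case top
  then show ?thesis by (cases "y = 0") (auto simp: ennreal_top_mult)
qed

lemma epow_epow: "epow (epow x a) b = epow x (a * b)"
  by (cases x) (auto simp: powr_powr)

lemma epow_add: "epow x (a + b) = epow x a * epow x b"
  by (cases x) (auto simp: powr_add ennreal_mult)

lemma epow_inverse_exp: "0 < a \<Longrightarrow> epow (epow x a) (1 / a) = x"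
  "0 < a \<Longrightarrow> epow (epow x (1 / a)) a = x"
  by (simp_all add: epow_epow)

text \<open>A positive power is an order isomorphism with inverse \<open>1 / a\<close>. This form
  moves exponents across inequalities and yields commutation with suprema.\<close>

lemma epow_le_iff: "0 < a \<Longrightarrow> epow x a \<le> y \<longleftrightarrow> x \<le> epow y (1 / a)"
  using epow_mono[of "epow x a" y "1/a"] epow_mono[of x "epow y (1/a)" a]
  by (auto simp: epow_inverse_exp)

lemma epow_SUP:
  assumes "0 < a" shows "epow (SUP i\<in>I. f i) a = (SUP i\<in>I. epow (f i) a)"
proof (rule antisym)
  have "f i \<le> epow (SUP i\<in>I. epow (f i) a) (1 / a)" if "i \<in> I" for i
    using assms that by (subst epow_le_iff[symmetric]) (auto intro: SUP_upper)
  then have "(SUP i\<in>I. f i) \<le> epow (SUP i\<in>I. epow (f i) a) (1 / a)"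
    by (rule SUP_least)
  then show "epow (SUP i\<in>I. f i) a \<le> (SUP i\<in>I. epow (f i) a)"
    using assms by (simp add: epow_le_iff)
qed (use assms in \<open>auto intro!: SUP_least epow_mono SUP_upper\<close>)

lemma measurable_epow [measurable (raw)]:
  assumes [measurable]: "f \<in> borel_measurable M"
  shows "(\<lambda>x. epow (f x) a) \<in> borel_measurable M"
  unfolding epow_def by measurable

lemma epow_mult_indicator: "epow (x * indicator A y) a = epow x a * indicator A y"
  by (auto simp: indicator_def)

text \<open>Divide by \<open>epow X (1 - \<theta>)\<close>, which is legitimate only for finite
  \<open>X\<close>; this is why the estimates that use it run over finitely many balls.\<close>

lemma ennreal_absorb:
  assumes "X < top" "0 < \<theta>" "\<theta> \<le> 1" "X \<le> k * epow Y \<theta> * epow X (1 - \<theta>)"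
  shows "X \<le> epow k (1 / \<theta>) * Y"
proof (cases "X = 0 \<or> k * epow Y \<theta> = top")
  case True
  then show ?thesis
    using assms by (auto simp: ennreal_mult_eq_top_iff)
next
  case False
  obtain x where x: "X = ennreal x" "0 < x"
    using False assms(1) by (cases X) auto
  obtain z where z: "k * epow Y \<theta> = ennreal z" "0 \<le> z"
    using False by (cases "k * epow Y \<theta>") auto
  have "x \<le> z * x powr (1 - \<theta>)"
    using assms(4) x z by (simp add: ennreal_mult[symmetric])
  then have "x powr \<theta> \<le> z"
    using x by (simp add: powr_diff field_simps)
  then have "epow X \<theta> \<le> k * epow Y \<theta>"
    using x z by simp
  then show ?thesis
    using assms(2) by (simp add: epow_le_iff epow_mult epow_epow)
qed

text \<open>Normalise by the two integrals and integrate the weighted inequality between arithmetic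
  and geometric mean; zero and infinite integrals are split off. The weighted form fits the later
  arguments, where an integrand is factored into powers.\<close>

lemma nn_integral_Holder_theta:
  assumes [measurable]: "f \<in> borel_measurable M" "g \<in> borel_measurable M" and t: "0 < \<theta>" "\<theta> < 1"
  shows "(\<integral>\<^sup>+x. epow (f x) \<theta> * epow (g x) (1 - \<theta>) \<partial>M)
    \<le> epow (\<integral>\<^sup>+x. f x \<partial>M) \<theta> * epow (\<integral>\<^sup>+x. g x \<partial>M) (1 - \<theta>)"
proof -
  define A where "A = (\<integral>\<^sup>+x. f x \<partial>M)"
  define B where "B = (\<integral>\<^sup>+x. g x \<partial>M)"
  consider "A = 0" | "B = 0" | "A \<noteq> 0" "B \<noteq> 0" "A = top \<or> B = top"
    | a b where "A = ennreal a" "B = ennreal b" "0 < a" "0 < b"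
    by (cases A; cases B) (auto simp: less_le)
  then show ?thesis
  proof cases
    case 1
    then have "AE x in M. f x = 0" by (simp add: A_def nn_integral_0_iff_AE)
    then have "AE x in M. epow (f x) \<theta> * epow (g x) (1 - \<theta>) = 0" by eventually_elim simp
    then have "(\<integral>\<^sup>+x. epow (f x) \<theta> * epow (g x) (1 - \<theta>) \<partial>M) = 0"
      by (subst nn_integral_0_iff_AE) auto
    then show ?thesis by simp
  next
    case 2
    then have "AE x in M. g x = 0" by (simp add: B_def nn_integral_0_iff_AE)
    then have "AE x in M. epow (f x) \<theta> * epow (g x) (1 - \<theta>) = 0" by eventually_elim simp
    then have "(\<integral>\<^sup>+x. epow (f x) \<theta> * epow (g x) (1 - \<theta>) \<partial>M) = 0"
      by (subst nn_integral_0_iff_AE) auto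
    then show ?thesis by simp
  next
    case 3
    then have "epow A \<theta> * epow B (1 - \<theta>) = top"
      by (auto simp: ennreal_mult_eq_top_iff)
    then show ?thesis by (simp add: A_def B_def)
  next
    case (4 a b)
    \<comment> \<open>\<open>K\<close> is the right-hand side of the claim. Young's inequality for
      \<open>u / a\<close> and \<open>v / b\<close>, multiplied by \<open>K\<close>, is linear in
      \<open>u\<close> and \<open>v\<close> and integrates to
      \<open>K * \<theta> + K * (1 - \<theta>)\<close>.\<close>
    define K where "K = a powr \<theta> * b powr (1 - \<theta>)"
    have K: "0 < K" using 4 by (simp add: K_def)
    have pt: "epow u \<theta> * epow v (1 - \<theta>) \<le> ennreal (K * \<theta> / a) * u + ennreal (K * (1 - \<theta>) / b) * v" for u v
    proof (cases "u = top \<or> v = top")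
      case True
      then show ?thesis using K 4 t by (auto simp: ennreal_mult_top)
    next
      case False
      then obtain x y where u: "u = ennreal x" "0 \<le> x" and v: "v = ennreal y" "0 \<le> y"
        by (cases u; cases v) auto
      have "(x / a) powr \<theta> * (y / b) powr (1 - \<theta>) \<le> \<theta> * (x / a) + (1 - \<theta>) * (y / b)"
      proof (cases "x = 0 \<or> y = 0")
        case True
        then show ?thesis using u v 4 t by auto
      next
        case False
        then show ?thesis using u v 4 t by (intro Youngs_inequality_0) auto
      qed
      then have "K * ((x / a) powr \<theta> * (y / b) powr (1 - \<theta>)) \<le> K * (\<theta> * (x / a) + (1 - \<theta>) * (y / b))"
        using K by simp
      moreover have "K * ((x / a) powr \<theta> * (y / b) powr (1 - \<theta>)) = x powr \<theta> * y powr (1 - \<theta>)"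
        using 4 u v by (simp add: K_def powr_divide)
      ultimately have "x powr \<theta> * y powr (1 - \<theta>) \<le> K * \<theta> / a * x + K * (1 - \<theta>) / b * y"
        by (simp add: field_simps)
      moreover have "epow u \<theta> * epow v (1 - \<theta>) = ennreal (x powr \<theta> * y powr (1 - \<theta>))"
        using u v by (simp add: ennreal_mult)
      moreover have "ennreal (K * \<theta> / a) * u + ennreal (K * (1 - \<theta>) / b) * v
          = ennreal (K * \<theta> / a * x + K * (1 - \<theta>) / b * y)"
        using u v 4 t K by (subst ennreal_plus) (auto simp: ennreal_mult[symmetric])
      ultimately show ?thesis by (simp add: ennreal_leI)
    qed
    have "(\<integral>\<^sup>+x. epow (f x) \<theta> * epow (g x) (1 - \<theta>) \<partial>M)
       \<le> (\<integral>\<^sup>+x. ennreal (K * \<theta> / a) * f x + ennreal (K * (1 - \<theta>) / b) * g x \<partial>M)"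
      by (intro nn_integral_mono pt)
    also have "\<dots> = ennreal (K * \<theta> / a) * A + ennreal (K * (1 - \<theta>) / b) * B"
      by (simp add: nn_integral_add nn_integral_cmult A_def B_def)
    also have "\<dots> = ennreal (K * \<theta> / a * a + K * (1 - \<theta>) / b * b)"
      using 4 t K by (subst ennreal_plus) (auto simp: ennreal_mult[symmetric])
    also have "K * \<theta> / a * a + K * (1 - \<theta>) / b * b = K"
      using 4 by (simp add: field_simps)
    also have "ennreal K = epow A \<theta> * epow B (1 - \<theta>)"
      using 4 by (simp add: K_def ennreal_mult)
    finally show ?thesis by (simp add: A_def B_def)
  qed
qed

text \<open>One norm for three measures: Lebesgue measure gives \<open>L^p\<close>, counting measure
  gives the sequence norm, the uniform measure on a box gives an average. A single Hoelder
  inequality thus serves all three.\<close>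

definition lnorm :: "'b measure \<Rightarrow> ennreal \<Rightarrow> ('b \<Rightarrow> ennreal) \<Rightarrow> ennreal" where
  "lnorm M p f = (if p = top then Inf {c. AE x in M. f x \<le> c}
     else epow (\<integral>\<^sup>+x. epow (f x) (enn2real p) \<partial>M) (1 / enn2real p))"

lemma lnorm_top: "lnorm M top f = Inf {c. AE x in M. f x \<le> c}"
  by (simp add: lnorm_def)

lemma lnorm_finite: "p \<noteq> top \<Longrightarrow> lnorm M p f = epow (\<integral>\<^sup>+x. epow (f x) (enn2real p) \<partial>M) (1 / enn2real p)"
  by (simp add: lnorm_def)

lemma exponent_pos: "1 \<le> p \<Longrightarrow> p \<noteq> top \<Longrightarrow> 1 \<le> enn2real p"
  by (cases p) auto

text \<open>The infimum is the limit of countably many essential bounds, and countably many null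
  sets have a null union, so the infimum is itself an essential bound.\<close>

lemma AE_le_lnorm_top: "AE x in M. f x \<le> lnorm M top f"
proof -
  let ?S = "{c. AE x in M. f x \<le> c}"
  have "?S \<noteq> {}" by (auto intro: exI[of _ top])
  then obtain g :: "nat \<Rightarrow> ennreal" where g: "range g \<subseteq> ?S" "Inf ?S = (INF i. g i)"
    using ennreal_Inf_countable_INF[of ?S] by auto
  have "AE x in M. \<forall>n. f x \<le> g n"
    using g(1) by (subst AE_all_countable) auto
  then show ?thesis
    by eventually_elim (auto simp: lnorm_top g(2) intro: INF_greatest)
qed

lemma lnorm_top_leI: "AE x in M. f x \<le> c \<Longrightarrow> lnorm M top f \<le> c"
  by (auto simp: lnorm_top intro: Inf_lower)

lemma lnorm_mono_AE:
  assumes "1 \<le> p" "AE x in M. f x \<le> g x"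
  shows "lnorm M p f \<le> lnorm M p g"
proof (cases "p = top")
  case True
  have "AE x in M. f x \<le> lnorm M top g"
    using assms(2) AE_le_lnorm_top by eventually_elim (rule order_trans)
  then show ?thesis using True by (auto intro: lnorm_top_leI)
next
  case False
  have "AE x in M. epow (f x) (enn2real p) \<le> epow (g x) (enn2real p)"
    using assms(2) by eventually_elim (simp add: epow_mono)
  then have "(\<integral>\<^sup>+x. epow (f x) (enn2real p) \<partial>M) \<le> (\<integral>\<^sup>+x. epow (g x) (enn2real p) \<partial>M)"
    by (rule nn_integral_mono_AE)
  then show ?thesis using False by (simp add: lnorm_finite epow_mono)
qed

lemma lnorm_mono: "1 \<le> p \<Longrightarrow> (\<And>x. x \<in> space M \<Longrightarrow> f x \<le> g x) \<Longrightarrow> lnorm M p f \<le> lnorm M p g"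
  by (rule lnorm_mono_AE) auto

lemma lnorm_cong_AE: "1 \<le> p \<Longrightarrow> AE x in M. f x = g x \<Longrightarrow> lnorm M p f = lnorm M p g"
  by (intro antisym lnorm_mono_AE) (auto elim: eventually_mono)

lemma lnorm_cmult:
  assumes "1 \<le> p" "p \<noteq> top" and [measurable]: "f \<in> borel_measurable M"
  shows "lnorm M p (\<lambda>x. k * f x) = k * lnorm M p f"
  using exponent_pos[OF assms(1,2)] assms(2)
  by (simp add: lnorm_finite epow_mult nn_integral_cmult epow_inverse_exp)

lemma lnorm_top_mult: "lnorm M top (\<lambda>x. f x * g x) \<le> lnorm M top f * lnorm M top g"
proof (rule lnorm_top_leI)
  show "AE x in M. f x * g x \<le> lnorm M top f * lnorm M top g"
    using AE_le_lnorm_top[of f M] AE_le_lnorm_top[of g M] by eventually_elim (rule mult_mono, auto)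
qed

lemma lnorm_cmult_le:
  assumes "1 \<le> p" and [measurable]: "f \<in> borel_measurable M"
  shows "lnorm M p (\<lambda>x. k * f x) \<le> k * lnorm M p f"
proof (cases "p = top")
  case True
  have "lnorm M top (\<lambda>x. k) \<le> k" by (intro lnorm_top_leI) simp
  with True show ?thesis
    using order_trans[OF lnorm_top_mult[of M "\<lambda>x. k" f] mult_right_mono[of _ k "lnorm M top f"]] by simp
qed (simp add: lnorm_cmult assms)

lemma lnorm_Holder_top:
  assumes "1 \<le> p" and [measurable]: "f \<in> borel_measurable M" "g \<in> borel_measurable M"
  shows "lnorm M p (\<lambda>x. f x * g x) \<le> lnorm M top f * lnorm M p g"
proof -
  have "AE x in M. f x * g x \<le> lnorm M top f * g x"
    using AE_le_lnorm_top[of f M] by eventually_elim (rule mult_right_mono, auto)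
  then have "lnorm M p (\<lambda>x. f x * g x) \<le> lnorm M p (\<lambda>x. lnorm M top f * g x)"
    by (rule lnorm_mono_AE[OF assms(1)])
  also have "\<dots> \<le> lnorm M top f * lnorm M p g"
    by (rule lnorm_cmult_le) (use assms in auto)
  finally show ?thesis .
qed

text \<open>Reciprocal exponents are kept as real numbers, so that
  \<open>1 / \<infinity> = 0\<close> is an ordinary value and the relations between exponents become
  linear arithmetic.\<close>

definition rexp :: "ennreal \<Rightarrow> real" where "rexp p = enn2real (inverse p)"

lemma rexp_top [simp]: "rexp top = 0"
  by (simp add: rexp_def)

lemma rexp_finite: "1 \<le> p \<Longrightarrow> p \<noteq> top \<Longrightarrow> rexp p = 1 / enn2real p"
  by (cases p) (auto simp: rexp_def inverse_ennreal divide_inverse)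

lemma rexp_nonneg [simp]: "0 \<le> rexp p"
  by (simp add: rexp_def)

lemma rexp_pos: "1 \<le> p \<Longrightarrow> p \<noteq> top \<Longrightarrow> 0 < rexp p"
  using exponent_pos[of p] by (simp add: rexp_finite)

lemma rexp_eq_0_iff: "1 \<le> p \<Longrightarrow> rexp p = 0 \<longleftrightarrow> p = top"
  using rexp_pos[of p] by (cases "p = top") auto

definition Holder_triple :: "ennreal \<Rightarrow> ennreal \<Rightarrow> ennreal \<Rightarrow> bool" where
  "Holder_triple p0 p1 p2 \<longleftrightarrow> 1 \<le> p0 \<and> 1 \<le> p1 \<and> 1 \<le> p2 \<and> rexp p0 = rexp p1 + rexp p2"

lemma Holder_tripleI:
  assumes "1 \<le> p0" "1 \<le> p1" "1 \<le> p2" "inverse p0 = inverse p1 + inverse p2"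
  shows "Holder_triple p0 p1 p2"
proof -
  have "inverse p < top" if "1 \<le> p" for p :: ennreal
    using that by (cases p) (auto simp: inverse_ennreal)
  then show ?thesis
    using assms by (simp add: Holder_triple_def rexp_def enn2real_plus)
qed

lemma Holder_tripleD:
  assumes "Holder_triple p0 p1 p2"
  shows "1 \<le> p0" "1 \<le> p1" "1 \<le> p2" "rexp p0 = rexp p1 + rexp p2"
    "p0 = top \<longleftrightarrow> p1 = top \<and> p2 = top"
proof -
  show 1: "1 \<le> p0" "1 \<le> p1" "1 \<le> p2" "rexp p0 = rexp p1 + rexp p2"
    using assms by (auto simp: Holder_triple_def)
  show "p0 = top \<longleftrightarrow> p1 = top \<and> p2 = top"
    using 1 rexp_eq_0_iff[of p0] rexp_eq_0_iff[of p1] rexp_eq_0_iff[of p2]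
      rexp_nonneg[of p1] rexp_nonneg[of p2] by (auto simp del: rexp_nonneg)
qed

lemma rexp_inject: "1 \<le> p \<Longrightarrow> 1 \<le> q \<Longrightarrow> rexp p = rexp q \<Longrightarrow> p = q"
  by (cases p; cases q) (auto simp: rexp_def inverse_ennreal)

lemma Holder_triple_top: "Holder_triple p0 top p2 \<Longrightarrow> p0 = p2" "Holder_triple p0 p1 top \<Longrightarrow> p0 = p1"
  by (auto simp: Holder_triple_def intro: rexp_inject)

text \<open>With \<open>\<theta> = P0 / P1\<close> the relation between the exponents says
  \<open>1 - \<theta> = P0 / P2\<close>, so the weighted form applies to \<open>f^P1\<close> and
  \<open>g^P2\<close>. If \<open>p1\<close> or \<open>p2\<close> is infinite, an essential supremum
  is pulled out instead.\<close>

lemma lnorm_Holder: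
  assumes c: "Holder_triple p0 p1 p2" and [measurable]: "f \<in> borel_measurable M" "g \<in> borel_measurable M"
  shows "lnorm M p0 (\<lambda>x. f x * g x) \<le> lnorm M p1 f * lnorm M p2 g"
proof -
  note c' = Holder_tripleD[OF c]
  consider "p1 = top" | "p2 = top" | "p1 \<noteq> top" "p2 \<noteq> top" by blast
  then show ?thesis
  proof cases
    case 1
    then show ?thesis using c Holder_triple_top(1) c' lnorm_Holder_top[of p2 f M g] by auto
  next
    case 2
    then show ?thesis using c Holder_triple_top(2)[of p0 p1] c' lnorm_Holder_top[of p1 g M f]
      by (auto simp: mult.commute)
  next
    case 3
    define P0 P1 P2 where "P0 = enn2real p0" and "P1 = enn2real p1" and "P2 = enn2real p2"
    have fin: "p0 \<noteq> top" using c'(5) 3 by auto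
    have P: "0 < P0" "0 < P1" "0 < P2"
      using exponent_pos[of p0] exponent_pos[of p1] exponent_pos[of p2] 3 c' fin
      by (auto simp: P0_def P1_def P2_def)
    have rel: "1 / P0 = 1 / P1 + 1 / P2"
      using c' 3 fin by (simp add: rexp_finite P0_def P1_def P2_def)
    define \<theta> where "\<theta> = P0 / P1"
    have th1: "1 - \<theta> = P0 / P2"
      using rel P by (simp add: \<theta>_def field_simps)
    have th: "0 < \<theta>" "\<theta> < 1"
      using divide_pos_pos[OF P(1,2)] divide_pos_pos[OF P(1,3)] th1 \<theta>_def by linarith+
    have "epow (f x * g x) P0 = epow (epow (f x) P1) \<theta> * epow (epow (g x) P2) (1 - \<theta>)" for x
      using P by (simp add: epow_mult epow_epow th1) (simp add: \<theta>_def)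
    then have "(\<integral>\<^sup>+x. epow (f x * g x) P0 \<partial>M) \<le>
        epow (\<integral>\<^sup>+x. epow (f x) P1 \<partial>M) \<theta> * epow (\<integral>\<^sup>+x. epow (g x) P2 \<partial>M) (1 - \<theta>)"
      using nn_integral_Holder_theta[of "\<lambda>x. epow (f x) P1" M "\<lambda>x. epow (g x) P2" \<theta>] th by simp
    then have "epow (\<integral>\<^sup>+x. epow (f x * g x) P0 \<partial>M) (1 / P0) \<le>
        epow (epow (\<integral>\<^sup>+x. epow (f x) P1 \<partial>M) \<theta> * epow (\<integral>\<^sup>+x. epow (g x) P2 \<partial>M) (1 - \<theta>)) (1 / P0)"
      using P by (intro epow_mono) auto
    also have "\<dots> = lnorm M p1 f * lnorm M p2 g"
      using P 3 by (simp add: epow_mult epow_epow lnorm_finite th1 P1_def[symmetric] P2_def[symmetric])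
        (simp add: \<theta>_def)
    finally show ?thesis using fin by (simp add: lnorm_finite P0_def)
  qed
qed

lemma lnorm_monotone_convergence:
  assumes p: "1 \<le> p" and inc: "\<And>x. incseq (\<lambda>n. f n x)"
    and [measurable]: "\<And>n::nat. f n \<in> borel_measurable M"
  shows "lnorm M p (\<lambda>x. SUP n. f n x) = (SUP n. lnorm M p (f n))"
proof (cases "p = top")
  case True
  have "AE x in M. \<forall>n. f n x \<le> lnorm M top (f n)"
    by (subst AE_all_countable) (auto intro: AE_le_lnorm_top)
  then have "AE x in M. (SUP n. f n x) \<le> (SUP n. lnorm M top (f n))"
    by eventually_elim (rule SUP_mono, auto)
  then have "lnorm M p (\<lambda>x. SUP n. f n x) \<le> (SUP n. lnorm M p (f n))"
    using True by (auto intro: lnorm_top_leI)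
  moreover have "(SUP n. lnorm M p (f n)) \<le> lnorm M p (\<lambda>x. SUP n. f n x)"
    using p by (intro SUP_least lnorm_mono) (auto intro: SUP_upper)
  ultimately show ?thesis by simp
next
  case False
  have P: "0 < enn2real p" using exponent_pos[OF p False] by simp
  have "(\<integral>\<^sup>+x. (SUP n. epow (f n x) (enn2real p)) \<partial>M) = (SUP n. \<integral>\<^sup>+x. epow (f n x) (enn2real p) \<partial>M)"
    using inc by (intro nn_integral_monotone_convergence_SUP)
      (auto simp: incseq_def le_fun_def intro!: epow_mono)
  then show ?thesis
    using False P by (simp add: lnorm_finite epow_SUP)
qed

lemma lnorm_0 [simp]: "1 \<le> p \<Longrightarrow> lnorm M p (\<lambda>x. 0) = 0"
  by (cases "p = top") (auto simp: lnorm_finite le_zero_eq[symmetric] intro: lnorm_top_leI simp del: le_zero_eq)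

section \<open>The maximal function of a finite family of balls\<close>

lemma layer_cake_real:
  assumes "0 < u" "0 \<le> x"
  shows "(\<integral>\<^sup>+s. ennreal (u * s powr (u - 1)) * indicator {0<..<x} s \<partial>lborel) = ennreal (x powr u)"
proof -
  have "((\<lambda>s. s powr (u - 1)) has_integral (x powr u / u)) {0..x}"
    using has_integral_powr_from_0[of "u - 1" x] assms by simp
  then have "((\<lambda>s. u * s powr (u - 1)) has_integral (x powr u)) {0..x}"
    using has_integral_mult_right[of "\<lambda>s. s powr (u - 1)" "x powr u / u" "{0..x}" u] assms by simp
  then have "((\<lambda>s. u * s powr (u - 1)) has_integral (x powr u)) {0<..<x}"
    using has_integral_Icc_iff_Ioo by blast
  then have "(\<integral>\<^sup>+s. ennreal (indicator {0<..<x} s * (u * s powr (u - 1))) \<partial>lborel) = ennreal (x powr u)"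
    using assms by (intro nn_integral_has_integral_lebesgue) auto
  moreover have "ennreal (indicator {0<..<x} s * (u * s powr (u - 1)))
      = ennreal (u * s powr (u - 1)) * indicator {0<..<x} s" for s
    by (auto simp: indicator_def)
  ultimately show ?thesis by simp
qed

lemma layer_cake:
  assumes "0 < u"
  shows "epow y u = (\<integral>\<^sup>+s. ennreal (u * s powr (u - 1)) * indicator {s. 0 < s \<and> ennreal s < y} s \<partial>lborel)"
proof (cases y)
  case (real x)
  then have "{s. 0 < s \<and> ennreal s < y} = {0<..<x}"
    by (auto simp: ennreal_less_iff)
  then show ?thesis using layer_cake_real[OF assms real(1)] real by simp
next
  case top
  let ?I = "\<integral>\<^sup>+s. ennreal (u * s powr (u - 1)) * indicator {s. 0 < s \<and> ennreal s < y} s \<partial>lborel"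
  have "of_nat n \<le> ?I" for n
  proof -
    \<comment> \<open>The cut-off is chosen so that the integral up to \<open>x\<close> is exactly
      \<open>n\<close>; hence the full integral exceeds every \<open>n\<close>.\<close>
    define x where "x = real n powr (1 / u)"
    have "of_nat n = ennreal (x powr u)"
      using assms by (simp add: x_def powr_powr ennreal_of_nat_eq_real_of_nat)
    also have "\<dots> = (\<integral>\<^sup>+s. ennreal (u * s powr (u - 1)) * indicator {0<..<x} s \<partial>lborel)"
      using assms by (subst layer_cake_real) (auto simp: x_def)
    also have "\<dots> \<le> ?I"
      using top by (intro nn_integral_mono) (auto simp: indicator_def)
    finally show ?thesis .
  qed
  then have "(SUP n. of_nat n) \<le> ?I" by (intro SUP_least) auto
  then have "?I = top" by (simp add: ennreal_SUP_of_nat_eq_top top_unique)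
  then show ?thesis using top by simp
qed

section \<open>Averages over balls and the maximal operator\<close>

definition avg :: "'a::euclidean_space set \<Rightarrow> ('a \<Rightarrow> ennreal) \<Rightarrow> ennreal" where
  "avg S h = (\<integral>\<^sup>+x. h x * indicator S x \<partial>lborel) / emeasure lborel S"

lemma emeasure_ball_pos: "0 < r \<Longrightarrow> 0 < emeasure lborel (ball (z::'a::euclidean_space) r)"
  by (simp add: emeasure_ball zero_less_mult_iff)

lemma emeasure_ball_scale:
  "0 \<le> r \<Longrightarrow> 0 \<le> k \<Longrightarrow> emeasure lborel (ball (z::'a::euclidean_space) (k * r))
    = ennreal (k ^ DIM('a)) * emeasure lborel (ball (w::'a) r)"
  by (simp add: emeasure_ball power_mult_distrib ennreal_mult[symmetric] mult_ac)

lemma avg_mult_measure: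
  assumes "0 < emeasure lborel S" "emeasure lborel S < top"
  shows "avg S h * emeasure lborel S = (\<integral>\<^sup>+x. h x * indicator S x \<partial>lborel)"
  using assms unfolding avg_def by (simp add: ennreal_divide_times ennreal_divide_self)

text \<open>An arbitrary sequence of balls. The Whitney geometry enters only through a later
  interpretation, so Hoelder's inequality and the multiplier theorem for sequences hold for every
  such family.\<close>

locale ball_family =
  fixes c :: "nat \<Rightarrow> 'a::euclidean_space" and \<rho> :: "nat \<Rightarrow> real"
  assumes \<rho>_pos: "0 < \<rho> i"
begin

abbreviation B :: "nat \<Rightarrow> 'a set" where "B i \<equiv> ball (c i) (\<rho> i)"

abbreviation vol :: "'a set \<Rightarrow> ennreal" where "vol \<equiv> emeasure lborel"

lemma measurable_B [measurable]: "B i \<in> sets borel"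
  by simp

lemma vol_B: "0 < vol (B i)" "vol (B i) < top"
  using emeasure_ball_pos[OF \<rho>_pos, of "c i" i] emeasure_lborel_ball_finite[of "c i" "\<rho> i"] by auto

text \<open>The uncentred Hardy-Littlewood maximal operator restricted to the balls of a finite
  family. Finiteness makes it measurable and bounds the radii, while the constants below do not
  depend on \<open>J\<close>.\<close>

definition maxf :: "nat set \<Rightarrow> ('a \<Rightarrow> ennreal) \<Rightarrow> 'a \<Rightarrow> ennreal" where
  "maxf J h x = (SUP i\<in>J. avg (B i) h * indicator (B i) x)"

lemma measurable_maxf [measurable]: "finite J \<Longrightarrow> maxf J h \<in> borel_measurable borel"
  unfolding maxf_def by (intro borel_measurable_SUP countable_finite) measurable

lemma avg_le_maxf: "i \<in> J \<Longrightarrow> x \<in> B i \<Longrightarrow> avg (B i) h \<le> maxf J h x"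
  unfolding maxf_def by (rule SUP_upper2[of i]) auto

text \<open>The part of \<open>h\<close> below \<open>l / 2\<close> adds at most
  \<open>l / 2\<close> to any average, so a ball with average above \<open>l\<close> has volume at
  most \<open>2 / l\<close> times the integral of the remaining part. A disjoint Vitali subfamily,
  enlarged five times, covers the level set. Keeping only the large values of \<open>h\<close> is
  what the strong type estimate needs.\<close>

lemma maxf_weak_type:
  assumes J: "finite J" and h [measurable]: "h \<in> borel_measurable borel" and l: "0 < l"
  shows "vol {x. ennreal l < maxf J h x}
    \<le> ennreal (5 ^ DIM('a) * 2 / l) * (\<integral>\<^sup>+x. h x * indicator {x. ennreal (l / 2) < h x} x \<partial>lborel)"
proof -
  define J' where "J' = {i\<in>J. ennreal l < avg (B i) h}"
  define h' where "h' x = h x * indicator {x. ennreal (l / 2) < h x} x" for x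
  have [measurable]: "h' \<in> borel_measurable borel" unfolding h'_def by measurable
  have "{x. ennreal l < maxf J h x} \<subseteq> (\<Union>i\<in>J'. B i)"
    by (auto simp: maxf_def less_SUP_iff J'_def indicator_def split: if_splits)
  \<comment> \<open>The Vitali lemma asks for a common bound on the radii; the sum over the finite
    \<open>J\<close> is one.\<close>
  moreover have "\<And>i. i \<in> J' \<Longrightarrow> 0 < \<rho> i \<and> \<rho> i \<le> (\<Sum>i\<in>J. \<rho> i)"
    using J \<rho>_pos by (auto simp: J'_def less_imp_le intro!: member_le_sum)
  ultimately obtain C where C: "C \<subseteq> J'" "pairwise (\<lambda>i j. disjnt (B i) (B j)) C"
      "{x. ennreal l < maxf J h x} \<subseteq> (\<Union>i\<in>C. ball (c i) (5 * \<rho> i))"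
    by (rule Vitali_covering_lemma_balls) blast
  have finC: "finite C" using C(1) J by (auto simp: J'_def intro: finite_subset)
  have vol_i: "vol (B i) \<le> ennreal (2 / l) * (\<integral>\<^sup>+x. h' x * indicator (B i) x \<partial>lborel)" if "i \<in> C" for i
  proof -
    obtain v where v: "vol (B i) = ennreal v" "0 < v"
      using vol_B[of i] by (cases "vol (B i)") auto
    have "ennreal l < avg (B i) h" using that C(1) by (auto simp: J'_def)
    then have "ennreal l * vol (B i) \<le> avg (B i) h * vol (B i)"
      by (intro mult_right_mono) auto
    also have "\<dots> = (\<integral>\<^sup>+x. h x * indicator (B i) x \<partial>lborel)"
      using vol_B by (intro avg_mult_measure)
    also have "\<dots> \<le> (\<integral>\<^sup>+x. h' x * indicator (B i) x + ennreal (l / 2) * indicator (B i) x \<partial>lborel)"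
      by (intro nn_integral_mono) (auto simp: h'_def indicator_def)
    also have "\<dots> = (\<integral>\<^sup>+x. h' x * indicator (B i) x \<partial>lborel) + ennreal (l / 2) * vol (B i)"
      by (subst nn_integral_add) (measurable, simp add: nn_integral_cmult_indicator)
    finally have le: "ennreal l * vol (B i) \<le> (\<integral>\<^sup>+x. h' x * indicator (B i) x \<partial>lborel) + ennreal (l / 2) * vol (B i)" .
    show ?thesis
    proof (cases "(\<integral>\<^sup>+x. h' x * indicator (B i) x \<partial>lborel)")
      case (real y)
      then have "ennreal (l * v) \<le> ennreal (y + l / 2 * v)"
        using le v l by (simp add: ennreal_mult[symmetric])
      then have "v \<le> 2 / l * y"
        using real l v by (subst (asm) ennreal_le_iff) (auto simp: field_simps)
      then show ?thesis
        using v real l by (auto simp: ennreal_mult[symmetric] intro: ennreal_leI)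
    qed (use l in \<open>auto simp: ennreal_mult_top\<close>)
  qed
  have "vol {x. ennreal l < maxf J h x} \<le> vol (\<Union>i\<in>C. ball (c i) (5 * \<rho> i))"
    using C(3) finC by (intro emeasure_mono) auto
  also have "\<dots> \<le> (\<Sum>i\<in>C. vol (ball (c i) (5 * \<rho> i)))"
    using finC by (intro emeasure_subadditive_finite) auto
  also have "\<dots> = ennreal (5 ^ DIM('a)) * (\<Sum>i\<in>C. vol (B i))"
    using \<rho>_pos emeasure_ball_scale[of "\<rho> _" 5] by (auto simp: sum_distrib_left less_imp_le intro!: sum.cong)
  also have "\<dots> \<le> ennreal (5 ^ DIM('a)) * (\<Sum>i\<in>C. ennreal (2 / l) * (\<integral>\<^sup>+x. h' x * indicator (B i) x \<partial>lborel))"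
    by (intro mult_left_mono sum_mono vol_i) auto
  also have "\<dots> = ennreal (5 ^ DIM('a)) * (ennreal (2 / l) * (\<integral>\<^sup>+x. (\<Sum>i\<in>C. h' x * indicator (B i) x) \<partial>lborel))"
    by (subst nn_integral_sum) (auto simp: sum_distrib_left)
  also have "(\<integral>\<^sup>+x. (\<Sum>i\<in>C. h' x * indicator (B i) x) \<partial>lborel) \<le> (\<integral>\<^sup>+x. h' x \<partial>lborel)"
  proof (intro nn_integral_mono)
    fix x
    have "disjoint_family_on B C"
      using C(2) by (auto simp: pairwise_def disjoint_family_on_def disjnt_def)
    then have "(\<Sum>i\<in>C. indicator (B i) x) = (indicator (\<Union>i\<in>C. B i) x :: ennreal)"
      using finC by (simp add: indicator_UN_disjoint)
    then show "(\<Sum>i\<in>C. h' x * indicator (B i) x) \<le> h' x"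
      by (simp add: sum_distrib_left[symmetric] indicator_def)
  qed
  finally show ?thesis
    using l by (simp add: h'_def mult.assoc[symmetric] ennreal_mult[symmetric] mult_left_mono)
qed

text \<open>Marcinkiewicz interpolation by hand: write the power as an integral over levels, insert
  the truncated weak type estimate and exchange the integrals. The level integral of
  \<open>s^(u-2)\<close> up to \<open>2 * h x\<close> converges at \<open>0\<close> because
  \<open>u > 1\<close> and produces the factor \<open>2^(u-1) / (u-1)\<close> in
  \<open>K\<close>.\<close>

lemma maxf_strong_type:
  assumes u: "1 < u"
  shows "\<exists>C>0. \<forall>J h. finite J \<longrightarrow> h \<in> borel_measurable borel \<longrightarrow>
    (\<integral>\<^sup>+x. epow (maxf J h x) u \<partial>lborel) \<le> ennreal C * (\<integral>\<^sup>+x. epow (h x) u \<partial>lborel)"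
proof -
  define K where "K = 5 ^ DIM('a) * 2 * (u / (u - 1)) * 2 powr (u - 1)"
  have "K > 0" using u by (simp add: K_def)
  moreover have "(\<integral>\<^sup>+x. epow (maxf J h x) u \<partial>lborel) \<le> ennreal K * (\<integral>\<^sup>+x. epow (h x) u \<partial>lborel)"
    if J: "finite J" and h [measurable]: "h \<in> borel_measurable borel" for J h
  proof -
    note [measurable] = measurable_maxf[OF J]
    let ?w = "\<lambda>s. ennreal (u * s powr (u - 1))"
    let ?A = "\<lambda>x. {s. 0 < s \<and> ennreal s < maxf J h x}"
    have "(\<integral>\<^sup>+x. epow (maxf J h x) u \<partial>lborel) = (\<integral>\<^sup>+x. (\<integral>\<^sup>+s. ?w s * indicator (?A x) s \<partial>lborel) \<partial>lborel)"
      using u by (intro nn_integral_cong layer_cake) auto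
    also have "\<dots> = (\<integral>\<^sup>+s. (\<integral>\<^sup>+x. ?w s * indicator (?A x) s \<partial>lborel) \<partial>lborel)"
      by (rule lborel_pair.Fubini') (simp add: indicator_def, measurable)
    also have "\<dots> \<le> (\<integral>\<^sup>+s. (\<integral>\<^sup>+x. ennreal (5 ^ DIM('a) * 2 * u * s powr (u - 2)) * h x
        * indicator {s. 0 < s \<and> ennreal (s / 2) < h x} s \<partial>lborel) \<partial>lborel)"
    proof (rule nn_integral_mono)
      fix s :: real
      show "(\<integral>\<^sup>+x. ?w s * indicator (?A x) s \<partial>lborel) \<le> (\<integral>\<^sup>+x. ennreal (5 ^ DIM('a) * 2 * u * s powr (u - 2)) * h x
        * indicator {s. 0 < s \<and> ennreal (s / 2) < h x} s \<partial>lborel)"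
      proof (cases "0 < s")
        case True
        have "(\<integral>\<^sup>+x. ?w s * indicator (?A x) s \<partial>lborel) = (\<integral>\<^sup>+x. ?w s * indicator {x. ennreal s < maxf J h x} x \<partial>lborel)"
          using True by (intro nn_integral_cong) (auto simp: indicator_def)
        also have "\<dots> = ?w s * vol {x. ennreal s < maxf J h x}"
          by (subst nn_integral_cmult_indicator) auto
        also have "\<dots> \<le> ?w s * (ennreal (5 ^ DIM('a) * 2 / s) * (\<integral>\<^sup>+x. h x * indicator {x. ennreal (s / 2) < h x} x \<partial>lborel))"
          by (intro mult_left_mono maxf_weak_type J h True) auto
        also have "\<dots> = (\<integral>\<^sup>+x. ennreal (u * s powr (u - 1) * (5 ^ DIM('a) * 2 / s)) * (h x * indicator {x. ennreal (s / 2) < h x} x) \<partial>lborel)"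
          using u True by (subst nn_integral_cmult) (auto simp: mult.assoc[symmetric] ennreal_mult[symmetric])
        also have "u * s powr (u - 1) * (5 ^ DIM('a) * 2 / s) = 5 ^ DIM('a) * 2 * u * s powr (u - 2)"
          using True powr_diff[of s "u - 1" 1] by (simp add: mult_ac)
        finally show ?thesis using True by (simp add: mult.assoc indicator_def)
      qed simp
    qed
    also have "\<dots> = (\<integral>\<^sup>+x. (\<integral>\<^sup>+s. ennreal (5 ^ DIM('a) * 2 * u * s powr (u - 2)) * h x
        * indicator {s. 0 < s \<and> ennreal (s / 2) < h x} s \<partial>lborel) \<partial>lborel)"
      by (rule lborel_pair.Fubini'[symmetric]) (simp add: indicator_def, measurable)
    also have "\<dots> = (\<integral>\<^sup>+x. ennreal K * epow (h x) u \<partial>lborel)"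
    proof (intro nn_integral_cong)
      fix x
      \<comment> \<open>In this form the inner integral is the layer cake formula with exponent
        \<open>u - 1\<close> at height \<open>2 * h x\<close>.\<close>
      have eq: "{s. 0 < s \<and> ennreal (s / 2) < h x} = {s. 0 < s \<and> ennreal s < 2 * h x}"
      proof (cases "h x")
        case (real r)
        have "2 * ennreal r = ennreal (2 * r)" using real by (simp add: ennreal_mult)
        then show ?thesis using real by (auto simp: ennreal_less_iff)
      qed (auto simp: ennreal_mult_top)
      have "(\<integral>\<^sup>+s. ennreal (5 ^ DIM('a) * 2 * u * s powr (u - 2)) * h x * indicator {s. 0 < s \<and> ennreal (s / 2) < h x} s \<partial>lborel)
        = (\<integral>\<^sup>+s. (ennreal (5 ^ DIM('a) * 2 * (u / (u - 1))) * h x) * (ennreal ((u - 1) * s powr (u - 1 - 1)) * indicator {s. 0 < s \<and> ennreal s < 2 * h x} s) \<partial>lborel)"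
        unfolding eq
      proof (intro nn_integral_cong)
        fix s
        have "ennreal (5 ^ DIM('a) * 2 * u * s powr (u - 2)) = ennreal (5 ^ DIM('a) * 2 * (u / (u - 1))) * ennreal ((u - 1) * s powr (u - 1 - 1))"
          using u by (subst ennreal_mult[symmetric]) auto
        then show "ennreal (5 ^ DIM('a) * 2 * u * s powr (u - 2)) * h x * indicator {s. 0 < s \<and> ennreal s < 2 * h x} s
          = (ennreal (5 ^ DIM('a) * 2 * (u / (u - 1))) * h x) * (ennreal ((u - 1) * s powr (u - 1 - 1)) * indicator {s. 0 < s \<and> ennreal s < 2 * h x} s)"
          by (simp add: mult_ac)
      qed
      also have "\<dots> = (ennreal (5 ^ DIM('a) * 2 * (u / (u - 1))) * h x) * epow (2 * h x) (u - 1)"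
        using u by (subst nn_integral_cmult) (auto simp: layer_cake)
      also have "\<dots> = ennreal (5 ^ DIM('a) * 2 * (u / (u - 1))) * ennreal (2 powr (u - 1)) * (h x * epow (h x) (u - 1))"
        using epow_ennreal[of 2 "u - 1"] by (simp add: epow_mult mult_ac)
      also have "h x * epow (h x) (u - 1) = epow (h x) u"
        using epow_add[of "h x" 1 "u - 1"] by simp
      also have "ennreal (5 ^ DIM('a) * 2 * (u / (u - 1))) * ennreal (2 powr (u - 1)) = ennreal K"
        using u by (simp add: K_def ennreal_mult[symmetric])
      finally show "(\<integral>\<^sup>+s. ennreal (5 ^ DIM('a) * 2 * u * s powr (u - 2)) * h x * indicator {s. 0 < s \<and> ennreal (s / 2) < h x} s \<partial>lborel)
        = ennreal K * epow (h x) u" .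
    qed
    also have "\<dots> = ennreal K * (\<integral>\<^sup>+x. epow (h x) u \<partial>lborel)"
      by (simp add: nn_integral_cmult)
    finally show ?thesis .
  qed
  ultimately show ?thesis by blast
qed

end

section \<open>Sparse sets and changes of aperture\<close>

lemma sum_ennreal_less_top: "finite J \<Longrightarrow> (\<And>i. i \<in> J \<Longrightarrow> f i < top) \<Longrightarrow> (\<Sum>i\<in>J. f i) < (top :: ennreal)"
  by (simp add: less_top)

lemma SUP_le_sum_ennreal:
  fixes f :: "'i \<Rightarrow> ennreal"
  assumes "finite J" shows "(SUP i\<in>J. f i) \<le> (\<Sum>i\<in>J. f i)"
  using assms by (intro SUP_least member_le_sum) auto

text \<open>Take the least value whose sublevel set fills half of \<open>S\<close>. By minimality
  the points with strictly smaller values fill less than half, so the superlevel set fills the rest.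
  Finiteness of the range makes the least value exist.\<close>

lemma median_exists:
  fixes f :: "'a::euclidean_space \<Rightarrow> ennreal"
  assumes S [measurable]: "S \<in> sets borel" and fS: "0 < emeasure lborel S" "emeasure lborel S < top"
    and f [measurable]: "f \<in> borel_measurable borel" and fin: "finite (f ` S)"
  shows "\<exists>m\<in>f ` S. emeasure lborel S \<le> 2 * emeasure lborel {x\<in>S. f x \<le> m} \<and>
    emeasure lborel S \<le> 2 * emeasure lborel {x\<in>S. m \<le> f x}"
proof -
  let ?v = "emeasure lborel"
  define T where "T = {t\<in>f ` S. ?v S \<le> 2 * ?v {x\<in>S. f x \<le> t}}"
  have ne: "f ` S \<noteq> {}" using fS by auto
  have dbl: "?v S \<le> 2 * ?v S" using mult_right_mono[of 1 2 "?v S"] by simp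
  have "{x\<in>S. f x \<le> Max (f ` S)} = S" using fin by auto
  then have "Max (f ` S) \<in> T" using fin ne dbl by (auto simp: T_def)
  moreover have finT: "finite T" using fin by (auto simp: T_def)
  ultimately have mT: "Min T \<in> T" by (metis Min_in empty_iff)
  define m where "m = Min T"
  have m: "m \<in> f ` S" "?v S \<le> 2 * ?v {x\<in>S. f x \<le> m}"
    using mT by (auto simp: m_def T_def)
  have "?v S \<le> 2 * ?v {x\<in>S. m \<le> f x}"
  proof (cases "{x\<in>S. f x < m} = {}")
    case True
    then have "{x\<in>S. m \<le> f x} = S" by (auto simp: not_less)
    then show ?thesis using dbl by simp
  next
    case False
    \<comment> \<open>The value preceding \<open>m\<close>: the strict sublevel set of
      \<open>m\<close> is the sublevel set of \<open>t\<close>, and \<open>t\<close> fails the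
      defining condition of \<open>T\<close>.\<close>
    define t where "t = Max {y\<in>f ` S. y < m}"
    have fin': "finite {y\<in>f ` S. y < m}" using fin by auto
    have "t \<in> {y\<in>f ` S. y < m}" unfolding t_def by (rule Max_in[OF fin']) (use False in auto)
    then have t: "t \<in> f ` S" "t < m" by auto
    have "y \<le> t" if "y \<in> f ` S" "y < m" for y
      unfolding t_def by (rule Max_ge[OF fin']) (use that in auto)
    then have eq: "{x\<in>S. f x < m} = {x\<in>S. f x \<le> t}" using t by auto
    have "t \<notin> T" using t Min_le[OF finT, of t] by (auto simp: m_def)
    then have lt: "2 * ?v {x\<in>S. f x < m} < ?v S" using t eq by (auto simp: T_def not_le)
    have "{x\<in>S. f x < m} \<union> {x\<in>S. m \<le> f x} = S" by auto
    then have sum: "?v {x\<in>S. f x < m} + ?v {x\<in>S. m \<le> f x} = ?v S"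
      by (subst plus_emeasure) auto
    have "?v {x\<in>S. f x < m} \<le> ?v S" "?v {x\<in>S. m \<le> f x} \<le> ?v S"
      by (auto intro!: emeasure_mono)
    then obtain a b where ab: "?v {x\<in>S. f x < m} = ennreal a" "0 \<le> a" "?v {x\<in>S. m \<le> f x} = ennreal b" "0 \<le> b"
      using fS(2) by (cases "?v {x\<in>S. f x < m}"; cases "?v {x\<in>S. m \<le> f x}") auto
    have two: "2 * ennreal z = ennreal (2 * z)" if "0 \<le> z" for z using that by (simp add: ennreal_mult)
    have "ennreal (2 * a) < ennreal (a + b)"
      using lt sum ab by (simp add: two)
    then have "a + b \<le> 2 * b" using ab by (subst (asm) ennreal_less_iff) auto
    then show ?thesis
      using sum ab by (simp add: two sum[symmetric] ennreal_plus[symmetric] ennreal_leI del: ennreal_plus)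
  qed
  then show ?thesis using m by blast
qed

context ball_family
begin

text \<open>Unlike in the usual notion of a sparse family, the sets \<open>E i\<close> may overlap;
  only the proportion \<open>\<eta>\<close> matters.\<close>

definition sparse_on :: "nat set \<Rightarrow> real \<Rightarrow> (nat \<Rightarrow> 'a set) \<Rightarrow> bool" where
  "sparse_on J \<eta> E \<longleftrightarrow> (\<forall>i\<in>J. E i \<in> sets borel \<and> E i \<subseteq> B i \<and> ennreal \<eta> * vol (B i) \<le> vol (E i))"

lemma sparse_onD:
  assumes "sparse_on J \<eta> E" "i \<in> J"
  shows "E i \<in> sets borel" "E i \<subseteq> B i" "ennreal \<eta> * vol (B i) \<le> vol (E i)"
  using assms by (auto simp: sparse_on_def)

lemma vol_B_le_sparse:
  assumes "sparse_on J \<eta> E" "i \<in> J" "0 < \<eta>"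
  shows "vol (B i) \<le> ennreal (1 / \<eta>) * vol (E i)"
proof -
  have "ennreal (1 / \<eta>) * (ennreal \<eta> * vol (B i)) \<le> ennreal (1 / \<eta>) * vol (E i)"
    using sparse_onD[OF assms(1,2)] by (intro mult_left_mono) auto
  then show ?thesis using assms(3) by (simp add: mult.assoc[symmetric] ennreal_mult[symmetric])
qed

lemma vol_sparse:
  assumes "sparse_on J \<eta> E" "i \<in> J" "0 < \<eta>"
  shows "0 < vol (E i)" "vol (E i) < top"
proof -
  have "0 < ennreal \<eta> * vol (B i)" using assms(3) vol_B by (simp add: ennreal_zero_less_mult_iff)
  then show "0 < vol (E i)" using sparse_onD(3)[OF assms(1,2)] by (rule less_le_trans)
  have "vol (E i) \<le> vol (B i)" using sparse_onD[OF assms(1,2)] by (intro emeasure_mono) auto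
  then show "vol (E i) < top" using vol_B(2) by (rule le_less_trans)
qed

lemma sparse_half_on:
  assumes "sparse_on J \<eta> E" "0 < \<eta>" "\<And>i. i \<in> J \<Longrightarrow> E' i \<in> sets borel" "\<And>i. i \<in> J \<Longrightarrow> E' i \<subseteq> E i"
    "\<And>i. i \<in> J \<Longrightarrow> vol (E i) \<le> 2 * vol (E' i)"
  shows "sparse_on J (\<eta> / 2) E'"
  unfolding sparse_on_def
proof (intro ballI conjI)
  fix i assume i: "i \<in> J"
  show "E' i \<in> sets borel" "E' i \<subseteq> B i" using assms(3,4)[OF i] sparse_onD[OF assms(1) i] by auto
  have "ennreal \<eta> * vol (B i) \<le> 2 * vol (E' i)"
    using sparse_onD(3)[OF assms(1) i] assms(5)[OF i] by (rule order_trans)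
  then have "ennreal (1 / 2) * (ennreal \<eta> * vol (B i)) \<le> ennreal (1 / 2) * (2 * vol (E' i))"
    by (intro mult_left_mono) auto
  moreover have "ennreal (1 / 2) * 2 = 1" using ennreal_mult[of "1 / 2" 2] by simp
  moreover have "ennreal (\<eta> / 2) = ennreal (1 / 2) * ennreal \<eta>"
    using ennreal_mult[of "1 / 2" \<eta>] assms(2) by simp
  ultimately show "ennreal (\<eta> / 2) * vol (B i) \<le> vol (E' i)"
    by (metis mult.assoc mult_1)
qed

text \<open>The value \<open>b\<^sub>i\<close> is attained on a fixed proportion of \<open>B\<^sub>i\<close>, so a power of the left-hand side is dominated
  by the maximal function of that power of the right-hand side.\<close>
lemma sparse_SUP:
  assumes \<eta>: "0 < \<eta>" and p: "0 < p"
  shows "\<exists>C>0. \<forall>J E b. finite J \<longrightarrow> sparse_on J \<eta> E \<longrightarrow>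
    (\<integral>\<^sup>+x. epow (SUP i\<in>J. b i * indicator (B i) x) p \<partial>lborel)
      \<le> ennreal C * (\<integral>\<^sup>+x. epow (SUP i\<in>J. b i * indicator (E i) x) p \<partial>lborel)"
proof -
  obtain C where C: "C > 0" "\<And>J h. finite J \<Longrightarrow> h \<in> borel_measurable borel \<Longrightarrow>
    (\<integral>\<^sup>+x. epow (maxf J h x) 2 \<partial>lborel) \<le> ennreal C * (\<integral>\<^sup>+x. epow (h x) 2 \<partial>lborel)"
    using maxf_strong_type[of 2] by auto
  have "(\<integral>\<^sup>+x. epow (SUP i\<in>J. b i * indicator (B i) x) p \<partial>lborel)
      \<le> ennreal ((1 / \<eta>) powr 2 * C) * (\<integral>\<^sup>+x. epow (SUP i\<in>J. b i * indicator (E i) x) p \<partial>lborel)"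
    if J: "finite J" and E: "sparse_on J \<eta> E" for J E and b :: "nat \<Rightarrow> ennreal"
  proof -
    define G where "G x = (SUP i\<in>J. b i * indicator (E i) x)" for x
    have [measurable]: "G \<in> borel_measurable borel"
      unfolding G_def using sparse_onD[OF E] J
      by (intro borel_measurable_SUP countable_finite) auto
    \<comment> \<open>The power \<open>p / 2\<close> moves the estimate to \<open>L^2\<close>, where
      the maximal operator is bounded, however small \<open>p\<close> is.\<close>
    define h where "h x = epow (G x) (p / 2)" for x
    have [measurable]: "h \<in> borel_measurable borel" unfolding h_def by measurable
    note [measurable] = measurable_maxf[OF J]
    have ba: "epow (b i) (p / 2) \<le> ennreal (1 / \<eta>) * avg (B i) h" if i: "i \<in> J" for i
    proof -
      have [measurable]: "E i \<in> sets borel" using sparse_onD[OF E i] by simp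
      have "epow (b i) (p / 2) * vol (B i) \<le> epow (b i) (p / 2) * (ennreal (1 / \<eta>) * vol (E i))"
        by (intro mult_left_mono vol_B_le_sparse[OF E i \<eta>]) auto
      also have "\<dots> = ennreal (1 / \<eta>) * (\<integral>\<^sup>+x. epow (b i) (p / 2) * indicator (E i) x \<partial>lborel)"
        by (subst nn_integral_cmult_indicator) (simp_all add: mult_ac)
      also have "\<dots> \<le> ennreal (1 / \<eta>) * (\<integral>\<^sup>+x. h x * indicator (B i) x \<partial>lborel)"
      proof (intro mult_left_mono nn_integral_mono)
        fix x
        show "epow (b i) (p / 2) * indicator (E i) x \<le> h x * indicator (B i) x"
        proof (cases "x \<in> E i")
          case True
          then have "b i \<le> G x" unfolding G_def by (intro SUP_upper2[OF i]) auto
          then show ?thesis using True sparse_onD(2)[OF E i] p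
            by (auto simp: h_def indicator_def intro!: epow_mono)
        qed simp
      qed simp
      also have "\<dots> = ennreal (1 / \<eta>) * avg (B i) h * vol (B i)"
        using vol_B by (simp add: avg_mult_measure mult.assoc)
      finally show ?thesis using vol_B[of i] by (simp add: ennreal_mult_le_mult_iff mult.commute[of _ "vol (B i)"])
    qed
    have pt: "epow (SUP i\<in>J. b i * indicator (B i) x) p \<le> ennreal ((1 / \<eta>) powr 2) * epow (maxf J h x) 2" for x
    proof -
      have "epow (SUP i\<in>J. b i * indicator (B i) x) (p / 2) \<le> ennreal (1 / \<eta>) * maxf J h x"
        using p
      proof (subst epow_SUP, simp, intro SUP_least)
        fix i assume i: "i \<in> J"
        show "epow (b i * indicator (B i) x) (p / 2) \<le> ennreal (1 / \<eta>) * maxf J h x"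
          using order_trans[OF ba[OF i] mult_left_mono[OF avg_le_maxf[OF i, of x h]]]
          by (cases "x \<in> B i") auto
      qed
      then have "epow (epow (SUP i\<in>J. b i * indicator (B i) x) (p / 2)) 2 \<le> epow (ennreal (1 / \<eta>) * maxf J h x) 2"
        by (rule epow_mono) simp
      then show ?thesis using \<eta> by (simp add: epow_epow epow_mult del: powr_numeral)
    qed
    have "(\<integral>\<^sup>+x. epow (SUP i\<in>J. b i * indicator (B i) x) p \<partial>lborel)
       \<le> (\<integral>\<^sup>+x. ennreal ((1 / \<eta>) powr 2) * epow (maxf J h x) 2 \<partial>lborel)"
      by (intro nn_integral_mono pt)
    also have "\<dots> = ennreal ((1 / \<eta>) powr 2) * (\<integral>\<^sup>+x. epow (maxf J h x) 2 \<partial>lborel)"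
      by (intro nn_integral_cmult) measurable
    also have "\<dots> \<le> ennreal ((1 / \<eta>) powr 2) * (ennreal C * (\<integral>\<^sup>+x. epow (h x) 2 \<partial>lborel))"
      by (intro mult_left_mono C J) measurable
    also have "\<dots> = ennreal ((1 / \<eta>) powr 2 * C) * (\<integral>\<^sup>+x. epow (G x) p \<partial>lborel)"
      using C(1) by (simp add: h_def epow_epow ennreal_mult mult.assoc)
    finally show ?thesis by (simp add: G_def)
  qed
  moreover have "0 < (1 / \<eta>) powr 2 * C" using \<eta> C by simp
  ultimately show ?thesis by blast
qed

text \<open>Real coefficients and a finite index set make the sum finite everywhere, as absorption
  requires, and give it finitely many values, as the median lemma requires.\<close>

definition lsum :: "nat set \<Rightarrow> (nat \<Rightarrow> 'a set) \<Rightarrow> (nat \<Rightarrow> real) \<Rightarrow> 'a \<Rightarrow> ennreal" where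
  "lsum J E b x = (\<Sum>i\<in>J. ennreal (b i) * indicator (E i) x)"

lemma measurable_lsum [measurable]:
  "(\<And>i. i \<in> J \<Longrightarrow> E i \<in> sets borel) \<Longrightarrow> lsum J E b \<in> borel_measurable borel"
  unfolding lsum_def by (intro borel_measurable_sum) auto

lemma lsum_finite: "finite J \<Longrightarrow> lsum J E b x < top"
  by (auto simp: lsum_def ennreal_mult_less_top indicator_def intro!: sum_ennreal_less_top)

lemma finite_range_lsum:
  assumes "finite J" shows "finite (lsum J E b ` S)"
proof -
  have "lsum J E b x = (\<Sum>i\<in>{i\<in>J. x \<in> E i}. ennreal (b i))" for x
    unfolding lsum_def using assms by (intro sum.mono_neutral_cong_right) auto
  then have "lsum J E b ` S \<subseteq> (\<lambda>T. \<Sum>i\<in>T. ennreal (b i)) ` Pow J" by auto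
  then show ?thesis by (rule finite_subset) (use assms in auto)
qed

lemma lsum_le: "i \<in> J \<Longrightarrow> finite J \<Longrightarrow> x \<in> E i \<Longrightarrow> ennreal (b i) \<le> lsum J E b x"
  unfolding lsum_def by (rule order_trans[OF _ member_le_sum[of i]]) auto

lemma lsum_eq_0: "(\<And>i. i \<in> J \<Longrightarrow> x \<notin> E i) \<Longrightarrow> lsum J E b x = 0"
  by (auto simp: lsum_def)

lemma nn_integral_lsum_mult:
  assumes "\<And>i. i \<in> J \<Longrightarrow> E i \<in> sets borel" and [measurable]: "h \<in> borel_measurable borel"
  shows "(\<integral>\<^sup>+x. lsum J E b x * h x \<partial>lborel) = (\<Sum>i\<in>J. ennreal (b i) * (\<integral>\<^sup>+x. h x * indicator (E i) x \<partial>lborel))"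
proof -
  have "(\<integral>\<^sup>+x. lsum J E b x * h x \<partial>lborel) = (\<integral>\<^sup>+x. (\<Sum>i\<in>J. ennreal (b i) * (h x * indicator (E i) x)) \<partial>lborel)"
    unfolding lsum_def sum_distrib_right by (intro nn_integral_cong sum.cong) (simp_all add: mult_ac)
  also have "\<dots> = (\<Sum>i\<in>J. \<integral>\<^sup>+x. ennreal (b i) * (h x * indicator (E i) x) \<partial>lborel)"
    using assms by (intro nn_integral_sum) auto
  also have "\<dots> = (\<Sum>i\<in>J. ennreal (b i) * (\<integral>\<^sup>+x. h x * indicator (E i) x \<partial>lborel))"
    using assms by (intro sum.cong nn_integral_cmult) auto
  finally show ?thesis .
qed

text \<open>The sum is bounded and lives on a set of finite volume. This supplies the finiteness
  hypothesis of \<open>ennreal_absorb\<close>.\<close>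

lemma nn_integral_lsum_finite:
  assumes J: "finite J" and s: "0 < s"
  shows "(\<integral>\<^sup>+x. epow (lsum J B b x) s \<partial>lborel) < top"
proof -
  let ?K = "epow (\<Sum>i\<in>J. ennreal (b i)) s"
  have "(\<integral>\<^sup>+x. epow (lsum J B b x) s \<partial>lborel) \<le> (\<integral>\<^sup>+x. ?K * indicator (\<Union>i\<in>J. B i) x \<partial>lborel)"
  proof (intro nn_integral_mono)
    fix x
    show "epow (lsum J B b x) s \<le> ?K * indicator (\<Union>i\<in>J. B i) x"
    proof (cases "x \<in> (\<Union>i\<in>J. B i)")
      case True
      have "lsum J B b x \<le> (\<Sum>i\<in>J. ennreal (b i))"
        unfolding lsum_def by (intro sum_mono) (auto simp: indicator_def)
      then show ?thesis using True s by (auto intro: epow_mono)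
    next
      case False
      then have "lsum J B b x = 0" by (intro lsum_eq_0) auto
      then show ?thesis by simp
    qed
  qed
  also have "\<dots> = ?K * vol (\<Union>i\<in>J. B i)"
    using J by (subst nn_integral_cmult_indicator) auto
  also have "\<dots> < top"
  proof -
    have "vol (\<Union>i\<in>J. B i) \<le> (\<Sum>i\<in>J. vol (B i))" using J by (intro emeasure_subadditive_finite) auto
    also have "\<dots> < top" using vol_B J by (intro sum_ennreal_less_top) auto
    finally have "vol (\<Union>i\<in>J. B i) < top" .
    moreover have "?K < top" using J by (simp add: sum_ennreal_less_top)
    ultimately show ?thesis by (simp add: ennreal_mult_less_top)
  qed
  finally show ?thesis .
qed

lemma sparse_sum_1:
  assumes J: "finite J" and E: "sparse_on J \<eta> E" "0 < \<eta>" and w: "\<And>i. i \<in> J \<Longrightarrow> 0 \<le> b i"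
  shows "(\<integral>\<^sup>+x. lsum J B b x \<partial>lborel) \<le> ennreal (1 / \<eta>) * (\<integral>\<^sup>+x. lsum J E b x \<partial>lborel)"
proof -
  have "(\<integral>\<^sup>+x. lsum J B b x \<partial>lborel) = (\<Sum>i\<in>J. ennreal (b i) * vol (B i))"
    using nn_integral_lsum_mult[of J B "\<lambda>_. 1" b] by simp
  also have "\<dots> \<le> (\<Sum>i\<in>J. ennreal (b i) * (ennreal (1 / \<eta>) * vol (E i)))"
    by (intro sum_mono mult_left_mono vol_B_le_sparse[OF E(1) _ E(2)]) auto
  also have "\<dots> = ennreal (1 / \<eta>) * (\<integral>\<^sup>+x. lsum J E b x \<partial>lborel)"
    using nn_integral_lsum_mult[of J E "\<lambda>_. 1" b] sparse_onD(1)[OF E(1)] by (simp add: sum_distrib_left mult_ac)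
  finally show ?thesis .
qed

text \<open>Duality with \<open>h = F\<^bsup>s-1\<^esup>\<close>: replacing \<open>h\<close> by its maximal function allows \<open>B\<^sub>i\<close> to be replaced by \<open>E\<^sub>i\<close>.\<close>
lemma sparse_sum_gt1:
  assumes \<eta>: "0 < \<eta>" and s: "1 < s"
  shows "\<exists>C>0. \<forall>J E b. finite J \<longrightarrow> sparse_on J \<eta> E \<longrightarrow>
    (\<integral>\<^sup>+x. epow (lsum J B b x) s \<partial>lborel) \<le> ennreal C * (\<integral>\<^sup>+x. epow (lsum J E b x) s \<partial>lborel)"
proof -
  \<comment> \<open>The conjugate exponent: \<open>(s - 1) * s' = s\<close>, so the
    \<open>s'\<close>-th power of \<open>h\<close> integrates to \<open>X\<close> again.\<close>
  define s' where "s' = s / (s - 1)"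
  have s': "1 < s'" using s by (simp add: s'_def field_simps)
  obtain C where C: "C > 0" "\<And>J h. finite J \<Longrightarrow> h \<in> borel_measurable borel \<Longrightarrow>
    (\<integral>\<^sup>+x. epow (maxf J h x) s' \<partial>lborel) \<le> ennreal C * (\<integral>\<^sup>+x. epow (h x) s' \<partial>lborel)"
    using maxf_strong_type[OF s'] by auto
  define K where "K = (1 / \<eta>) * C powr (1 - 1 / s)"
  have K: "0 < K" using \<eta> C by (simp add: K_def)
  have "(\<integral>\<^sup>+x. epow (lsum J B b x) s \<partial>lborel) \<le> ennreal (K powr s) * (\<integral>\<^sup>+x. epow (lsum J E b x) s \<partial>lborel)"
    if J: "finite J" and E: "sparse_on J \<eta> E" for J E b
  proof -
    let ?F = "lsum J B b" and ?G = "lsum J E b"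
    have [measurable]: "?F \<in> borel_measurable borel" "?G \<in> borel_measurable borel"
      using sparse_onD(1)[OF E] by (auto intro: measurable_lsum)
    define h where "h x = epow (?F x) (s - 1)" for x
    have [measurable]: "h \<in> borel_measurable borel" unfolding h_def by measurable
    note [measurable] = measurable_maxf[OF J]
    define X where "X = (\<integral>\<^sup>+x. epow (?F x) s \<partial>lborel)"
    define Y where "Y = (\<integral>\<^sup>+x. epow (?G x) s \<partial>lborel)"
    have Xfin: "X < top" unfolding X_def using J s by (intro nn_integral_lsum_finite) auto
    have "X = (\<integral>\<^sup>+x. ?F x * h x \<partial>lborel)"
      unfolding X_def h_def using epow_add[of _ 1 "s - 1"] by simp
    also have "\<dots> = (\<Sum>i\<in>J. ennreal (b i) * (\<integral>\<^sup>+x. h x * indicator (B i) x \<partial>lborel))"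
      by (rule nn_integral_lsum_mult) auto
    also have "\<dots> = (\<Sum>i\<in>J. ennreal (b i) * (avg (B i) h * vol (B i)))"
      using vol_B by (simp add: avg_mult_measure)
    also have "\<dots> \<le> (\<Sum>i\<in>J. ennreal (b i) * (ennreal (1 / \<eta>) * (\<integral>\<^sup>+x. maxf J h x * indicator (E i) x \<partial>lborel)))"
    proof (intro sum_mono mult_left_mono)
      fix i assume i: "i \<in> J"
      note Ei = sparse_onD[OF E i]
      have "avg (B i) h * vol (B i) \<le> avg (B i) h * (ennreal (1 / \<eta>) * vol (E i))"
        by (intro mult_left_mono vol_B_le_sparse[OF E i \<eta>]) auto
      also have "\<dots> = ennreal (1 / \<eta>) * (\<integral>\<^sup>+x. avg (B i) h * indicator (E i) x \<partial>lborel)"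
        using Ei by (subst nn_integral_cmult_indicator) (simp_all add: mult_ac)
      also have "\<dots> \<le> ennreal (1 / \<eta>) * (\<integral>\<^sup>+x. maxf J h x * indicator (E i) x \<partial>lborel)"
        using Ei avg_le_maxf[OF i, of _ h]
        by (intro mult_left_mono nn_integral_mono) (auto simp: indicator_def)
      finally show "avg (B i) h * vol (B i) \<le> ennreal (1 / \<eta>) * (\<integral>\<^sup>+x. maxf J h x * indicator (E i) x \<partial>lborel)" .
    qed auto
    also have "\<dots> = ennreal (1 / \<eta>) * (\<integral>\<^sup>+x. ?G x * maxf J h x \<partial>lborel)"
      using sparse_onD(1)[OF E] by (subst nn_integral_lsum_mult) (auto simp: sum_distrib_left mult_ac)
    also have "(\<integral>\<^sup>+x. ?G x * maxf J h x \<partial>lborel)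
        = (\<integral>\<^sup>+x. epow (epow (?G x) s) (1 / s) * epow (epow (maxf J h x) s') (1 - 1 / s) \<partial>lborel)"
      using s by (intro nn_integral_cong) (simp add: epow_epow s'_def field_simps)
    also have "\<dots> \<le> epow Y (1 / s) * epow (\<integral>\<^sup>+x. epow (maxf J h x) s' \<partial>lborel) (1 - 1 / s)"
      unfolding Y_def using s by (intro nn_integral_Holder_theta) auto
    also have "\<dots> \<le> epow Y (1 / s) * epow (ennreal C * X) (1 - 1 / s)"
    proof (intro mult_left_mono epow_mono)
      have "(\<integral>\<^sup>+x. epow (h x) s' \<partial>lborel) = X"
        using s unfolding X_def h_def by (simp add: epow_epow s'_def)
      then show "(\<integral>\<^sup>+x. epow (maxf J h x) s' \<partial>lborel) \<le> ennreal C * X"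
        using C(2)[OF J, of h] by simp
    qed (use s in auto)
    finally have "X \<le> ennreal (1 / \<eta>) * (epow Y (1 / s) * epow (ennreal C * X) (1 - 1 / s))"
      by (simp add: mult_left_mono)
    also have "\<dots> = ennreal K * epow Y (1 / s) * epow X (1 - 1 / s)"
    proof -
      have "ennreal K = ennreal (1 / \<eta>) * ennreal (C powr (1 - 1 / s))"
        using \<eta> unfolding K_def by (intro ennreal_mult) auto
      then show ?thesis using C(1) by (simp add: epow_mult mult_ac)
    qed
    finally have "X \<le> ennreal K * epow Y (1 / s) * epow X (1 - 1 / s)" .
    \<comment> \<open>\<open>X\<close> occurs on the right with exponent
      \<open>1 - 1 / s < 1\<close> and is absorbed.\<close>
    then have "X \<le> epow (ennreal K) (1 / (1 / s)) * Y"
      using s Xfin by (intro ennreal_absorb) auto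
    then show ?thesis using K by (simp add: X_def Y_def)
  qed
  moreover have "0 < K powr s" using K by simp
  ultimately show ?thesis by blast
qed

text \<open>With \<open>m\<^sub>i\<close> a median of \<open>G = \<Sum> b\<^sub>i 1\<^bsub>E\<^sub>i\<^esub>\<close> over \<open>E\<^sub>i\<close> and \<open>H = sup m\<^sub>i 1\<^bsub>B\<^sub>i\<^esub>\<close>, Hoelder's inequality bounds
  \<open>\<integral> F\<^sup>s\<close> by \<open>(\<integral> F H\<^bsup>s-1\<^esup>)\<^sup>s (\<integral> H\<^sup>s)\<^bsup>1-s\<^esup>\<close>, and both factors are controlled by \<open>\<integral> G\<^sup>s\<close>.\<close>
lemma sparse_sum_lt1:
  assumes \<eta>: "0 < \<eta>" and s: "0 < s" "s < 1"
  shows "\<exists>C>0. \<forall>J E b. finite J \<longrightarrow> sparse_on J \<eta> E \<longrightarrow> (\<forall>i\<in>J. 0 < b i) \<longrightarrow>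
    (\<integral>\<^sup>+x. epow (lsum J B b x) s \<partial>lborel) \<le> ennreal C * (\<integral>\<^sup>+x. epow (lsum J E b x) s \<partial>lborel)"
proof -
  obtain C where C: "C > 0" "\<And>J E b. finite J \<Longrightarrow> sparse_on J (\<eta> / 2) E \<Longrightarrow>
    (\<integral>\<^sup>+x. epow (SUP i\<in>J. b i * indicator (B i) x) s \<partial>lborel)
      \<le> ennreal C * (\<integral>\<^sup>+x. epow (SUP i\<in>J. b i * indicator (E i) x) s \<partial>lborel)"
    using sparse_SUP[of "\<eta> / 2" s] \<eta> s by auto
  define K where "K = max C (2 / \<eta>)"
  have "(\<integral>\<^sup>+x. epow (lsum J B b x) s \<partial>lborel) \<le> ennreal K * (\<integral>\<^sup>+x. epow (lsum J E b x) s \<partial>lborel)"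
    if J: "finite J" and E: "sparse_on J \<eta> E" and b: "\<And>i. i \<in> J \<Longrightarrow> 0 < b i" for J E b
  proof -
    let ?F = "lsum J B b" and ?G = "lsum J E b"
    have [measurable]: "?F \<in> borel_measurable borel" "?G \<in> borel_measurable borel"
      using sparse_onD(1)[OF E] by (auto intro: measurable_lsum)
    define Y where "Y = (\<integral>\<^sup>+x. epow (?G x) s \<partial>lborel)"
    have "\<forall>i\<in>J. \<exists>m\<in>?G ` E i. vol (E i) \<le> 2 * vol {x\<in>E i. ?G x \<le> m} \<and> vol (E i) \<le> 2 * vol {x\<in>E i. m \<le> ?G x}"
      by (intro ballI median_exists sparse_onD(1)[OF E] vol_sparse[OF E _ \<eta>] finite_range_lsum[OF J]) auto
    from bchoice[OF this[unfolded Bex_def]] obtain m where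
      "\<forall>i\<in>J. m i \<in> ?G ` E i \<and> vol (E i) \<le> 2 * vol {x\<in>E i. ?G x \<le> m i}
        \<and> vol (E i) \<le> 2 * vol {x\<in>E i. m i \<le> ?G x}" ..
    then have m: "\<And>i. i \<in> J \<Longrightarrow> m i \<in> ?G ` E i"
      "\<And>i. i \<in> J \<Longrightarrow> vol (E i) \<le> 2 * vol {x\<in>E i. ?G x \<le> m i}"
      "\<And>i. i \<in> J \<Longrightarrow> vol (E i) \<le> 2 * vol {x\<in>E i. m i \<le> ?G x}"
      by simp_all
    \<comment> \<open>Positive coefficients keep \<open>G\<close> and its medians away from
      \<open>0\<close>, so the negative power \<open>s - 1\<close> reverses inequalities as it
      should.\<close>
    have Gpos: "0 < ?G x" if "i \<in> J" "x \<in> E i" for i x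
    proof -
      have "0 < ennreal (b i)" using b[OF that(1)] by simp
      then show ?thesis using lsum_le[of i J x E b, OF that(1) J that(2)] by (rule less_le_trans)
    qed
    have mpos: "0 < m i" "m i < top" if i: "i \<in> J" for i
    proof -
      obtain x where x: "x \<in> E i" "m i = ?G x" using m(1)[OF i] by blast
      show "0 < m i" unfolding x(2) by (rule Gpos[OF i x(1)])
      show "m i < top" unfolding x(2) by (rule lsum_finite[OF J])
    qed
    \<comment> \<open>The two halves serve opposite purposes. On \<open>E1\<close> the median
      dominates \<open>G\<close>, so its negative power is at most that of \<open>G\<close>, which
      bounds the integral of \<open>F H^(s-1)\<close>. On \<open>E2\<close> it is dominated by
      \<open>G\<close>, which bounds the supremum \<open>H\<close>.\<close>
    define E1 where "E1 i = {x\<in>E i. ?G x \<le> m i}" for i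
    define E2 where "E2 i = {x\<in>E i. m i \<le> ?G x}" for i
    have E12 [measurable]: "E1 i \<in> sets borel" "E2 i \<in> sets borel" if "i \<in> J" for i
      using sparse_onD(1)[OF E that] by (auto simp: E1_def E2_def)
    have sp1: "sparse_on J (\<eta> / 2) E1" and sp2: "sparse_on J (\<eta> / 2) E2"
      using m E12 by (auto intro!: sparse_half_on[OF E \<eta>] simp: E1_def E2_def)
    define H where "H x = (SUP i\<in>J. m i * indicator (B i) x)" for x
    have [measurable]: "H \<in> borel_measurable borel"
      unfolding H_def using J by (intro borel_measurable_SUP countable_finite) auto
    have Hfin: "H x < top" for x
      using SUP_le_sum_ennreal[OF J, of "\<lambda>i. m i * indicator (B i) x"] mpos J unfolding H_def
      by (auto simp: ennreal_mult_less_top indicator_def intro!: sum_ennreal_less_top elim!: le_less_trans)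
    have mH: "m i \<le> H x" if "i \<in> J" "x \<in> B i" for i x
      unfolding H_def using that by (intro SUP_upper2[of i]) auto
    have H: "(\<integral>\<^sup>+x. epow (H x) s \<partial>lborel) \<le> ennreal C * Y"
    proof -
      have "(\<integral>\<^sup>+x. epow (H x) s \<partial>lborel) \<le> ennreal C * (\<integral>\<^sup>+x. epow (SUP i\<in>J. m i * indicator (E2 i) x) s \<partial>lborel)"
        unfolding H_def by (rule C(2)[OF J sp2])
      also have "\<dots> \<le> ennreal C * Y"
        unfolding Y_def using s
        by (intro mult_left_mono nn_integral_mono epow_mono SUP_least) (auto simp: E2_def indicator_def)
      finally show ?thesis .
    qed
    have FH: "(\<integral>\<^sup>+x. ?F x * epow (H x) (s - 1) \<partial>lborel) \<le> ennreal (2 / \<eta>) * Y"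
    proof -
      have "(\<integral>\<^sup>+x. ?F x * epow (H x) (s - 1) \<partial>lborel)
          = (\<Sum>i\<in>J. ennreal (b i) * (\<integral>\<^sup>+x. epow (H x) (s - 1) * indicator (B i) x \<partial>lborel))"
        by (rule nn_integral_lsum_mult) auto
      also have "\<dots> \<le> (\<Sum>i\<in>J. ennreal (b i) * (\<integral>\<^sup>+x. epow (m i) (s - 1) * indicator (B i) x \<partial>lborel))"
        using mpos mH Hfin s
        by (intro sum_mono mult_left_mono nn_integral_mono) (auto simp: indicator_def intro!: epow_antimono)
      also have "\<dots> = (\<Sum>i\<in>J. ennreal (b i) * (epow (m i) (s - 1) * vol (B i)))"
        by (simp add: nn_integral_cmult_indicator)
      also have "\<dots> \<le> (\<Sum>i\<in>J. ennreal (b i) * (epow (m i) (s - 1) * (ennreal (2 / \<eta>) * vol (E1 i))))"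
        using vol_B_le_sparse[OF sp1] \<eta> by (intro sum_mono mult_left_mono) auto
      also have "\<dots> = ennreal (2 / \<eta>) * (\<Sum>i\<in>J. ennreal (b i) * (\<integral>\<^sup>+x. epow (m i) (s - 1) * indicator (E1 i) x \<partial>lborel))"
        unfolding sum_distrib_left
        by (intro sum.cong refl, subst nn_integral_cmult_indicator) (use E12 in \<open>auto simp: mult_ac\<close>)
      also have "\<dots> \<le> ennreal (2 / \<eta>) * (\<Sum>i\<in>J. ennreal (b i) * (\<integral>\<^sup>+x. epow (?G x) (s - 1) * indicator (E i) x \<partial>lborel))"
        using mpos Gpos s by (intro sum_mono mult_left_mono nn_integral_mono)
          (auto simp: indicator_def E1_def intro!: epow_antimono)
      also have "\<dots> = ennreal (2 / \<eta>) * (\<integral>\<^sup>+x. ?G x * epow (?G x) (s - 1) \<partial>lborel)"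
        using sparse_onD(1)[OF E] by (subst nn_integral_lsum_mult) auto
      also have "\<dots> = ennreal (2 / \<eta>) * Y"
        unfolding Y_def using epow_add[of _ 1 "s - 1"] by simp
      finally show ?thesis .
    qed
    \<comment> \<open>The powers of \<open>H\<close> cancel because
      \<open>(s - 1) * s + s * (1 - s) = 0\<close>. Where \<open>H\<close> could vanish, outside all
      balls, \<open>F\<close> vanishes too.\<close>
    have pt: "epow (?F x) s = epow (?F x * epow (H x) (s - 1)) s * epow (epow (H x) s) (1 - s)" for x
    proof (cases "\<exists>i\<in>J. x \<in> B i")
      case True
      then obtain i where "i \<in> J" "x \<in> B i" by blast
      then have "0 < H x" using mH mpos(1) less_le_trans by blast
      then obtain z where z: "H x = ennreal z" "0 < z" using Hfin[of x] by (cases "H x") auto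
      have "epow (epow (H x) (s - 1)) s * epow (epow (H x) s) (1 - s) = epow (H x) ((s - 1) * s + s * (1 - s))"
        by (simp only: epow_epow epow_add)
      also have "(s - 1) * s + s * (1 - s) = 0" by (simp add: algebra_simps)
      also have "epow (H x) 0 = 1" using z by simp
      finally show ?thesis by (simp add: epow_mult mult.assoc)
    next
      case False
      then have "?F x = 0" by (intro lsum_eq_0) auto
      then show ?thesis by simp
    qed
    have "(\<integral>\<^sup>+x. epow (?F x) s \<partial>lborel)
       \<le> epow (\<integral>\<^sup>+x. ?F x * epow (H x) (s - 1) \<partial>lborel) s * epow (\<integral>\<^sup>+x. epow (H x) s \<partial>lborel) (1 - s)"
      unfolding pt using s by (intro nn_integral_Holder_theta) auto
    also have "\<dots> \<le> epow (ennreal K * Y) s * epow (ennreal K * Y) (1 - s)"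
    proof -
      have "ennreal (2 / \<eta>) * Y \<le> ennreal K * Y" "ennreal C * Y \<le> ennreal K * Y"
        by (auto simp: K_def intro!: mult_right_mono ennreal_leI)
      then have "(\<integral>\<^sup>+x. ?F x * epow (H x) (s - 1) \<partial>lborel) \<le> ennreal K * Y"
        "(\<integral>\<^sup>+x. epow (H x) s \<partial>lborel) \<le> ennreal K * Y"
        using FH H by (blast intro: order_trans)+
      then show ?thesis using s by (intro mult_mono epow_mono) auto
    qed
    also have "\<dots> = ennreal K * Y" by (simp add: epow_add[symmetric])
    finally show ?thesis by (simp add: Y_def)
  qed
  moreover have "0 < K" using C by (simp add: K_def less_max_iff_disj)
  ultimately show ?thesis by blast
qed

text \<open>Three regimes of the exponent: medians for \<open>s < 1\<close>, linearity for
  \<open>s = 1\<close>, duality for \<open>s > 1\<close>. Zero coefficients are dropped in the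
  first, where the medians have to be positive.\<close>

lemma sparse_sum:
  assumes \<eta>: "0 < \<eta>" and s: "0 < s"
  shows "\<exists>C>0. \<forall>J E b. finite J \<longrightarrow> sparse_on J \<eta> E \<longrightarrow> (\<forall>i\<in>J. 0 \<le> b i) \<longrightarrow>
    (\<integral>\<^sup>+x. epow (lsum J B b x) s \<partial>lborel) \<le> ennreal C * (\<integral>\<^sup>+x. epow (lsum J E b x) s \<partial>lborel)"
proof -
  consider "s < 1" | "s = 1" | "1 < s" by linarith
  then show ?thesis
  proof cases
    case 1
    obtain C where C: "C > 0" "\<And>J E b. finite J \<Longrightarrow> sparse_on J \<eta> E \<Longrightarrow> (\<forall>i\<in>J. 0 < b i) \<Longrightarrow>
      (\<integral>\<^sup>+x. epow (lsum J B b x) s \<partial>lborel) \<le> ennreal C * (\<integral>\<^sup>+x. epow (lsum J E b x) s \<partial>lborel)"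
      using sparse_sum_lt1[OF \<eta> s 1] by auto
    have "(\<integral>\<^sup>+x. epow (lsum J B b x) s \<partial>lborel) \<le> ennreal C * (\<integral>\<^sup>+x. epow (lsum J E b x) s \<partial>lborel)"
      if J: "finite J" and E: "sparse_on J \<eta> E" and b: "\<forall>i\<in>J. 0 \<le> b i" for J E b
    proof -
      let ?J = "{i\<in>J. 0 < b i}"
      have eq: "lsum ?J A b x = lsum J A b x" for A x
        unfolding lsum_def using J b by (intro sum.mono_neutral_left) (auto simp: less_le)
      have "sparse_on ?J \<eta> E" using E by (auto simp: sparse_on_def)
      then have "(\<integral>\<^sup>+x. epow (lsum ?J B b x) s \<partial>lborel) \<le> ennreal C * (\<integral>\<^sup>+x. epow (lsum ?J E b x) s \<partial>lborel)"
        using J by (intro C(2)) auto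
      then show ?thesis unfolding eq .
    qed
    then show ?thesis using C(1) by blast
  next
    case 2
    then show ?thesis using sparse_sum_1[OF _ _ \<eta>] \<eta> by (intro exI[of _ "1 / \<eta>"]) auto
  next
    case 3
    then show ?thesis using sparse_sum_gt1[OF \<eta> 3] by blast
  qed
qed

end

section \<open>Norms on sequences indexed by a family of balls\<close>

lemma suminf_mono_ennreal: "(\<And>i. f i \<le> g i) \<Longrightarrow> (\<Sum>i. f i :: ennreal) \<le> (\<Sum>i. g i)"
  by (intro suminf_le) auto

lemma le_suminf_ennreal: "f i \<le> (\<Sum>i. f i :: ennreal)"
  using sum_le_suminf[of f "{i}"] by simp

context ball_family
begin

definition seqn :: "ennreal \<Rightarrow> (nat \<Rightarrow> 'a set) \<Rightarrow> (nat \<Rightarrow> ennreal) \<Rightarrow> 'a \<Rightarrow> ennreal" where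
  "seqn q E a x = lnorm (count_space UNIV) q (\<lambda>i. a i * indicator (E i) x)"

lemma seqn_top: "seqn top E a x = (SUP i. a i * indicator (E i) x)"
  unfolding seqn_def lnorm_top
  by (rule antisym) (auto simp: AE_count_space intro!: Inf_lower Inf_greatest SUP_upper SUP_least)

lemma seqn_finite:
  assumes "q \<noteq> top"
  shows "seqn q E a x = epow (\<Sum>i. epow (a i) (enn2real q) * indicator (E i) x) (1 / enn2real q)"
  unfolding seqn_def using assms by (simp add: lnorm_finite nn_integral_count_space_nat epow_mult_indicator)

lemma measurable_seqn [measurable]:
  assumes [measurable]: "\<And>i. E i \<in> sets borel"
  shows "seqn q E a \<in> borel_measurable borel"
proof (cases "q = top")
  case True
  have "(\<lambda>x. SUP i. a i * indicator (E i) x) \<in> borel_measurable borel" by measurable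
  then show ?thesis using True by (simp add: seqn_top[abs_def])
next
  case False
  have "(\<lambda>x. epow (\<Sum>i. epow (a i) (enn2real q) * indicator (E i) x) (1 / enn2real q)) \<in> borel_measurable borel"
    by measurable
  moreover have "seqn q E a = (\<lambda>x. epow (\<Sum>i. epow (a i) (enn2real q) * indicator (E i) x) (1 / enn2real q))"
    using seqn_finite[OF False] by blast
  ultimately show ?thesis by simp
qed

lemma seqn_mono:
  "1 \<le> q \<Longrightarrow> (\<And>i. a i * indicator (E i) x \<le> a' i * indicator (E' i) x) \<Longrightarrow> seqn q E a x \<le> seqn q E' a' x"
  unfolding seqn_def by (rule lnorm_mono)

lemma seqn_cmult_le: "1 \<le> q \<Longrightarrow> seqn q E (\<lambda>i. k * a i) x \<le> k * seqn q E a x"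
  unfolding seqn_def using lnorm_cmult_le[of q "\<lambda>i. a i * indicator (E i) x" "count_space UNIV" k]
  by (simp add: mult.assoc)

lemma seqn_ge:
  assumes "1 \<le> q" shows "a i * indicator (E i) x \<le> seqn q E a x"
proof (cases "q = top")
  case True
  then show ?thesis by (auto simp: seqn_top intro!: SUP_upper)
next
  case False
  note Q = exponent_pos[OF assms False]
  have "epow (a i * indicator (E i) x) (enn2real q) \<le> (\<Sum>i. epow (a i) (enn2real q) * indicator (E i) x)"
    unfolding epow_mult_indicator by (rule le_suminf_ennreal)
  then show ?thesis using Q by (simp add: seqn_finite[OF False] epow_le_iff)
qed

definition mixed :: "ennreal \<Rightarrow> ennreal \<Rightarrow> (nat \<Rightarrow> 'a set) \<Rightarrow> (nat \<Rightarrow> ennreal) \<Rightarrow> ennreal" where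
  "mixed p q E a = lnorm lborel p (seqn q E a)"

lemma mixed_mono:
  "1 \<le> p \<Longrightarrow> 1 \<le> q \<Longrightarrow> (\<And>i x. a i * indicator (E i) x \<le> a' i * indicator (E' i) x) \<Longrightarrow> mixed p q E a \<le> mixed p q E' a'"
  unfolding mixed_def by (intro lnorm_mono seqn_mono) auto

lemma mixed_mono_fun: "1 \<le> p \<Longrightarrow> 1 \<le> q \<Longrightarrow> (\<And>i. a i \<le> a' i) \<Longrightarrow> mixed p q E a \<le> mixed p q E a'"
  by (intro mixed_mono mult_right_mono) auto

lemma mixed_finite: "p \<noteq> top \<Longrightarrow> mixed p q E a
   = epow (\<integral>\<^sup>+x. epow (seqn q E a x) (enn2real p) \<partial>lborel) (1 / enn2real p)"
  by (simp add: mixed_def lnorm_finite)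

text \<open>The discrete Carleson condition: \<open>vol (B i)\<close> stands for the integral of
  \<open>1 / t\<close> over a box, and \<open>B i \<subseteq> ball z R\<close> for the box lying in
  the tent over the test ball.\<close>

definition carl :: "ennreal \<Rightarrow> (nat \<Rightarrow> ennreal) \<Rightarrow> ennreal" where
  "carl q a = (SUP (z, R)\<in>UNIV \<times> {0<..}.
     epow ((\<Sum>i. epow (a i) (enn2real q) * (vol (B i) * of_bool (B i \<subseteq> ball z R))) / vol (ball z R)) (1 / enn2real q))"

text \<open>The discrete counterpart of \<open>tent_norm\<close>. Its two cases with finite
  \<open>p\<close> merge into one, since \<open>seqn\<close> already becomes a supremum for
  \<open>q = top\<close>.\<close>

definition tseq_norm :: "ennreal \<Rightarrow> ennreal \<Rightarrow> (nat \<Rightarrow> ennreal) \<Rightarrow> ennreal" where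
  "tseq_norm p q a = (if p \<noteq> top then mixed p q B a else if q \<noteq> top then carl q a else (SUP i. a i))"

lemma carl_leI:
  assumes Q: "0 < enn2real q" and "\<And>z R. 0 < R \<Longrightarrow>
    (\<Sum>i. epow (a i) (enn2real q) * (vol (B i) * of_bool (B i \<subseteq> ball z R))) \<le> epow X (enn2real q) * vol (ball z R)"
  shows "carl q a \<le> X"
  unfolding carl_def
proof (intro SUP_least, clarsimp)
  fix z :: 'a and R :: real assume R: "0 < R"
  let ?S = "\<Sum>i. epow (a i) (enn2real q) * (vol (B i) * of_bool (B i \<subseteq> ball z R))"
  have "?S / vol (ball z R) \<le> epow X (enn2real q) * vol (ball z R) / vol (ball z R)"
    by (intro divide_right_mono_ennreal assms(2) R)
  also have "\<dots> = epow X (enn2real q)"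
    using emeasure_ball_pos[OF R, of z] emeasure_lborel_ball_finite[of z R]
    by (intro mult_divide_eq_ennreal) auto
  finally show "epow (?S / vol (ball z R)) (1 / enn2real q) \<le> X"
    using Q by (simp add: epow_le_iff)
qed

lemma carlD:
  assumes Q: "0 < enn2real q" and R: "0 < R"
  shows "(\<Sum>i. epow (a i) (enn2real q) * (vol (B i) * of_bool (B i \<subseteq> ball z R)))
    \<le> epow (carl q a) (enn2real q) * vol (ball z R)"
proof -
  let ?S = "\<Sum>i. epow (a i) (enn2real q) * (vol (B i) * of_bool (B i \<subseteq> ball z R))"
  have v: "0 < vol (ball z R)" "vol (ball z R) < top"
    using emeasure_ball_pos[OF R, of z] emeasure_lborel_ball_finite[of z R] by auto
  have "epow (?S / vol (ball z R)) (1 / enn2real q) \<le> carl q a"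
    unfolding carl_def using R by (intro SUP_upper2[of "(z, R)"]) auto
  then have "?S / vol (ball z R) \<le> epow (carl q a) (enn2real q)"
    using Q epow_le_iff[of "1 / enn2real q"] by simp
  then have "?S / vol (ball z R) * vol (ball z R) \<le> epow (carl q a) (enn2real q) * vol (ball z R)"
    by (rule mult_right_mono) simp
  then show ?thesis using v by (simp add: ennreal_divide_times ennreal_divide_self)
qed

lemma tseq_norm_mono:
  assumes "1 \<le> p" "1 \<le> q" "\<And>i. a i \<le> a' i" shows "tseq_norm p q a \<le> tseq_norm p q a'"
proof -
  have "carl q a \<le> carl q a'"
    unfolding carl_def using assms(3)
    by (intro SUP_mono bexI) (auto intro!: epow_mono divide_right_mono_ennreal suminf_mono_ennreal mult_right_mono)
  then show ?thesis
    using assms mixed_mono_fun[of p q a a' B] unfolding tseq_norm_def by (auto intro: SUP_mono)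
qed

lemma tseq_norm_cmult_le:
  assumes p: "1 \<le> p" and q: "1 \<le> q" shows "tseq_norm p q (\<lambda>i. k * a i) \<le> k * tseq_norm p q a"
proof -
  have "mixed p q B (\<lambda>i. k * a i) \<le> lnorm lborel p (\<lambda>x. k * seqn q B a x)"
    unfolding mixed_def by (intro lnorm_mono seqn_cmult_le p q)
  also have "\<dots> \<le> k * mixed p q B a"
    unfolding mixed_def using p by (intro lnorm_cmult_le) auto
  finally have 1: "mixed p q B (\<lambda>i. k * a i) \<le> k * mixed p q B a" .
  have 2: "carl q (\<lambda>i. k * a i) \<le> k * carl q a" if "q \<noteq> top"
  proof (rule carl_leI)
    note Q = exponent_pos[OF q that]
    show Q': "0 < enn2real q" using Q by simp
    fix z and R :: real assume R: "0 < R"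
    have "(\<Sum>i. epow (k * a i) (enn2real q) * (vol (B i) * of_bool (B i \<subseteq> ball z R)))
      = epow k (enn2real q) * (\<Sum>i. epow (a i) (enn2real q) * (vol (B i) * of_bool (B i \<subseteq> ball z R)))"
      by (simp only: epow_mult mult.assoc ennreal_suminf_cmult)
    also have "\<dots> \<le> epow k (enn2real q) * (epow (carl q a) (enn2real q) * vol (ball z R))"
      by (intro mult_left_mono carlD Q' R) auto
    finally show "(\<Sum>i. epow (k * a i) (enn2real q) * (vol (B i) * of_bool (B i \<subseteq> ball z R)))
      \<le> epow (k * carl q a) (enn2real q) * vol (ball z R)"
      by (simp add: epow_mult mult.assoc)
  qed
  have 3: "(SUP i. k * a i) \<le> k * (SUP i. a i)"
    by (intro SUP_least mult_left_mono SUP_upper) auto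
  show ?thesis using 1 2 3 unfolding tseq_norm_def by auto
qed

text \<open>The Fatou property: each of the norms is an iteration of sums, integrals and suprema,
  all of which commute with increasing limits or are dominated by their bounds.\<close>

lemma tseq_norm_SUP_leI:
  assumes p: "1 \<le> p" and q: "1 \<le> q" and inc: "\<And>i. incseq (\<lambda>n. a n i)"
    and le: "\<And>n::nat. tseq_norm p q (a n) \<le> X"
  shows "tseq_norm p q (\<lambda>i. SUP n. a n i) \<le> X"
proof -
  consider "p \<noteq> top" | "p = top" "q \<noteq> top" | "p = top" "q = top" by blast
  then show ?thesis
  proof cases
    case 1
    have "seqn q B (\<lambda>i. SUP n. a n i) x = (SUP n. seqn q B (a n) x)" for x
      unfolding seqn_def SUP_mult_right_ennreal using q inc
      by (intro lnorm_monotone_convergence) (auto simp: incseq_def intro: mult_right_mono)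
    then have "mixed p q B (\<lambda>i. SUP n. a n i) = lnorm lborel p (\<lambda>x. SUP n. seqn q B (a n) x)"
      unfolding mixed_def by (intro arg_cong[where f = "lnorm lborel p"] ext)
    also have "\<dots> = (SUP n. mixed p q B (a n))"
      unfolding mixed_def using p q inc
      by (intro lnorm_monotone_convergence) (auto simp: incseq_def intro!: seqn_mono mult_right_mono)
    also have "\<dots> \<le> X" using 1 le by (intro SUP_least) (simp add: tseq_norm_def)
    finally show ?thesis using 1 by (simp add: tseq_norm_def)
  next
    case 2
    have Q: "0 < enn2real q" using exponent_pos[OF q 2(2)] by simp
    have "carl q (\<lambda>i. SUP n. a n i) \<le> X"
    proof (rule carl_leI[OF Q])
      fix z and R :: real assume R: "0 < R"
      let ?w = "\<lambda>i. vol (B i) * of_bool (B i \<subseteq> ball z R)"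
      have "(\<Sum>i. epow (SUP n. a n i) (enn2real q) * ?w i) = (\<Sum>i. SUP n. epow (a n i) (enn2real q) * ?w i)"
        using Q by (simp add: epow_SUP SUP_mult_right_ennreal)
      also have "\<dots> = (SUP n. \<Sum>i. epow (a n i) (enn2real q) * ?w i)"
        using inc Q by (intro ennreal_suminf_SUP_eq) (auto simp: incseq_def intro!: mult_right_mono epow_mono)
      also have "\<dots> \<le> epow X (enn2real q) * vol (ball z R)"
      proof (intro SUP_least)
        fix n
        have "carl q (a n) \<le> X" using le[of n] 2 by (simp add: tseq_norm_def)
        then show "(\<Sum>i. epow (a n i) (enn2real q) * ?w i) \<le> epow X (enn2real q) * vol (ball z R)"
          using Q by (intro order_trans[OF carlD[OF Q R]] mult_right_mono epow_mono) auto
      qed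
      finally show "(\<Sum>i. epow (SUP n. a n i) (enn2real q) * ?w i) \<le> epow X (enn2real q) * vol (ball z R)" .
    qed
    then show ?thesis using 2 by (simp add: tseq_norm_def)
  next
    case 3
    then have "a n i \<le> X" for n i
      using le[of n] by (auto simp: tseq_norm_def SUP_le_iff)
    then show ?thesis using 3 by (auto simp: tseq_norm_def intro!: SUP_least)
  qed
qed

section \<open>Reduction to finitely supported real sequences\<close>

definition supp :: "nat \<Rightarrow> (nat \<Rightarrow> real) \<Rightarrow> bool" where
  "supp n b \<longleftrightarrow> (\<forall>i. 0 \<le> b i \<and> (n \<le> i \<longrightarrow> b i = 0))"

lemma suppD: "supp n b \<Longrightarrow> 0 \<le> b i" "supp n b \<Longrightarrow> n \<le> i \<Longrightarrow> b i = 0"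
  by (auto simp: supp_def)

text \<open>The bound for all truncations passes to the sequence by the Fatou property. Every
  estimate by absorption or by a finite selection reaches general sequences this way.\<close>

lemma tseq_norm_truncI:
  assumes p: "1 \<le> p" and q: "1 \<le> q"
    and le: "\<And>n b. supp n b \<Longrightarrow> (\<And>i. ennreal (b i) \<le> a i) \<Longrightarrow> tseq_norm p q (\<lambda>i. ennreal (b i)) \<le> X"
  shows "tseq_norm p q a \<le> X"
proof -
  \<comment> \<open>Cut both in the index and in the value, so that the truncation is real even
    where \<open>a i\<close> is infinite.\<close>
  define f where "f n i = (if i < n then min (a i) (of_nat n) else 0)" for n i
  have fin: "f n i < top" for n i by (auto simp: f_def min_less_iff_disj of_nat_less_top)
  have "(SUP n. f n i) = a i" for i
  proof (rule antisym)
    show "(SUP n. f n i) \<le> a i" by (intro SUP_least) (simp add: f_def)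
    have "a i = min (a i) (SUP n. of_nat n)" by (simp add: ennreal_SUP_of_nat_eq_top)
    also have "\<dots> = (SUP n. min (a i) (of_nat n))" by (simp add: inf_min[symmetric] inf_SUP)
    also have "\<dots> \<le> (SUP n. f n i)"
    proof (intro SUP_mono)
      fix n
      show "\<exists>m\<in>UNIV. min (a i) (of_nat n) \<le> f m i"
        by (intro bexI[of _ "max n (Suc i)"]) (auto simp: f_def min.coboundedI2 max_def)
    qed
    finally show "a i \<le> (SUP n. f n i)" .
  qed
  then have eq: "a = (\<lambda>i. SUP n. f n i)" by auto
  show ?thesis
  proof (subst eq, rule tseq_norm_SUP_leI[OF p q])
    fix i show "incseq (\<lambda>n. f n i)"
      by (rule incseq_SucI) (auto simp: f_def min_def intro: order_trans)
  next
    fix n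
    have "(\<lambda>i. ennreal (enn2real (f n i))) = f n" using fin by (intro ext ennreal_enn2real) auto
    moreover have "supp n (\<lambda>i. enn2real (f n i))" by (auto simp: supp_def f_def)
    moreover have "f n i \<le> a i" for i by (auto simp: f_def)
    ultimately show "tseq_norm p q (f n) \<le> X" using le[of n "\<lambda>i. enn2real (f n i)"] fin by simp
  qed
qed

lemma suminf_supp:
  assumes "supp n b" "0 < Q"
  shows "(\<Sum>i. epow (ennreal (b i)) Q * w i) = (\<Sum>i<n. ennreal (b i powr Q) * w i)"
proof -
  have "(\<Sum>i. epow (ennreal (b i)) Q * w i) = (\<Sum>i<n. epow (ennreal (b i)) Q * w i)"
    using suppD[OF assms(1)] by (intro suminf_finite) auto
  then show ?thesis using suppD[OF assms(1)] by simp
qed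

lemma seqn_supp_finite:
  assumes "supp n b" "1 \<le> q" "q \<noteq> top"
  shows "seqn q E (\<lambda>i. ennreal (b i)) x = epow (lsum {..<n} E (\<lambda>i. b i powr enn2real q) x) (1 / enn2real q)"
  using suminf_supp[OF assms(1), of "enn2real q" "\<lambda>i. indicator (E i) x"] exponent_pos[OF assms(2,3)] assms(3)
  by (simp add: seqn_finite lsum_def)

lemma seqn_supp_top:
  assumes "supp n b"
  shows "seqn top E (\<lambda>i. ennreal (b i)) x = (SUP i\<in>{..<n}. ennreal (b i) * indicator (E i) x)"
  unfolding seqn_top
proof (rule antisym)
  show "(SUP i. ennreal (b i) * indicator (E i) x) \<le> (SUP i\<in>{..<n}. ennreal (b i) * indicator (E i) x)"
  proof (rule SUP_least)
    fix i show "ennreal (b i) * indicator (E i) x \<le> (SUP i\<in>{..<n}. ennreal (b i) * indicator (E i) x)"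
      by (cases "i < n") (auto simp: suppD(2)[OF assms] intro: SUP_upper)
  qed
qed (rule SUP_subset_mono, auto)

lemma sparse_onI_B: "\<eta> \<le> 1 \<Longrightarrow> sparse_on J \<eta> B"
  unfolding sparse_on_def using mult_right_mono[of "ennreal \<eta>" 1] by (auto simp: ennreal_le_1)

text \<open>For finite \<open>p\<close> this is the change of aperture applied to
  \<open>q\<close>-th powers, with exponent \<open>p / q\<close>, or to suprema. For the Carleson
  norm, integrate the essential bound of the sum over a test ball: each ball inside it contributes
  at least \<open>\<eta>\<close> times its volume through \<open>E i\<close>. For
  \<open>p = q = top\<close> it is enough that \<open>E i\<close> is not null.\<close>

lemma tseq_norm_le_mixed:
  assumes \<eta>: "0 < \<eta>" and p: "1 \<le> p" and q: "1 \<le> q"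
  shows "\<exists>C>0. \<forall>E a. sparse_on UNIV \<eta> E \<longrightarrow> tseq_norm p q a \<le> ennreal C * mixed p q E a"
proof -
  consider "p \<noteq> top" "q \<noteq> top" | "p \<noteq> top" "q = top" | "p = top" "q \<noteq> top" | "p = top" "q = top" by blast
  then show ?thesis
  proof cases
    case 1
    define P Q where "P = enn2real p" and "Q = enn2real q"
    have PQ: "0 < P" "0 < Q" using exponent_pos[OF p 1(1)] exponent_pos[OF q 1(2)] by (auto simp: P_def Q_def)
    obtain C where C: "C > 0" "\<And>J E b. finite J \<Longrightarrow> sparse_on J \<eta> E \<Longrightarrow> (\<forall>i\<in>J. 0 \<le> b i) \<Longrightarrow>
       (\<integral>\<^sup>+x. epow (lsum J B b x) (P / Q) \<partial>lborel) \<le> ennreal C * (\<integral>\<^sup>+x. epow (lsum J E b x) (P / Q) \<partial>lborel)"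
      using sparse_sum[OF \<eta>, of "P / Q"] PQ by auto
    have "tseq_norm p q a \<le> ennreal (C powr (1 / P)) * mixed p q E a" if E: "sparse_on UNIV \<eta> E" for E a
    proof (rule tseq_norm_truncI[OF p q])
      fix n b assume b: "supp n b" and ba: "\<And>i. ennreal (b i) \<le> a i"
      have mx: "mixed p q F (\<lambda>i. ennreal (b i)) = epow (\<integral>\<^sup>+x. epow (lsum {..<n} F (\<lambda>i. b i powr Q) x) (P / Q) \<partial>lborel) (1 / P)" for F
        using PQ 1 by (simp add: mixed_finite P_def[symmetric] seqn_supp_finite[OF b q] Q_def[symmetric] epow_epow)
      have "sparse_on {..<n} \<eta> E" using E by (auto simp: sparse_on_def)
      then have "mixed p q B (\<lambda>i. ennreal (b i)) \<le> epow (ennreal C * (\<integral>\<^sup>+x. epow (lsum {..<n} E (\<lambda>i. b i powr Q) x) (P / Q) \<partial>lborel)) (1 / P)"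
        unfolding mx using PQ by (intro epow_mono C) auto
      also have "\<dots> = ennreal (C powr (1 / P)) * mixed p q E (\<lambda>i. ennreal (b i))"
        unfolding mx using C(1) by (simp add: epow_mult)
      also have "\<dots> \<le> ennreal (C powr (1 / P)) * mixed p q E a"
        by (intro mult_left_mono mixed_mono_fun p q ba) auto
      finally show "tseq_norm p q (\<lambda>i. ennreal (b i)) \<le> ennreal (C powr (1 / P)) * mixed p q E a"
        using 1 by (simp add: tseq_norm_def)
    qed
    then show ?thesis using C(1) by (intro exI[of _ "C powr (1 / P)"]) auto
  next
    case 2
    define P where "P = enn2real p"
    have P: "0 < P" using exponent_pos[OF p 2(1)] by (auto simp: P_def)
    obtain C where C: "C > 0" "\<And>J E b. finite J \<Longrightarrow> sparse_on J \<eta> E \<Longrightarrow>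
       (\<integral>\<^sup>+x. epow (SUP i\<in>J. b i * indicator (B i) x) P \<partial>lborel) \<le> ennreal C * (\<integral>\<^sup>+x. epow (SUP i\<in>J. b i * indicator (E i) x) P \<partial>lborel)"
      using sparse_SUP[OF \<eta>, of P] P by auto
    have "tseq_norm p q a \<le> ennreal (C powr (1 / P)) * mixed p q E a" if E: "sparse_on UNIV \<eta> E" for E a
    proof (rule tseq_norm_truncI[OF p q])
      fix n b assume b: "supp n b" and ba: "\<And>i. ennreal (b i) \<le> a i"
      have mx: "mixed p q F (\<lambda>i. ennreal (b i)) = epow (\<integral>\<^sup>+x. epow (SUP i\<in>{..<n}. ennreal (b i) * indicator (F i) x) P \<partial>lborel) (1 / P)" for F
        using 2 by (simp add: mixed_finite P_def[symmetric] seqn_supp_top[OF b])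
      have "sparse_on {..<n} \<eta> E" using E by (auto simp: sparse_on_def)
      then have "mixed p q B (\<lambda>i. ennreal (b i)) \<le> epow (ennreal C * (\<integral>\<^sup>+x. epow (SUP i\<in>{..<n}. ennreal (b i) * indicator (E i) x) P \<partial>lborel)) (1 / P)"
        unfolding mx using P by (intro epow_mono C) auto
      also have "\<dots> = ennreal (C powr (1 / P)) * mixed p q E (\<lambda>i. ennreal (b i))"
        unfolding mx using C(1) by (simp add: epow_mult)
      also have "\<dots> \<le> ennreal (C powr (1 / P)) * mixed p q E a"
        by (intro mult_left_mono mixed_mono_fun p q ba) auto
      finally show "tseq_norm p q (\<lambda>i. ennreal (b i)) \<le> ennreal (C powr (1 / P)) * mixed p q E a"
        using 2 by (simp add: tseq_norm_def)
    qed
    then show ?thesis using C(1) by (intro exI[of _ "C powr (1 / P)"]) auto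
  next
    case 3
    define Q where "Q = enn2real q"
    have Q: "0 < Q" using exponent_pos[OF q 3(2)] by (auto simp: Q_def)
    define K where "K = (1 / \<eta>) powr (1 / Q)"
    have K: "0 < K" "K powr Q = 1 / \<eta>" using \<eta> Q by (auto simp: K_def powr_powr)
    have "tseq_norm p q a \<le> ennreal K * mixed p q E a" if E: "sparse_on UNIV \<eta> E" for E a
    proof -
      note Ei = sparse_onD[OF E UNIV_I]
      have [measurable]: "E i \<in> sets borel" for i using Ei by simp
      define N where "N = mixed p q E a"
      have AE: "AE x in lborel. (\<Sum>i. epow (a i) Q * indicator (E i) x) \<le> epow N Q"
        using AE_le_lnorm_top[of "seqn q E a" lborel]
      proof eventually_elim
        case (elim x)
        then show ?case using 3 Q epow_le_iff[of "1 / Q"]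
          by (simp add: N_def mixed_def seqn_finite Q_def[symmetric])
      qed
      have "carl q a \<le> ennreal K * N"
      proof (rule carl_leI, unfold Q_def[symmetric])
        show "0 < Q" by (rule Q)
        fix z and R :: real assume R: "0 < R"
        let ?w = "\<lambda>i. of_bool (B i \<subseteq> ball z R) :: ennreal"
        have "(\<Sum>i. epow (a i) Q * (vol (B i) * ?w i)) \<le> (\<Sum>i. epow (a i) Q * ((ennreal (1 / \<eta>) * vol (E i)) * ?w i))"
          by (intro suminf_mono_ennreal mult_left_mono mult_right_mono vol_B_le_sparse[OF E UNIV_I \<eta>]) auto
        also have "\<dots> = (\<Sum>i. ennreal (1 / \<eta>) * (\<integral>\<^sup>+x. epow (a i) Q * ?w i * indicator (E i) x \<partial>lborel))"
          by (intro suminf_cong, subst nn_integral_cmult_indicator) (auto simp: mult_ac)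
        also have "\<dots> = ennreal (1 / \<eta>) * (\<integral>\<^sup>+x. (\<Sum>i. epow (a i) Q * ?w i * indicator (E i) x) \<partial>lborel)"
          by (subst nn_integral_suminf) auto
        also have "\<dots> \<le> ennreal (1 / \<eta>) * (\<integral>\<^sup>+x. epow N Q * indicator (ball z R) x \<partial>lborel)"
        proof (intro mult_left_mono nn_integral_mono_AE)
          show "AE x in lborel. (\<Sum>i. epow (a i) Q * ?w i * indicator (E i) x) \<le> epow N Q * indicator (ball z R) x"
            using AE
          proof eventually_elim
            case (elim x)
            have "(\<Sum>i. epow (a i) Q * ?w i * indicator (E i) x) \<le> (\<Sum>i. epow (a i) Q * indicator (E i) x * indicator (ball z R) x)"
            proof (intro suminf_mono_ennreal)
              fix i
              show "epow (a i) Q * ?w i * indicator (E i) x \<le> epow (a i) Q * indicator (E i) x * indicator (ball z R) x"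
                using Ei(2)[of i] by (cases "B i \<subseteq> ball z R"; cases "x \<in> E i") (auto dest!: subsetD)
            qed
            also have "\<dots> \<le> epow N Q * indicator (ball z R) x"
              using elim by (simp add: mult_right_mono)
            finally show ?case .
          qed
        qed simp
        also have "\<dots> = epow (ennreal K * N) Q * vol (ball z R)"
          using K by (simp add: nn_integral_cmult_indicator epow_mult mult.assoc)
        finally show "(\<Sum>i. epow (a i) Q * (vol (B i) * ?w i)) \<le> epow (ennreal K * N) Q * vol (ball z R)" .
      qed
      then show ?thesis using 3 by (simp add: tseq_norm_def N_def)
    qed
    then show ?thesis using K(1) by blast
  next
    case 4
    have "tseq_norm p q a \<le> ennreal 1 * mixed p q E a" if E: "sparse_on UNIV \<eta> E" for E a
    proof -
      have "a i \<le> mixed top top E a" for i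
      proof (rule ccontr)
        assume n: "\<not> a i \<le> mixed top top E a"
        have "AE x in lborel. seqn top E a x \<le> mixed top top E a"
          unfolding mixed_def by (rule AE_le_lnorm_top)
        then have "AE x in lborel. x \<notin> E i"
        proof eventually_elim
          case (elim x)
          then show ?case using n seqn_ge[of top a i E x] by (auto split: split_indicator_asm)
        qed
        moreover have "E i \<in> sets lborel" using sparse_onD(1)[OF E, of i] by simp
        ultimately have "vol (E i) = 0"
          using AE_iff_measurable[of "E i" lborel "\<lambda>x. x \<notin> E i"] by simp
        then show False using vol_sparse(1)[OF E, of i] \<eta> by simp
      qed
      then show ?thesis using 4 by (auto simp: tseq_norm_def intro: SUP_least)
    qed
    then show ?thesis by (intro exI[of _ 1]) auto
  qed
qed

text \<open>A single term already bounds the norm from below; in the Carleson case the test ball is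
  \<open>B i\<close> itself. The constant depends on \<open>i\<close>, which is harmless: it only
  serves to show that finite norm means finite entries and zero norm means zero entries.\<close>

lemma tseq_norm_ge_single:
  assumes p: "1 \<le> p" and q: "1 \<le> q"
  shows "\<exists>k>0. k < top \<and> (\<forall>a. k * a i \<le> tseq_norm p q a)"
proof (cases "p = top")
  case False
  define k where "k = lnorm lborel p (indicator (B i) :: 'a \<Rightarrow> ennreal)"
  have "k = epow (vol (B i)) (1 / enn2real p)"
    using False by (simp add: k_def lnorm_finite epow_mult_indicator[of 1, simplified])
  then have k: "0 < k" "k < top" using vol_B[of i] by (auto simp: less_le)
  have "k * a i \<le> tseq_norm p q a" for a
  proof -
    have "k * a i = lnorm lborel p (\<lambda>x. a i * indicator (B i) x)"
      unfolding k_def using p False by (subst lnorm_cmult) (auto simp: mult.commute)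
    also have "\<dots> \<le> mixed p q B a"
      unfolding mixed_def by (intro lnorm_mono seqn_ge p q)
    finally show ?thesis using False by (simp add: tseq_norm_def)
  qed
  then show ?thesis using k by blast
next
  case True
  have "1 * a i \<le> tseq_norm p q a" for a
  proof (cases "q = top")
    case False
    have Q: "0 < enn2real q" using exponent_pos[OF q False] by simp
    have "epow (a i) (enn2real q) * vol (B i) \<le> (\<Sum>j. epow (a j) (enn2real q) * (vol (B j) * of_bool (B j \<subseteq> B i)))"
      using le_suminf_ennreal[of "\<lambda>j. epow (a j) (enn2real q) * (vol (B j) * of_bool (B j \<subseteq> B i))" i] by simp
    also have "\<dots> \<le> epow (carl q a) (enn2real q) * vol (B i)"
      by (rule carlD[OF Q \<rho>_pos])
    finally have "epow (a i) (enn2real q) \<le> epow (carl q a) (enn2real q)"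
      using vol_B[of i] by (simp add: ennreal_mult_le_mult_iff mult.commute[of _ "vol (B i)"])
    then show ?thesis using Q True False by (simp add: epow_le_iff epow_epow tseq_norm_def)
  qed (use True in \<open>auto simp: tseq_norm_def intro: SUP_upper\<close>)
  then show ?thesis by (intro exI[of _ 1]) auto
qed

lemma tseq_norm_finite_imp: "1 \<le> p \<Longrightarrow> 1 \<le> q \<Longrightarrow> tseq_norm p q a < top \<Longrightarrow> a i < top"
  using tseq_norm_ge_single[of p q i] by (metis ennreal_mult_eq_top_iff less_irrefl less_top top_unique)

lemma tseq_norm_eq_0_imp: "1 \<le> p \<Longrightarrow> 1 \<le> q \<Longrightarrow> tseq_norm p q a = 0 \<Longrightarrow> a i = 0"
  using tseq_norm_ge_single[of p q i] by (metis less_irrefl le_zero_eq mult_eq_0_iff)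

end

section \<open>Sparse families adapted to a sequence, and Hoelder's inequality\<close>

text \<open>The norm of a test function that is a power \<open>t / p\<close> of \<open>f\<close>,
  uniformly in \<open>p\<close>. For \<open>p = top\<close> the exponent is \<open>0\<close>; then
  \<open>epow (f x) 0 \<le> 1\<close> by finiteness of \<open>f\<close>, and a vanishing integral
  makes both sides \<open>0\<close> thanks to \<open>epow 0 0 = 0\<close>.\<close>

lemma lnorm_epow_le:
  assumes p: "1 \<le> p" and t: "0 < t" and [measurable]: "f \<in> borel_measurable M" and fin: "\<And>x. f x < top"
  shows "lnorm M p (\<lambda>x. epow (f x) (t * rexp p)) \<le> epow (\<integral>\<^sup>+x. epow (f x) t \<partial>M) (rexp p)"
proof (cases "p = top")
  case False
  then show ?thesis using exponent_pos[OF p False]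
    by (simp add: lnorm_finite epow_epow rexp_finite[OF p])
next
  case True
  define I where "I = (\<integral>\<^sup>+x. epow (f x) t \<partial>M)"
  consider "I = 0" | "I = top" | y where "I = ennreal y" "0 < y"
    by (cases I) (auto simp: less_le)
  then show ?thesis
  proof cases
    case 1
    then have "AE x in M. f x = 0" by (simp add: I_def nn_integral_0_iff_AE)
    then have "AE x in M. epow (f x) (t * rexp p) \<le> 0" by eventually_elim simp
    then show ?thesis using True by (auto intro: order_trans[OF lnorm_top_leI])
  next
    case 2
    then show ?thesis by (simp add: I_def)
  next
    case 3
    have "epow (f x) 0 \<le> 1" for x using fin[of x] by (cases "f x") (auto simp: powr_def)
    then have "lnorm M top (\<lambda>x. epow (f x) 0) \<le> 1" by (intro lnorm_top_leI) auto
    then show ?thesis using True 3 by (simp add: I_def[symmetric])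
  qed
qed

lemma lnorm_indicator_le:
  assumes p: "1 \<le> p" and [measurable]: "A \<in> sets M" and "0 < emeasure M A" "emeasure M A < top"
  shows "lnorm M p (\<lambda>x. indicator A x) \<le> epow (emeasure M A) (rexp p)"
proof (cases "p = top")
  case False
  then show ?thesis by (simp add: lnorm_finite epow_mult_indicator[of 1, simplified] rexp_finite[OF p])
next
  case True
  obtain v where "emeasure M A = ennreal v" "0 < v" using assms(3,4) by (cases "emeasure M A") auto
  moreover have "lnorm M top (\<lambda>x. indicator A x) \<le> 1" by (intro lnorm_top_leI) (auto simp: indicator_def)
  ultimately show ?thesis using True by simp
qed

context ball_family
begin

lemma tseq_norm_supp_finite:
  assumes b: "supp n b" and p: "1 \<le> p" and q: "1 \<le> q"
  shows "tseq_norm p q (\<lambda>i. ennreal (b i)) < top"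
proof -
  consider "p \<noteq> top" "q \<noteq> top" | "p \<noteq> top" "q = top" | "p = top" "q \<noteq> top" | "p = top" "q = top" by blast
  then show ?thesis
  proof cases
    case 1
    then show ?thesis using exponent_pos[OF p 1(1)] exponent_pos[OF q 1(2)]
      by (simp add: tseq_norm_def mixed_finite seqn_supp_finite[OF b q] epow_epow nn_integral_lsum_finite)
  next
    case 2
    have "(\<integral>\<^sup>+x. epow (seqn q B (\<lambda>i. ennreal (b i)) x) (enn2real p) \<partial>lborel)
       \<le> (\<integral>\<^sup>+x. epow (lsum {..<n} B b x) (enn2real p) \<partial>lborel)"
      unfolding 2(2) seqn_supp_top[OF b] lsum_def
      by (intro nn_integral_mono epow_mono SUP_le_sum_ennreal) auto
    also have "\<dots> < top" using exponent_pos[OF p 2(1)] by (intro nn_integral_lsum_finite) auto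
    finally show ?thesis using 2 by (simp add: tseq_norm_def mixed_finite)
  next
    case 3
    have Q: "0 < enn2real q" using exponent_pos[OF q 3(2)] by simp
    define X where "X = epow (\<Sum>i<n. ennreal (b i powr enn2real q)) (1 / enn2real q)"
    have "carl q (\<lambda>i. ennreal (b i)) \<le> X"
    proof (rule carl_leI[OF Q])
      fix z :: 'a and R :: real assume "0 < R"
      have "(\<Sum>i. epow (ennreal (b i)) (enn2real q) * (vol (B i) * of_bool (B i \<subseteq> ball z R)))
        = (\<Sum>i<n. ennreal (b i powr enn2real q) * (vol (B i) * of_bool (B i \<subseteq> ball z R)))"
        by (rule suminf_supp[OF b Q])
      also have "\<dots> \<le> (\<Sum>i<n. ennreal (b i powr enn2real q) * vol (ball z R))"
        by (intro sum_mono mult_left_mono) (auto intro: emeasure_mono)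
      finally show "(\<Sum>i. epow (ennreal (b i)) (enn2real q) * (vol (B i) * of_bool (B i \<subseteq> ball z R)))
        \<le> epow X (enn2real q) * vol (ball z R)"
        using Q by (simp add: X_def epow_epow sum_distrib_right del: sum_ennreal)
    qed
    also have "X < top" by (simp add: X_def)
    finally show ?thesis using 3 by (simp add: tseq_norm_def)
  next
    case 4
    have "(SUP i. ennreal (b i)) \<le> (\<Sum>i<n. ennreal (b i))"
    proof (rule SUP_least)
      fix i show "ennreal (b i) \<le> (\<Sum>i<n. ennreal (b i))"
        using suppD(2)[OF b, of i] by (cases "i < n") (auto intro: member_le_sum)
    qed
    also have "\<dots> < top" by (simp add: sum_ennreal_less_top)
    finally show ?thesis using 4 by (simp add: tseq_norm_def)
  qed
qed

text \<open>In the Carleson case \<open>E\<^sub>i\<close> consists of the points of \<open>B\<^sub>i\<close> at which the sum over the balls not larger than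
  \<open>B\<^sub>i\<close> is at most a large multiple of the norm; the complement is small by Markov's inequality.\<close>
lemma sparse_witness:
  assumes p: "1 \<le> p" and q: "1 \<le> q"
  shows "\<exists>C>0. \<forall>n b. supp n b \<longrightarrow> (\<exists>E. sparse_on UNIV (3/4) E \<and>
     mixed p q E (\<lambda>i. ennreal (b i)) \<le> ennreal C * tseq_norm p q (\<lambda>i. ennreal (b i)))"
proof -
  consider "p \<noteq> top" | "p = top" "q = top" | "p = top" "q \<noteq> top" by blast
  then show ?thesis
  proof cases
    case 1
    then show ?thesis using sparse_onI_B[of "3/4" UNIV]
      by (intro exI[of _ 1]) (auto simp: tseq_norm_def intro!: exI[of _ B])
  next
    case 2
    have "mixed p q B a \<le> tseq_norm p q a" for a
    proof -
      have "seqn top B a x \<le> (SUP i. a i)" for x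
        unfolding seqn_top by (intro SUP_mono) (auto simp: indicator_def)
      then show ?thesis using 2 by (simp add: mixed_def tseq_norm_def lnorm_top_leI)
    qed
    then show ?thesis using sparse_onI_B[of "3/4" UNIV]
      by (intro exI[of _ 1]) (auto intro!: exI[of _ B])
  next
    case 3
    define Q where "Q = enn2real q"
    have Q: "0 < Q" using exponent_pos[OF q 3(2)] by (simp add: Q_def)
    \<comment> \<open>A ball meeting \<open>B i\<close> whose radius is not larger lies in the
      threefold ball, which costs \<open>3^n\<close>. The factor \<open>4\<close> makes the
      exceptional set at most a quarter of \<open>B i\<close>.\<close>
    define C0 :: real where "C0 = 4 * 3 ^ DIM('a)"
    have C0: "0 < C0" by (simp add: C0_def)
    have "\<exists>E. sparse_on UNIV (3/4) E \<and> mixed p q E (\<lambda>i. ennreal (b i)) \<le> ennreal (C0 powr (1 / Q)) * tseq_norm p q (\<lambda>i. ennreal (b i))"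
      if b: "supp n b" for n b
    proof -
      define a where "a = (\<lambda>i. ennreal (b i))"
      define d where "d = epow (carl q a) Q"
      have Dfin: "tseq_norm p q a < top" using tseq_norm_supp_finite[OF b p q] by (simp add: a_def)
      show ?thesis
      proof (cases "d = 0")
        case True
        then have "a = (\<lambda>i. 0)" using tseq_norm_eq_0_imp[OF p q, of a] 3 by (auto simp: d_def tseq_norm_def)
        moreover have "mixed p q B (\<lambda>i. 0) = 0"
        proof -
          have "seqn q B (\<lambda>i. 0) = (\<lambda>x. 0)" using seqn_finite[OF 3(2), of B "\<lambda>_. 0"] by auto
          then show ?thesis unfolding mixed_def using p by simp
        qed
        ultimately show ?thesis unfolding a_def[symmetric]
          using sparse_onI_B[of "3/4" UNIV] by (intro exI[of _ B]) auto
      next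
        case False
        have "d < top" using Dfin 3 by (simp add: d_def tseq_norm_def)
        then obtain d' where d': "d = ennreal d'" "0 < d'"
          using False by (cases d) (auto simp: less_le)
        define h where "h i = lsum {j. j < n \<and> \<rho> j \<le> \<rho> i} B (\<lambda>j. b j powr Q)" for i
        define E where "E i = {x\<in>B i. h i x \<le> ennreal C0 * d}" for i
        define F where "F i = {x\<in>B i. ennreal C0 * d < h i x}" for i
        have [measurable]: "h i \<in> borel_measurable borel" for i unfolding h_def by measurable
        have [measurable]: "E i \<in> sets borel" "F i \<in> sets borel" for i by (auto simp: E_def F_def)
        have F4: "4 * vol (F i) \<le> vol (B i)" for i
        proof -
          let ?J = "{j. j < n \<and> \<rho> j \<le> \<rho> i}"
          have "ennreal C0 * d * vol (F i) = (\<integral>\<^sup>+x. ennreal C0 * d * indicator (F i) x \<partial>lborel)"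
            by (simp add: nn_integral_cmult_indicator)
          also have "\<dots> \<le> (\<integral>\<^sup>+x. h i x * indicator (B i) x \<partial>lborel)"
            by (intro nn_integral_mono) (auto simp: F_def indicator_def)
          also have "\<dots> = (\<Sum>j\<in>?J. ennreal (b j powr Q) * (\<integral>\<^sup>+x. indicator (B i) x * indicator (B j) x \<partial>lborel))"
            unfolding h_def by (rule nn_integral_lsum_mult) auto
          also have "\<dots> \<le> (\<Sum>j\<in>?J. ennreal (b j powr Q) * (vol (B j) * of_bool (B j \<subseteq> ball (c i) (3 * \<rho> i))))"
          proof (intro sum_mono mult_left_mono)
            fix j assume j: "j \<in> ?J"
            show "(\<integral>\<^sup>+x. indicator (B i) x * indicator (B j) x \<partial>lborel) \<le> vol (B j) * of_bool (B j \<subseteq> ball (c i) (3 * \<rho> i))"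
            proof (cases "B i \<inter> B j = {}")
              case True
              then have "(\<integral>\<^sup>+x. indicator (B i) x * indicator (B j) x \<partial>lborel) = 0"
                by (simp add: indicator_inter_arith[symmetric])
              then show ?thesis by simp
            next
              case False
              then obtain x where x: "dist (c i) x < \<rho> i" "dist (c j) x < \<rho> j" by auto
              have "B j \<subseteq> ball (c i) (3 * \<rho> i)"
              proof
                fix y assume y: "y \<in> B j"
                have "dist (c i) y \<le> dist (c i) x + dist (c j) x + dist (c j) y"
                  using dist_triangle[of "c i" y x] dist_triangle[of x y "c j"] by (simp add: dist_commute)
                then show "y \<in> ball (c i) (3 * \<rho> i)" using x y j by simp
              qed
              moreover have "(\<integral>\<^sup>+x. indicator (B i) x * indicator (B j) x \<partial>lborel) \<le> (\<integral>\<^sup>+x. indicator (B j) x \<partial>lborel)"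
                by (intro nn_integral_mono) (auto simp: indicator_def)
              ultimately show ?thesis by simp
            qed
          qed simp
          also have "\<dots> \<le> (\<Sum>j<n. ennreal (b j powr Q) * (vol (B j) * of_bool (B j \<subseteq> ball (c i) (3 * \<rho> i))))"
            by (intro sum_mono2) auto
          also have "\<dots> = (\<Sum>j. epow (a j) Q * (vol (B j) * of_bool (B j \<subseteq> ball (c i) (3 * \<rho> i))))"
            unfolding a_def by (rule suminf_supp[OF b Q, symmetric])
          also have "\<dots> \<le> d * vol (ball (c i) (3 * \<rho> i))"
            unfolding d_def Q_def using Q \<rho>_pos[of i] by (intro carlD) (auto simp: Q_def)
          also have "\<dots> = d * (ennreal (3 ^ DIM('a)) * vol (B i))"
            using emeasure_ball_scale[of "\<rho> i" 3 "c i" "c i"] \<rho>_pos[of i] by simp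
          finally have le: "ennreal C0 * d * vol (F i) \<le> d * (ennreal (3 ^ DIM('a)) * vol (B i))" .
          obtain v where v: "vol (B i) = ennreal v" "0 < v" using vol_B[of i] by (cases "vol (B i)") auto
          have "vol (F i) \<le> vol (B i)" by (intro emeasure_mono) (auto simp: F_def)
          then obtain f where f: "vol (F i) = ennreal f" "0 \<le> f" using v by (cases "vol (F i)") (auto simp: top_unique)
          have "ennreal (C0 * d' * f) \<le> ennreal (d' * (3 ^ DIM('a) * v))"
            using le d' v f C0 by (simp add: ennreal_mult)
          then have "(d' * 3 ^ DIM('a)) * (4 * f) \<le> (d' * 3 ^ DIM('a)) * v"
            using d' v by (subst (asm) ennreal_le_iff) (auto simp: C0_def mult_ac)
          then have "4 * f \<le> v" using d' by simp
          then have "ennreal (4 * f) \<le> ennreal v" by (rule ennreal_leI)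
          then show ?thesis using f v by (simp add: ennreal_mult)
        qed
        have "sparse_on UNIV (3/4) E"
          unfolding sparse_on_def
        proof (intro ballI conjI)
          fix i
          show "E i \<in> sets borel" "E i \<subseteq> B i" by (auto simp: E_def)
          have "B i = E i \<union> F i" by (auto simp: E_def F_def)
          moreover have "vol (E i) + vol (F i) = vol (E i \<union> F i)"
            by (intro plus_emeasure) (simp, simp, force simp: E_def F_def)
          ultimately have sum: "vol (B i) = vol (E i) + vol (F i)" by simp
          obtain v where v: "vol (B i) = ennreal v" "0 < v" using vol_B[of i] by (cases "vol (B i)") auto
          have "vol (E i) \<le> vol (B i)" "vol (F i) \<le> vol (B i)"
            by (auto intro!: emeasure_mono simp: E_def F_def)
          then have "vol (E i) < top" "vol (F i) < top" using vol_B(2)[of i] by (auto intro: le_less_trans)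
          then obtain e f where ef: "vol (E i) = ennreal e" "0 \<le> e" "vol (F i) = ennreal f" "0 \<le> f"
            by (cases "vol (E i)"; cases "vol (F i)") auto
          have "ennreal (4 * f) \<le> ennreal v" using F4[of i] ef v by (simp add: ennreal_mult)
          then have "4 * f \<le> v" using v by (subst (asm) ennreal_le_iff) auto
          moreover have "v = e + f" using sum v ef by (simp add: ennreal_plus[symmetric] del: ennreal_plus)
          ultimately have "3 / 4 * v \<le> e" by simp
          then have "ennreal (3 / 4 * v) \<le> ennreal e" by (rule ennreal_leI)
          then show "ennreal (3 / 4) * vol (B i) \<le> vol (E i)" using v ef by (subst (asm) ennreal_mult) auto
        qed
        moreover have "mixed p q E a \<le> ennreal (C0 powr (1 / Q)) * tseq_norm p q a"
        proof -
          have "seqn q E a x \<le> epow (ennreal C0 * d) (1 / Q)" for x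
          proof -
            have "lsum {..<n} E (\<lambda>i. b i powr Q) x \<le> ennreal C0 * d"
            proof -
              let ?T = "{i. i < n \<and> x \<in> E i}"
              have eq: "lsum {..<n} E (\<lambda>i. b i powr Q) x = (\<Sum>i\<in>?T. ennreal (b i powr Q))"
                unfolding lsum_def by (intro sum.mono_neutral_cong_right) auto
              show ?thesis
              proof (cases "?T = {}")
                case False
                \<comment> \<open>Among the sets \<open>E i\<close> containing x take one with the
                  largest radius: all the other balls involved are no larger, so the whole sum at x
                  is bounded by \<open>h i x\<close>, which the definition of \<open>E i\<close>
                  controls.\<close>
                have "finite (\<rho> ` ?T)" by simp
                then have "Max (\<rho> ` ?T) \<in> \<rho> ` ?T" using False by (intro Max_in) auto
                then obtain i where i: "i \<in> ?T" "\<rho> i = Max (\<rho> ` ?T)" by auto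
                have "(\<Sum>j\<in>?T. ennreal (b j powr Q)) = (\<Sum>j\<in>?T. ennreal (b j powr Q) * indicator (B j) x)"
                  by (intro sum.cong) (auto simp: E_def)
                also have "\<dots> \<le> h i x"
                  unfolding h_def lsum_def using i(2) by (intro sum_mono2) (auto intro!: Max_ge)
                also have "\<dots> \<le> ennreal C0 * d" using i by (auto simp: E_def)
                finally show ?thesis unfolding eq .
              next
                case True
                show ?thesis unfolding eq True by simp
              qed
            qed
            then show ?thesis unfolding a_def using Q
              by (simp add: seqn_supp_finite[OF b q 3(2)] Q_def[symmetric] epow_mono)
          qed
          then have "mixed p q E a \<le> epow (ennreal C0 * d) (1 / Q)"
            unfolding mixed_def using 3 by (auto intro: lnorm_top_leI)
          also have "\<dots> = ennreal (C0 powr (1 / Q)) * tseq_norm p q a"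
            using 3 Q C0 by (simp add: epow_mult d_def epow_epow tseq_norm_def)
          finally show ?thesis .
        qed
        ultimately show ?thesis unfolding a_def by blast
      qed
    qed
    then show ?thesis using C0 by (intro exI[of _ "C0 powr (1 / Q)"]) auto
  qed
qed

text \<open>The reason for the proportion \<open>3/4\<close> in the witnesses: the sets of two
  factors can be intersected and half of each ball is left.\<close>

lemma sparse_Int:
  assumes "sparse_on UNIV (3/4) E" "sparse_on UNIV (3/4) F"
  shows "sparse_on UNIV (1/2) (\<lambda>i. E i \<inter> F i)"
  unfolding sparse_on_def
proof (intro ballI conjI)
  fix i
  note Ei = sparse_onD[OF assms(1) UNIV_I, of i] and Fi = sparse_onD[OF assms(2) UNIV_I, of i]
  show "E i \<inter> F i \<in> sets borel" "E i \<inter> F i \<subseteq> B i" using Ei Fi by auto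
  have le: "vol (E i) \<le> vol (B i)" "vol (F i) \<le> vol (B i)" "vol (E i \<inter> F i) \<le> vol (B i)" "vol (E i \<union> F i) \<le> vol (B i)"
    using Ei Fi by (auto intro!: emeasure_mono)
  have eq: "vol (E i) + vol (F i) = vol (E i \<union> F i) + vol (E i \<inter> F i)"
    using Ei Fi le vol_B(2)[of i] by (intro emeasure_Un_Int) auto
  obtain v where v: "vol (B i) = ennreal v" "0 < v" using vol_B[of i] by (cases "vol (B i)") auto
  obtain e where e: "vol (E i) = ennreal e" "0 \<le> e" using le(1) v by (cases "vol (E i)") (auto simp: top_unique)
  obtain f where f: "vol (F i) = ennreal f" "0 \<le> f" using le(2) v by (cases "vol (F i)") (auto simp: top_unique)
  obtain g where g: "vol (E i \<inter> F i) = ennreal g" "0 \<le> g" using le(3) v by (cases "vol (E i \<inter> F i)") (auto simp: top_unique)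
  obtain u where u: "vol (E i \<union> F i) = ennreal u" "0 \<le> u" using le(4) v by (cases "vol (E i \<union> F i)") (auto simp: top_unique)
  have "e + f = u + g" using eq e f g u by (simp add: ennreal_plus[symmetric] del: ennreal_plus)
  moreover have "u \<le> v" using le(4) u v by simp
  moreover have "3 / 4 * v \<le> e"
  proof -
    have "ennreal (3 / 4 * v) \<le> ennreal e" using Ei(3) e v by (subst ennreal_mult) auto
    then show ?thesis using e by (subst (asm) ennreal_le_iff) auto
  qed
  moreover have "3 / 4 * v \<le> f"
  proof -
    have "ennreal (3 / 4 * v) \<le> ennreal f" using Fi(3) f v by (subst ennreal_mult) auto
    then show ?thesis using f by (subst (asm) ennreal_le_iff) auto
  qed
  ultimately have "1 / 2 * v \<le> g" by simp
  then have "ennreal (1 / 2 * v) \<le> ennreal g" by (rule ennreal_leI)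
  then show "ennreal (1 / 2) * vol (B i) \<le> vol (E i \<inter> F i)"
    using v g by (subst (asm) ennreal_mult) auto
qed

text \<open>Each factor brings its own witness sets. On their intersections Hoelder's inequality is
  applied at every point x to the sequences and then to the functions of x; the change of aperture
  returns to the full norm on the left, Carleson case included.\<close>

lemma tseq_norm_Holder_supp:
  assumes cp: "Holder_triple p0 p1 p2" and cq: "Holder_triple q0 q1 q2"
  shows "\<exists>C>0. \<forall>n a b. supp n a \<longrightarrow> supp n b \<longrightarrow>
    tseq_norm p0 q0 (\<lambda>i. ennreal (a i) * ennreal (b i)) \<le> ennreal C * (tseq_norm p1 q1 (\<lambda>i. ennreal (a i)) * tseq_norm p2 q2 (\<lambda>i. ennreal (b i)))"
proof -
  note P = Holder_tripleD[OF cp] and Q = Holder_tripleD[OF cq]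
  obtain C1 where C1: "C1 > 0" "\<And>n b. supp n b \<Longrightarrow> \<exists>E. sparse_on UNIV (3/4) E \<and>
     mixed p1 q1 E (\<lambda>i. ennreal (b i)) \<le> ennreal C1 * tseq_norm p1 q1 (\<lambda>i. ennreal (b i))"
    using sparse_witness[OF P(2) Q(2)] by auto
  obtain C2 where C2: "C2 > 0" "\<And>n b. supp n b \<Longrightarrow> \<exists>E. sparse_on UNIV (3/4) E \<and>
     mixed p2 q2 E (\<lambda>i. ennreal (b i)) \<le> ennreal C2 * tseq_norm p2 q2 (\<lambda>i. ennreal (b i))"
    using sparse_witness[OF P(3) Q(3)] by auto
  obtain C0 where C0: "C0 > 0" "\<And>E a. sparse_on UNIV (1/2) E \<Longrightarrow> tseq_norm p0 q0 a \<le> ennreal C0 * mixed p0 q0 E a"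
    using tseq_norm_le_mixed[of "1/2", OF _ P(1) Q(1)] by auto
  have "tseq_norm p0 q0 (\<lambda>i. ennreal (a i) * ennreal (b i)) \<le>
      ennreal (C0 * (C1 * C2)) * (tseq_norm p1 q1 (\<lambda>i. ennreal (a i)) * tseq_norm p2 q2 (\<lambda>i. ennreal (b i)))"
    if a: "supp n a" and b: "supp n b" for n a b
  proof -
    obtain E where E: "sparse_on UNIV (3/4) E" "mixed p1 q1 E (\<lambda>i. ennreal (a i)) \<le> ennreal C1 * tseq_norm p1 q1 (\<lambda>i. ennreal (a i))"
      using C1(2)[OF a] by auto
    obtain F where F: "sparse_on UNIV (3/4) F" "mixed p2 q2 F (\<lambda>i. ennreal (b i)) \<le> ennreal C2 * tseq_norm p2 q2 (\<lambda>i. ennreal (b i))"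
      using C2(2)[OF b] by auto
    let ?A = "\<lambda>i. ennreal (a i)" and ?B = "\<lambda>i. ennreal (b i)"
    have [measurable]: "E i \<in> sets borel" "F i \<in> sets borel" for i
      using sparse_onD(1)[OF E(1)] sparse_onD(1)[OF F(1)] by auto
    have "tseq_norm p0 q0 (\<lambda>i. ?A i * ?B i) \<le> ennreal C0 * mixed p0 q0 (\<lambda>i. E i \<inter> F i) (\<lambda>i. ?A i * ?B i)"
      by (rule C0(2)[OF sparse_Int[OF E(1) F(1)]])
    also have "mixed p0 q0 (\<lambda>i. E i \<inter> F i) (\<lambda>i. ?A i * ?B i) \<le> mixed p1 q1 E ?A * mixed p2 q2 F ?B"
    proof -
      have "seqn q0 (\<lambda>i. E i \<inter> F i) (\<lambda>i. ?A i * ?B i) x \<le> seqn q1 E ?A x * seqn q2 F ?B x" for x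
      proof -
        have "seqn q0 (\<lambda>i. E i \<inter> F i) (\<lambda>i. ?A i * ?B i) x
           = lnorm (count_space UNIV) q0 (\<lambda>i. (?A i * indicator (E i) x) * (?B i * indicator (F i) x))"
          unfolding seqn_def by (intro arg_cong[where f = "lnorm _ _"] ext) (auto simp: indicator_def)
        also have "\<dots> \<le> seqn q1 E ?A x * seqn q2 F ?B x"
          unfolding seqn_def by (rule lnorm_Holder[OF cq]) auto
        finally show ?thesis .
      qed
      then have "mixed p0 q0 (\<lambda>i. E i \<inter> F i) (\<lambda>i. ?A i * ?B i) \<le> lnorm lborel p0 (\<lambda>x. seqn q1 E ?A x * seqn q2 F ?B x)"
        unfolding mixed_def by (intro lnorm_mono P)
      also have "\<dots> \<le> mixed p1 q1 E ?A * mixed p2 q2 F ?B"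
        unfolding mixed_def by (rule lnorm_Holder[OF cp]) auto
      finally show ?thesis .
    qed
    also have "\<dots> \<le> (ennreal C1 * tseq_norm p1 q1 ?A) * (ennreal C2 * tseq_norm p2 q2 ?B)"
      by (intro mult_mono E F) auto
    finally have "tseq_norm p0 q0 (\<lambda>i. ?A i * ?B i) \<le> ennreal C0 * ((ennreal C1 * tseq_norm p1 q1 ?A) * (ennreal C2 * tseq_norm p2 q2 ?B))"
      by (simp add: mult_left_mono)
    also have "\<dots> = ennreal (C0 * (C1 * C2)) * (tseq_norm p1 q1 ?A * tseq_norm p2 q2 ?B)"
      using C0(1) C1(1) C2(1) by (simp add: ennreal_mult mult_ac)
    finally show ?thesis .
  qed
  then show ?thesis using C0(1) C1(1) C2(1) by (intro exI[of _ "C0 * (C1 * C2)"]) auto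
qed

text \<open>Finite norms force finite entries, so cutting off the index alone yields finitely
  supported real sequences increasing to the product.\<close>

lemma tseq_norm_Holder:
  assumes cp: "Holder_triple p0 p1 p2" and cq: "Holder_triple q0 q1 q2"
  shows "\<exists>C>0. \<forall>a b. tseq_norm p1 q1 a < top \<longrightarrow> tseq_norm p2 q2 b < top \<longrightarrow>
    tseq_norm p0 q0 (\<lambda>i. a i * b i) \<le> ennreal C * (tseq_norm p1 q1 a * tseq_norm p2 q2 b)"
proof -
  note P = Holder_tripleD[OF cp] and Q = Holder_tripleD[OF cq]
  obtain C where C: "C > 0" "\<And>n a b. supp n a \<Longrightarrow> supp n b \<Longrightarrow>
    tseq_norm p0 q0 (\<lambda>i. ennreal (a i) * ennreal (b i)) \<le> ennreal C * (tseq_norm p1 q1 (\<lambda>i. ennreal (a i)) * tseq_norm p2 q2 (\<lambda>i. ennreal (b i)))"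
    using tseq_norm_Holder_supp[OF cp cq] by blast
  have "tseq_norm p0 q0 (\<lambda>i. a i * b i) \<le> ennreal C * (tseq_norm p1 q1 a * tseq_norm p2 q2 b)"
    if a: "tseq_norm p1 q1 a < top" and b: "tseq_norm p2 q2 b < top" for a b
  proof -
    define t where "t n z i = (if i < n then enn2real (z i) else 0)" for n :: nat and z :: "nat \<Rightarrow> ennreal" and i
    have fin: "a i < top" "b i < top" for i
      using tseq_norm_finite_imp[OF P(2) Q(2) a] tseq_norm_finite_imp[OF P(3) Q(3) b] by auto
    have le: "ennreal (t n a i) \<le> a i" "ennreal (t n b i) \<le> b i" for n i
      using fin[of i] by (auto simp: t_def)
    have eq: "a i * b i = (SUP n. ennreal (t n a i) * ennreal (t n b i))" for i
    proof (rule antisym)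
      show "a i * b i \<le> (SUP n. ennreal (t n a i) * ennreal (t n b i))"
        using fin[of i] by (intro SUP_upper2[of "Suc i"]) (auto simp: t_def)
    qed (auto intro!: SUP_least mult_mono le)
    show ?thesis unfolding eq
    proof (rule tseq_norm_SUP_leI[OF P(1) Q(1)])
      show "incseq (\<lambda>n. ennreal (t n a i) * ennreal (t n b i))" for i
        by (auto simp: incseq_def t_def intro!: mult_mono ennreal_leI)
      fix n
      have "supp n (t n a)" "supp n (t n b)" by (auto simp: supp_def t_def)
      then have "tseq_norm p0 q0 (\<lambda>i. ennreal (t n a i) * ennreal (t n b i)) \<le> ennreal C * (tseq_norm p1 q1 (\<lambda>i. ennreal (t n a i)) * tseq_norm p2 q2 (\<lambda>i. ennreal (t n b i)))"
        by (rule C(2))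
      also have "\<dots> \<le> ennreal C * (tseq_norm p1 q1 a * tseq_norm p2 q2 b)"
        by (intro mult_left_mono mult_mono tseq_norm_mono P Q le) auto
      finally show "tseq_norm p0 q0 (\<lambda>i. ennreal (t n a i) * ennreal (t n b i)) \<le> ennreal C * (tseq_norm p1 q1 a * tseq_norm p2 q2 b)" .
    qed
  qed
  then show ?thesis using C(1) by blast
qed

end

section \<open>Multipliers of sequence spaces\<close>

text \<open>The common last step for finite \<open>p2\<close>. \<open>X\<close> is the
  \<open>P2\<close>-th power of the norm of the multiplier, \<open>W\<close> the norm of the test
  sequence and \<open>Z\<close> that of the product; cancelling \<open>epow X r1\<close> leaves
  exactly the exponent \<open>1 / P2\<close>.\<close>

lemma ennreal_cancel_power:
  assumes rel: "1 / P0 = r1 + 1 / P2" and P: "0 < P0" "0 < P2" and C: "0 < C1" "0 < C2" "0 \<le> K"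
    and X: "X < top" "X \<le> ennreal C1 * Y"
    and Y: "epow Y (1 / P0) \<le> Z" and Z: "Z \<le> ennreal K * W" and W: "W \<le> ennreal C2 * epow X r1"
  shows "epow X (1 / P2) \<le> ennreal (C1 powr (1 / P0) * C2 * K)"
proof (cases "X = 0")
  case False
  then obtain x where x: "X = ennreal x" "0 < x" using X(1) by (cases X) (auto simp: less_le)
  have "epow X (1 / P0) \<le> epow (ennreal C1 * Y) (1 / P0)"
    using X(2) P by (intro epow_mono) auto
  also have "\<dots> = ennreal (C1 powr (1 / P0)) * epow Y (1 / P0)"
    using C by (simp add: epow_mult)
  also have "\<dots> \<le> ennreal (C1 powr (1 / P0)) * (ennreal K * (ennreal C2 * epow X r1))"
    by (intro mult_left_mono order_trans[OF Y] order_trans[OF Z] W) auto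
  finally have "ennreal (x powr (1 / P0)) \<le> ennreal (C1 powr (1 / P0) * (K * (C2 * x powr r1)))"
    using x C by (simp add: ennreal_mult)
  then have "x powr (1 / P0) \<le> C1 powr (1 / P0) * (K * (C2 * x powr r1))"
    using C by (subst (asm) ennreal_le_iff) auto
  moreover have "x powr (1 / P0) = x powr (1 / P2) * x powr r1"
    unfolding rel by (simp add: powr_add)
  ultimately have "x powr (1 / P2) * x powr r1 \<le> (C1 powr (1 / P0) * C2 * K) * x powr r1"
    by (simp add: mult_ac)
  then have "x powr (1 / P2) \<le> C1 powr (1 / P0) * C2 * K" using x by simp
  then show ?thesis using x by (simp add: ennreal_leI)
qed simp

context ball_family
begin

text \<open>The multiplier bound is tested only on sequences supported below \<open>n\<close>: these
  come from functions living on finitely many boxes, and they suffice for a \<open>b\<close> with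
  the same support.\<close>

definition mult_le :: "ennreal \<Rightarrow> ennreal \<Rightarrow> ennreal \<Rightarrow> ennreal \<Rightarrow> nat \<Rightarrow> (nat \<Rightarrow> real) \<Rightarrow> real \<Rightarrow> bool" where
  "mult_le p0 q0 p1 q1 n b K \<longleftrightarrow> 0 \<le> K \<and> (\<forall>a. supp n a \<longrightarrow>
     tseq_norm p0 q0 (\<lambda>i. ennreal (a i * b i)) \<le> ennreal K * tseq_norm p1 q1 (\<lambda>i. ennreal (a i)))"

lemma mult_leD:
  assumes "mult_le p0 q0 p1 q1 n b K"
  shows "0 \<le> K" "supp n a \<Longrightarrow> tseq_norm p0 q0 (\<lambda>i. ennreal (a i * b i)) \<le> ennreal K * tseq_norm p1 q1 (\<lambda>i. ennreal (a i))"
  using assms by (auto simp: mult_le_def)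

text \<open>Test against unit vectors: their norm is finite and nonzero and cancels.\<close>

lemma tseq_norm_converse_top_top:
  assumes p: "1 \<le> p" and q: "1 \<le> q" and b: "supp n b" and m: "mult_le p q p q n b K"
  shows "tseq_norm top top (\<lambda>i. ennreal (b i)) \<le> ennreal K"
proof -
  have "ennreal (b i) \<le> ennreal K" for i
  proof (cases "0 < b i")
    case True
    then have i: "i < n" using suppD(2)[OF b, of i] by (cases "i < n") auto
    define e where "e j = (if j = i then 1 else 0 :: real)" for j
    have e: "supp n e" using i by (auto simp: supp_def e_def)
    define X where "X = tseq_norm p q (\<lambda>j. ennreal (e j))"
    have "X < top" unfolding X_def by (rule tseq_norm_supp_finite[OF e p q])
    moreover have "X \<noteq> 0" using tseq_norm_eq_0_imp[OF p q, of "\<lambda>j. ennreal (e j)" i] by (auto simp: X_def e_def)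
    ultimately obtain x where x: "X = ennreal x" "0 < x" by (cases X) (auto simp: less_le)
    have "(\<lambda>j. ennreal (e j)) = (\<lambda>j. ennreal (1 / b i) * ennreal (e j * b j))"
      using True by (auto simp: e_def ennreal_mult[symmetric])
    then have "X \<le> ennreal (1 / b i) * tseq_norm p q (\<lambda>j. ennreal (e j * b j))"
      unfolding X_def using tseq_norm_cmult_le[OF p q, of "ennreal (1 / b i)" "\<lambda>j. ennreal (e j * b j)"] by simp
    also have "\<dots> \<le> ennreal (1 / b i) * (ennreal K * X)"
      unfolding X_def by (intro mult_left_mono mult_leD(2)[OF m e]) auto
    finally have "x \<le> 1 / b i * (K * x)"
      using x True mult_leD(1)[OF m] by (simp add: ennreal_mult[symmetric])
    then have "b i \<le> K" using x True by (simp add: field_simps)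
    then show ?thesis by (rule ennreal_leI)
  next
    case False
    then show ?thesis using suppD(1)[OF b, of i] mult_leD(1)[OF m] by simp
  qed
  then show ?thesis by (simp add: tseq_norm_def SUP_le_iff)
qed

text \<open>Let \<open>S\<close> be the sum of \<open>b_i^Q2\<close> over the balls, so that the
  norm of \<open>b\<close> is the \<open>P2\<close>-th root of \<open>X\<close>, the integral of
  \<open>S^(P2/Q2)\<close>. The test sequence \<open>b_i^(Q2 k1) m_i^\<delta>\<close>, with medians
  \<open>m_i\<close> of \<open>S\<close>, is built to have norm at most about \<open>X^r1\<close>,
  while its product with \<open>b\<close> has norm at least about \<open>X^(1/P0)\<close>.\<close>

lemma tseq_norm_converse_fin_fin:
  assumes cp: "Holder_triple p0 p1 p2" and cq: "Holder_triple q0 q1 q2" and fin: "p2 \<noteq> top" "q2 \<noteq> top"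
  shows "\<exists>C>0. \<forall>n b K. supp n b \<longrightarrow> mult_le p0 q0 p1 q1 n b K \<longrightarrow> tseq_norm p2 q2 (\<lambda>i. ennreal (b i)) \<le> ennreal (C * K)"
proof -
  note P = Holder_tripleD[OF cp] and Q = Holder_tripleD[OF cq]
  have fin0: "p0 \<noteq> top" "q0 \<noteq> top" using P(5) Q(5) fin by auto
  define P0 P2 Q0 Q2 r1 k1 where "P0 = enn2real p0" and "P2 = enn2real p2" and "Q0 = enn2real q0"
    and "Q2 = enn2real q2" and "r1 = rexp p1" and "k1 = rexp q1"
  note defs = P0_def[symmetric] P2_def[symmetric] Q0_def[symmetric] Q2_def[symmetric] r1_def[symmetric] k1_def[symmetric]
  have pos: "0 < P0" "0 < P2" "0 < Q0" "0 < Q2" "0 \<le> r1" "0 \<le> k1"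
    using exponent_pos[OF P(1) fin0(1)] exponent_pos[OF P(3) fin(1)] exponent_pos[OF Q(1) fin0(2)] exponent_pos[OF Q(3) fin(2)]
    by (auto simp: defs) (auto simp: r1_def k1_def)
  have rel: "1 / P0 = r1 + 1 / P2" "1 / Q0 = k1 + 1 / Q2"
    using P(1,3,4) Q(1,3,4) fin fin0 by (auto simp: rexp_finite defs)
  \<comment> \<open>If the median were \<open>S\<close> itself, the inner norm of the test sequence
    would be \<open>S^(\<delta> + k1)\<close>. The choice makes this \<open>S^((P2/Q2) r1)\<close>,
    whose norm with exponent \<open>p1\<close> is \<open>X^r1\<close>.\<close>
  define \<delta> where "\<delta> = P2 / Q2 * r1 - k1"
  define \<theta> where "\<theta> = (P2 / Q2) / (P0 / Q0)"
  \<comment> \<open>The same \<open>\<delta>\<close> is right for the product: up to medians, the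
    inner norm of \<open>a b\<close> raised to \<open>P0\<close> is
    \<open>S^(\<delta> P0 + P0/Q0)\<close>.\<close>
  have dP0: "\<delta> * P0 + P0 / Q0 = P2 / Q2"
  proof -
    have "P2 * r1 + 1 = P2 / P0" using rel(1) pos by (simp add: field_simps)
    moreover have "\<delta> + 1 / Q0 = (P2 * r1 + 1) / Q2" unfolding \<delta>_def rel(2) by (simp add: add_divide_distrib)
    ultimately have "\<delta> + 1 / Q0 = P2 / P0 / Q2" by simp
    then have "(\<delta> + 1 / Q0) * P0 = P2 / P0 / Q2 * P0" by simp
    then show ?thesis using pos by (simp add: field_simps)
  qed
  have th: "0 < \<theta>" using pos by (simp add: \<theta>_def)
  obtain C1 where C1: "C1 > 0" "\<And>J E b. finite J \<Longrightarrow> sparse_on J (1/2) E \<Longrightarrow> (\<forall>i\<in>J. 0 \<le> b i) \<Longrightarrow>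
    (\<integral>\<^sup>+x. epow (lsum J B b x) (P2 / Q2) \<partial>lborel) \<le> ennreal C1 * (\<integral>\<^sup>+x. epow (lsum J E b x) (P2 / Q2) \<partial>lborel)"
    using sparse_sum[of "1/2" "P2 / Q2"] pos by auto
  obtain C2 where C2: "C2 > 0" "\<And>E a. sparse_on UNIV (1/2) E \<Longrightarrow> tseq_norm p1 q1 a \<le> ennreal C2 * mixed p1 q1 E a"
    using tseq_norm_le_mixed[of "1/2", OF _ P(2) Q(2)] by auto
  \<comment> \<open>The power \<open>1 / \<theta>\<close> is the price of the absorption needed when
    \<open>\<delta>\<close> is negative.\<close>
  define C1' where "C1' = (if 0 \<le> \<delta> then C1 else C1 powr (1 / \<theta>))"
  have C1': "0 < C1'" using C1(1) by (simp add: C1'_def)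
  have "tseq_norm p2 q2 (\<lambda>i. ennreal (b i)) \<le> ennreal (C1' powr (1 / P0) * C2 * K)"
    if b: "supp n b" and m: "mult_le p0 q0 p1 q1 n b K" for n b K
  proof -
    define J where "J = {i. i < n \<and> 0 < b i}"
    have J: "finite J" by (simp add: J_def)
    have Jb: "i \<in> J \<Longrightarrow> 0 < b i" "i \<notin> J \<Longrightarrow> b i = 0" for i
      using suppD[OF b, of i] by (auto simp: J_def not_less le_less)
    define e where "e i = b i powr Q2" for i
    have e: "0 \<le> e i" "i \<in> J \<Longrightarrow> 0 < e i" "i \<notin> J \<Longrightarrow> e i = 0" for i using Jb[of i] by (auto simp: e_def)
    let ?S = "lsum J B e"
    define X where "X = (\<integral>\<^sup>+x. epow (?S x) (P2 / Q2) \<partial>lborel)"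
    have Xfin: "X < top" unfolding X_def using pos J by (intro nn_integral_lsum_finite) auto
    have "lsum {..<n} B e = ?S"
      unfolding lsum_def by (intro ext sum.mono_neutral_right) (auto simp: J_def e(3))
    then have D2: "tseq_norm p2 q2 (\<lambda>i. ennreal (b i)) = epow X (1 / P2)"
      using fin pos by (simp add: tseq_norm_def mixed_finite seqn_supp_finite[OF b Q(3)] defs epow_epow X_def e_def[abs_def])
    have Sfin: "?S x < top" for x by (rule lsum_finite[OF J])
    have Spos: "0 < ?S x" if i: "i \<in> J" "x \<in> B i" for i x
    proof -
      have "0 < ennreal (e i)" using e(2)[OF i(1)] by simp
      then show ?thesis using lsum_le[of i J x B e, OF i(1) J i(2)] by (rule less_le_trans)
    qed
    have "\<forall>i\<in>J. \<exists>m\<in>?S ` B i. vol (B i) \<le> 2 * vol {x\<in>B i. ?S x \<le> m} \<and> vol (B i) \<le> 2 * vol {x\<in>B i. m \<le> ?S x}"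
      using vol_B by (intro ballI median_exists finite_range_lsum[OF J]) auto
    from bchoice[OF this[unfolded Bex_def]] obtain m where
      "\<forall>i\<in>J. m i \<in> ?S ` B i \<and> vol (B i) \<le> 2 * vol {x\<in>B i. ?S x \<le> m i}
        \<and> vol (B i) \<le> 2 * vol {x\<in>B i. m i \<le> ?S x}" ..
    then have m': "\<And>i. i \<in> J \<Longrightarrow> m i \<in> ?S ` B i"
      "\<And>i. i \<in> J \<Longrightarrow> vol (B i) \<le> 2 * vol {x\<in>B i. ?S x \<le> m i}"
      "\<And>i. i \<in> J \<Longrightarrow> vol (B i) \<le> 2 * vol {x\<in>B i. m i \<le> ?S x}"
      by simp_all
    define \<mu> where "\<mu> i = enn2real (m i)" for i
    have mu: "m i = ennreal (\<mu> i)" "0 < \<mu> i" "0 < m i" "m i < top" if i: "i \<in> J" for i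
    proof -
      obtain x where x: "x \<in> B i" "m i = ?S x" using m'(1)[OF i] by blast
      show 1: "0 < m i" unfolding x(2) by (rule Spos[OF i x(1)])
      show 2: "m i < top" unfolding x(2) by (rule Sfin)
      show "m i = ennreal (\<mu> i)" "0 < \<mu> i" using 1 2 by (auto simp: \<mu>_def enn2real_positive_iff)
    qed
    \<comment> \<open>On \<open>E\<close> the power \<open>S^\<delta>\<close> is at least
      \<open>m^\<delta>\<close>, which bounds the test sequence from above; on \<open>E'\<close> it
      is at most \<open>m^\<delta>\<close>, which bounds the product from below. The sign of
      \<open>\<delta>\<close> decides which half is which. Off \<open>J\<close> the test sequence is
      \<open>0\<close>, and the whole ball keeps \<open>E\<close> sparse on all indices.\<close>
    define E where "E i = (if i \<in> J then (if 0 \<le> \<delta> then {x\<in>B i. m i \<le> ?S x} else {x\<in>B i. ?S x \<le> m i}) else B i)" for i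
    define E' where "E' i = (if 0 \<le> \<delta> then {x\<in>B i. ?S x \<le> m i} else {x\<in>B i. m i \<le> ?S x})" for i
    have [measurable]: "E i \<in> sets borel" "E' i \<in> sets borel" for i by (auto simp: E_def E'_def)
    have spB: "sparse_on T 1 B" for T by (rule sparse_onI_B) simp
    have dbl: "vol (B i) \<le> 2 * vol (B i)" for i using mult_right_mono[of 1 2 "vol (B i)"] by simp
    have spE: "sparse_on UNIV (1/2) E"
      using m' dbl by (intro sparse_half_on[OF spB]) (auto simp: E_def)
    have spE': "sparse_on J (1/2) E'"
      using m' by (intro sparse_half_on[OF spB]) (auto simp: E'_def)
    have key: "epow (m i) \<delta> \<le> epow (?S x) \<delta>" if "i \<in> J" "x \<in> E i" for i x
    proof (cases "0 \<le> \<delta>")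
      case True
      then show ?thesis using that by (auto simp: E_def intro!: epow_mono)
    next
      case False
      then show ?thesis using that mu(3,4)[OF that(1)] Spos[OF that(1), of x] Sfin[of x]
        by (auto simp: E_def intro!: epow_antimono)
    qed
    have key': "epow (?S x) (\<delta> * t) \<le> epow (m i) (\<delta> * t)" if "i \<in> J" "x \<in> E' i" "0 < t" for i x t
    proof (cases "0 \<le> \<delta>")
      case True
      then show ?thesis using that by (auto simp: E'_def intro!: epow_mono)
    next
      case False
      then show ?thesis using that mu(3,4)[OF that(1)] Spos[OF that(1), of x] Sfin[of x]
        by (auto simp: E'_def mult_nonpos_nonneg intro!: epow_antimono)
    qed
    define a where "a i = (if i \<in> J then b i powr (Q2 * k1) * \<mu> i powr \<delta> else 0)" for i
    have a: "supp n a" by (auto simp: supp_def a_def J_def)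
    have ea: "ennreal (a i) = epow (ennreal (e i)) k1 * epow (m i) \<delta>" if "i \<in> J" for i
      using that mu[OF that] by (simp add: a_def e_def powr_powr ennreal_mult)
    have eab: "epow (ennreal (a i * b i)) Q0 = ennreal (e i) * epow (m i) (\<delta> * Q0)" if i: "i \<in> J" for i
    proof -
      \<comment> \<open>This is \<open>1 / Q0 = k1 + 1 / Q2\<close> with denominators cleared; it
        turns the power of \<open>b i\<close> in the product back into \<open>e i\<close>.\<close>
      have ex: "(Q2 * k1 + 1) * Q0 = Q2" using rel(2) pos by (simp add: field_simps)
      have "a i * b i = b i powr (Q2 * k1 + 1) * \<mu> i powr \<delta>"
        using i Jb(1)[OF i] by (simp add: a_def powr_add)
      then have "(a i * b i) powr Q0 = e i * \<mu> i powr (\<delta> * Q0)"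
        by (simp add: powr_mult powr_powr ex e_def)
      moreover have "0 \<le> a i * b i" by (simp add: a_def suppD(1)[OF b])
      ultimately show ?thesis using mu[OF i] e(1)[of i] by (simp add: ennreal_mult del: ennreal_mult')
    qed
    have W: "tseq_norm p1 q1 (\<lambda>i. ennreal (a i)) \<le> ennreal C2 * epow X r1"
    proof -
      have "seqn q1 E (\<lambda>i. ennreal (a i)) x \<le> epow (?S x) (P2 / Q2 * rexp p1)" for x
      proof -
        have "seqn q1 E (\<lambda>i. ennreal (a i)) x \<le> seqn q1 B (\<lambda>i. epow (?S x) \<delta> * epow (ennreal (e i)) k1) x"
        proof (rule seqn_mono[OF Q(2)])
          fix i
          show "ennreal (a i) * indicator (E i) x \<le> epow (?S x) \<delta> * epow (ennreal (e i)) k1 * indicator (B i) x"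
          proof (cases "i \<in> J \<and> x \<in> E i")
            case True
            then have "x \<in> B i" by (auto simp: E_def split: if_splits)
            moreover have "epow (ennreal (e i)) k1 * epow (m i) \<delta> \<le> epow (ennreal (e i)) k1 * epow (?S x) \<delta>"
              using True by (intro mult_left_mono key) auto
            ultimately show ?thesis using True ea[of i] by (simp add: mult.commute)
          qed (auto simp: a_def)
        qed
        also have "\<dots> \<le> epow (?S x) \<delta> * seqn q1 B (\<lambda>i. epow (ennreal (e i)) k1) x"
          by (rule seqn_cmult_le[OF Q(2)])
        also have "seqn q1 B (\<lambda>i. epow (ennreal (e i)) k1) x
           = lnorm (count_space UNIV) q1 (\<lambda>i. epow (ennreal (e i) * indicator (B i) x) (1 * rexp q1))"
          unfolding seqn_def by (simp add: epow_mult_indicator defs)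
        also have "\<dots> \<le> epow (\<integral>\<^sup>+i. epow (ennreal (e i) * indicator (B i) x) 1 \<partial>count_space UNIV) k1"
          unfolding k1_def by (rule lnorm_epow_le[OF Q(2)]) (auto simp: indicator_def)
        also have "(\<integral>\<^sup>+i. epow (ennreal (e i) * indicator (B i) x) 1 \<partial>count_space UNIV) = ?S x"
          unfolding lsum_def by (simp add: nn_integral_count_space_nat) (rule suminf_finite[OF J], simp add: e(3))
        finally have "seqn q1 E (\<lambda>i. ennreal (a i)) x \<le> epow (?S x) \<delta> * epow (?S x) k1"
          by (simp add: mult_left_mono)
        also have "\<dots> = epow (?S x) (P2 / Q2 * rexp p1)"
          by (simp add: epow_add[symmetric] \<delta>_def defs)
        finally show ?thesis .
      qed
      then have "mixed p1 q1 E (\<lambda>i. ennreal (a i)) \<le> lnorm lborel p1 (\<lambda>x. epow (?S x) (P2 / Q2 * rexp p1))"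
        unfolding mixed_def by (intro lnorm_mono P)
      also have "\<dots> \<le> epow X r1"
        unfolding X_def r1_def using Sfin pos by (intro lnorm_epow_le P) auto
      finally have "ennreal C2 * mixed p1 q1 E (\<lambda>i. ennreal (a i)) \<le> ennreal C2 * epow X r1"
        by (rule mult_left_mono) simp
      with C2(2)[OF spE] show ?thesis by (rule order_trans)
    qed
    let ?S' = "lsum J E' e"
    have [measurable]: "?S' \<in> borel_measurable borel" by (rule measurable_lsum) simp
    have S'S: "?S' x \<le> ?S x" for x
      unfolding lsum_def by (intro sum_mono mult_left_mono) (auto simp: E'_def indicator_def)
    define Y where "Y = (\<integral>\<^sup>+x. epow (?S x) (\<delta> * P0) * epow (?S' x) (P0 / Q0) \<partial>lborel)"
    have Y: "epow Y (1 / P0) \<le> tseq_norm p0 q0 (\<lambda>i. ennreal (a i * b i))"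
    proof -
      let ?ab = "\<lambda>i. ennreal (a i * b i)"
      have "epow (?S x) (\<delta> * P0) * epow (?S' x) (P0 / Q0) \<le> epow (seqn q0 B ?ab x) P0" for x
      proof -
        have "epow (?S x) (\<delta> * Q0) * ?S' x = (\<Sum>i\<in>J. epow (?S x) (\<delta> * Q0) * (ennreal (e i) * indicator (E' i) x))"
          by (simp add: lsum_def sum_distrib_left)
        also have "\<dots> \<le> (\<Sum>i\<in>J. epow (?ab i) Q0 * indicator (B i) x)"
        proof (intro sum_mono)
          fix i assume i: "i \<in> J"
          show "epow (?S x) (\<delta> * Q0) * (ennreal (e i) * indicator (E' i) x) \<le> epow (?ab i) Q0 * indicator (B i) x"
          proof (cases "x \<in> E' i")
            case True
            then have "x \<in> B i" by (auto simp: E'_def split: if_splits)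
            moreover have "epow (?S x) (\<delta> * Q0) * ennreal (e i) \<le> epow (m i) (\<delta> * Q0) * ennreal (e i)"
              using key'[OF i True pos(3)] by (rule mult_right_mono) simp
            ultimately show ?thesis using True eab[OF i] by (simp add: mult.commute)
          qed simp
        qed
        also have "\<dots> \<le> (\<Sum>i. epow (?ab i) Q0 * indicator (B i) x)"
          by (intro sum_le_suminf J) auto
        finally have "epow (epow (?S x) (\<delta> * Q0) * ?S' x) (P0 / Q0) \<le> epow (\<Sum>i. epow (?ab i) Q0 * indicator (B i) x) (P0 / Q0)"
          using pos by (intro epow_mono) auto
        then show ?thesis using pos
          by (simp add: seqn_finite[OF fin0(2)] defs epow_mult epow_epow)
      qed
      then have "Y \<le> (\<integral>\<^sup>+x. epow (seqn q0 B ?ab x) P0 \<partial>lborel)"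
        unfolding Y_def by (intro nn_integral_mono)
      then have "epow Y (1 / P0) \<le> epow (\<integral>\<^sup>+x. epow (seqn q0 B ?ab x) P0 \<partial>lborel) (1 / P0)"
        using pos by (intro epow_mono) auto
      then show ?thesis using fin0 by (simp add: tseq_norm_def mixed_finite defs)
    qed
    have XV: "X \<le> ennreal C1 * (\<integral>\<^sup>+x. epow (?S' x) (P2 / Q2) \<partial>lborel)"
      unfolding X_def using e by (intro C1(2) J spE') auto
    \<comment> \<open>\<open>Y\<close> contains \<open>S^(\<delta> P0)\<close> with full balls, but
      \<open>S'\<close> with halves. For \<open>\<delta> \<ge> 0\<close> the inequality
      \<open>S' \<le> S\<close> suffices. For negative \<open>\<delta>\<close> it points the wrong
      way, and Hoelder's inequality with weight \<open>\<theta> < 1\<close> followed by absorption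
      of \<open>X\<close> takes its place.\<close>
    have XY: "X \<le> ennreal C1' * Y"
    proof (cases "0 \<le> \<delta>")
      case True
      have "epow (?S' x) (P2 / Q2) \<le> epow (?S x) (\<delta> * P0) * epow (?S' x) (P0 / Q0)" for x
      proof -
        have "epow (?S' x) (P2 / Q2) = epow (?S' x) (\<delta> * P0) * epow (?S' x) (P0 / Q0)"
          by (simp only: epow_add[symmetric] dP0)
        also have "\<dots> \<le> epow (?S x) (\<delta> * P0) * epow (?S' x) (P0 / Q0)"
          using True pos by (intro mult_right_mono epow_mono S'S) auto
        finally show ?thesis .
      qed
      then have "(\<integral>\<^sup>+x. epow (?S' x) (P2 / Q2) \<partial>lborel) \<le> Y"
        unfolding Y_def by (intro nn_integral_mono)
      then have "ennreal C1 * (\<integral>\<^sup>+x. epow (?S' x) (P2 / Q2) \<partial>lborel) \<le> ennreal C1 * Y"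
        by (rule mult_left_mono) simp
      with XV show ?thesis using True by (auto simp: C1'_def)
    next
      case False
      have th1: "\<theta> < 1"
      proof -
        have "P2 / Q2 < P0 / Q0" using dP0 False pos mult_neg_pos[of \<delta> P0] by linarith
        then show ?thesis using pos by (simp add: \<theta>_def field_simps)
      qed
      have thP: "P0 / Q0 * \<theta> = P2 / Q2" using pos by (simp add: \<theta>_def)
      \<comment> \<open>\<open>\<theta>\<close> is chosen so that the exponent of \<open>S'\<close>
        comes out as \<open>P2 / Q2\<close>; the powers of \<open>S\<close> then cancel of
        themselves.\<close>
      have ex0: "\<delta> * P0 * \<theta> + P2 / Q2 * (1 - \<theta>) = 0"
      proof -
        have "\<delta> * P0 = P2 / Q2 - P0 / Q0" using dP0 by simp
        then show ?thesis using thP by (simp only: left_diff_distrib right_diff_distrib)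
      qed
      have "epow (?S' x) (P2 / Q2) = epow (epow (?S x) (\<delta> * P0) * epow (?S' x) (P0 / Q0)) \<theta> * epow (epow (?S x) (P2 / Q2)) (1 - \<theta>)" for x
      proof (cases "?S x = 0")
        case True
        then show ?thesis using S'S[of x] by simp
      next
        case False
        then obtain z where z: "?S x = ennreal z" "0 < z" using Sfin[of x] by (cases "?S x") (auto simp: less_le)
        have "epow (epow (?S x) (\<delta> * P0) * epow (?S' x) (P0 / Q0)) \<theta> * epow (epow (?S x) (P2 / Q2)) (1 - \<theta>)
          = epow (?S x) (\<delta> * P0 * \<theta> + P2 / Q2 * (1 - \<theta>)) * epow (?S' x) (P0 / Q0 * \<theta>)"
          by (simp only: epow_mult epow_epow epow_add mult_ac)
        then show ?thesis unfolding ex0 thP using z by simp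
      qed
      then have "(\<integral>\<^sup>+x. epow (?S' x) (P2 / Q2) \<partial>lborel) \<le> epow Y \<theta> * epow X (1 - \<theta>)"
        unfolding Y_def X_def using th th1
        by (simp only:) (intro nn_integral_Holder_theta, auto)
      then have "ennreal C1 * (\<integral>\<^sup>+x. epow (?S' x) (P2 / Q2) \<partial>lborel) \<le> ennreal C1 * (epow Y \<theta> * epow X (1 - \<theta>))"
        by (rule mult_left_mono) simp
      with XV have "X \<le> ennreal C1 * epow Y \<theta> * epow X (1 - \<theta>)" by (simp add: mult.assoc)
      then have "X \<le> epow (ennreal C1) (1 / \<theta>) * Y"
        using Xfin th th1 by (intro ennreal_absorb) auto
      then show ?thesis using False C1(1) by (simp add: C1'_def)
    qed
    show ?thesis unfolding D2
      by (rule ennreal_cancel_power[OF rel(1) pos(1,2) C1' C2(1) mult_leD(1)[OF m] Xfin XY Y mult_leD(2)[OF m a] W])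
  qed
  then show ?thesis using C1' C2(1) by (intro exI[of _ "C1' powr (1 / P0) * C2"]) auto
qed


text \<open>Run through the balls by decreasing \<open>b\<^sub>i\<close>, selecting a ball if at least half of it is not covered by those
  selected before.\<close>
lemma greedy_selection:
  fixes b :: "nat \<Rightarrow> real"
  assumes "finite J"
  shows "\<exists>S E. S \<subseteq> J \<and> (\<forall>i\<in>S. E i \<in> sets borel \<and> E i \<subseteq> B i \<and> vol (B i) \<le> 2 * vol (E i)) \<and>
    disjoint_family_on E S \<and> (\<forall>i\<in>J. vol (B i) \<le> 2 * vol (B i \<inter> (\<Union>j\<in>{j\<in>S. b i \<le> b j}. B j)))"
  using assms
\<comment> \<open>Ranking by \<open>- b i\<close> makes the newly inserted ball the one with the
  least \<open>b\<close>; all balls selected earlier therefore count for its covering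
  condition.\<close>
proof (induction J rule: finite_ranking_induct[where f = "\<lambda>i. - b i"])
  case empty
  show ?case by (auto simp: disjoint_family_on_def)
next
  case (insert i J)
  from insert.IH obtain S E where SE': "S \<subseteq> J" "\<forall>i\<in>S. E i \<in> sets borel \<and> E i \<subseteq> B i \<and> vol (B i) \<le> 2 * vol (E i)"
      "disjoint_family_on E S" "\<forall>i\<in>J. vol (B i) \<le> 2 * vol (B i \<inter> (\<Union>j\<in>{j\<in>S. b i \<le> b j}. B j))"
    by (elim exE conjE) (rule that)
  then have SE: "S \<subseteq> J" "\<And>j. j \<in> S \<Longrightarrow> E j \<in> sets borel" "\<And>j. j \<in> S \<Longrightarrow> E j \<subseteq> B j"
      "\<And>j. j \<in> S \<Longrightarrow> vol (B j) \<le> 2 * vol (E j)" "disjoint_family_on E S"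
      "\<And>k. k \<in> J \<Longrightarrow> vol (B k) \<le> 2 * vol (B k \<inter> (\<Union>j\<in>{j\<in>S. b k \<le> b j}. B j))"
    by blast+
  show ?case
  proof (cases "i \<in> J")
    case True
    then have "insert i J = J" by auto
    then show ?thesis using SE by (intro exI[of _ S] exI[of _ E]) auto
  next
    case iJ: False
    have finS: "finite S" using SE(1) insert(1) by (rule finite_subset)
    define U where "U = (\<Union>j\<in>S. B j)"
    have U [measurable]: "U \<in> sets borel" unfolding U_def by auto
    have dbl: "vol (B i) \<le> 2 * vol (B i)" using mult_right_mono[of 1 2 "vol (B i)"] by simp
    show ?thesis
    proof (cases "vol (B i) \<le> 2 * vol (B i - U)")
      case True
      \<comment> \<open>The new set avoids the union of all selected balls, hence all earlier
        \<open>E j\<close>, and has half the volume of \<open>B i\<close> by the case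
        assumption.\<close>
      define S' E' where "S' = insert i S" and "E' = E(i := B i - U)"
      have "i \<notin> S" using SE(1) iJ by auto
      have E': "E' j = (if j = i then B i - U else E j)" for j by (simp add: E'_def)
      have "vol (B k) \<le> 2 * vol (B k \<inter> (\<Union>j\<in>{j\<in>S'. b k \<le> b j}. B j))" if k: "k \<in> insert i J" for k
      proof (cases "k = i")
        case True
        then have "B k \<inter> (\<Union>j\<in>{j\<in>S'. b k \<le> b j}. B j) = B i" by (auto simp: S'_def)
        then show ?thesis using dbl True by simp
      next
        case False
        have "vol (B k) \<le> 2 * vol (B k \<inter> (\<Union>j\<in>{j\<in>S. b k \<le> b j}. B j))" using SE(6) k False by auto
        also have "\<dots> \<le> 2 * vol (B k \<inter> (\<Union>j\<in>{j\<in>S'. b k \<le> b j}. B j))"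
          by (intro mult_left_mono emeasure_mono) (auto simp: S'_def)
        finally show ?thesis .
      qed
      moreover have "disjoint_family_on E' S'"
        unfolding disjoint_family_on_def
      proof (intro ballI impI)
        fix j k assume jk: "j \<in> S'" "k \<in> S'" "j \<noteq> k"
        have "E l \<inter> (B i - U) = {}" if "l \<in> S" for l using SE(3)[OF that] that by (auto simp: U_def)
        moreover have "E l \<inter> E l' = {}" if "l \<in> S" "l' \<in> S" "l \<noteq> l'" for l l'
          using SE(5) that unfolding disjoint_family_on_def by blast
        ultimately show "E' j \<inter> E' k = {}"
          using jk by (cases "j = i"; cases "k = i") (simp_all add: E' S'_def Int_commute)
      qed
      moreover have "\<forall>j\<in>S'. E' j \<in> sets borel \<and> E' j \<subseteq> B j \<and> vol (B j) \<le> 2 * vol (E' j)"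
        using SE(2,3,4) True U by (auto simp: S'_def E')
      moreover have "S' \<subseteq> insert i J" using SE(1) by (auto simp: S'_def)
      ultimately show ?thesis by (intro exI[of _ S'] exI[of _ E']) auto
    next
      case False
      have sum: "vol (B i - U) + vol (B i \<inter> U) = vol (B i)"
      proof -
        have "vol (B i - U) + vol (B i \<inter> U) = vol ((B i - U) \<union> (B i \<inter> U))"
          by (intro plus_emeasure) (use U in auto)
        also have "(B i - U) \<union> (B i \<inter> U) = B i" by auto
        finally show ?thesis .
      qed
      \<comment> \<open>A rejected ball is covered by more than half, and every ball of
        \<open>U\<close> has at least as large a \<open>b\<close>.\<close>
      have "vol (B i) \<le> 2 * vol (B i \<inter> U)"
      proof -
        obtain v where v: "vol (B i) = ennreal v" "0 < v" using vol_B[of i] by (cases "vol (B i)") auto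
        have "vol (B i - U) \<le> vol (B i)" "vol (B i \<inter> U) \<le> vol (B i)" by (auto intro!: emeasure_mono)
        then obtain x y where xy: "vol (B i - U) = ennreal x" "0 \<le> x" "vol (B i \<inter> U) = ennreal y" "0 \<le> y"
          using v by (cases "vol (B i - U)"; cases "vol (B i \<inter> U)") (auto simp: top_unique)
        have "x + y = v" using sum v xy by (simp add: ennreal_plus[symmetric] del: ennreal_plus)
        moreover have "ennreal (2 * x) < ennreal v" using False v xy by (simp add: ennreal_mult not_le)
        then have "2 * x < v" using xy by (subst (asm) ennreal_less_iff) auto
        ultimately have "v \<le> 2 * y" by simp
        then have "ennreal v \<le> ennreal (2 * y)" by (rule ennreal_leI)
        then show ?thesis using v xy by (simp add: ennreal_mult)
      qed
      moreover have "{j\<in>S. b i \<le> b j} = S" using insert(2) SE(1) by auto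
      ultimately have "vol (B i) \<le> 2 * vol (B i \<inter> (\<Union>j\<in>{j\<in>S. b i \<le> b j}. B j))"
        by (simp add: U_def)
      then show ?thesis using SE by (intro exI[of _ S] exI[of _ E]) auto
    qed
  qed
qed

text \<open>A sequence with one nonzero term has the same norm for every \<open>q\<close>; applied
  to disjoint sets, where at most one term is nonzero at each point.\<close>

lemma seqn_le_single:
  assumes q: "1 \<le> q" and le: "\<And>j. a j * indicator (F j) x \<le> (if j = i then y else 0)"
  shows "seqn q F a x \<le> y"
proof (cases "q = top")
  case True
  have "a j * indicator (F j) x \<le> y" for j by (rule order_trans[OF le]) simp
  then show ?thesis using True by (auto simp: seqn_top intro!: SUP_least)
next
  case False
  have Q: "0 < enn2real q" using exponent_pos[OF q False] by simp
  have "(\<Sum>j. epow (a j) (enn2real q) * indicator (F j) x) = (\<Sum>j\<in>{i}. epow (a j) (enn2real q) * indicator (F j) x)"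
  proof (rule suminf_finite)
    fix j assume "j \<notin> {i}"
    then have "a j * indicator (F j) x = 0" using le[of j] by simp
    then show "epow (a j) (enn2real q) * indicator (F j) x = 0"
      by (auto simp: indicator_def split: if_splits)
  qed simp
  also have "\<dots> = epow (a i * indicator (F i) x) (enn2real q)"
    unfolding epow_mult_indicator by (subst sum.insert) simp_all
  also have "\<dots> \<le> epow y (enn2real q)" using le[of i] Q by (intro epow_mono) auto
  finally show ?thesis using Q epow_le_iff[of "1 / enn2real q"] by (simp add: seqn_finite[OF False])
qed

text \<open>With \<open>q2 = top\<close> a test sequence on all balls would fail: overlapping balls
  with equal \<open>b\<close> inflate the \<open>q\<close>-norm but not the supremum. On the
  greedily selected balls the sets \<open>E i\<close> are disjoint, so the test sequence has the
  norm of a supremum, and by the covering property the selected balls still carry a fixed share of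
  the supremum over all.\<close>

lemma tseq_norm_converse_fin_top:
  assumes cp: "Holder_triple p0 p1 p2" and q: "1 \<le> q" and fin: "p2 \<noteq> top"
  shows "\<exists>C>0. \<forall>n b K. supp n b \<longrightarrow> mult_le p0 q p1 q n b K \<longrightarrow> tseq_norm p2 top (\<lambda>i. ennreal (b i)) \<le> ennreal (C * K)"
proof -
  note P = Holder_tripleD[OF cp]
  have fin0: "p0 \<noteq> top" using P(5) fin by auto
  define P0 P2 r1 where "P0 = enn2real p0" and "P2 = enn2real p2" and "r1 = rexp p1"
  note defs = P0_def[symmetric] P2_def[symmetric] r1_def[symmetric]
  have pos: "0 < P0" "0 < P2" "0 \<le> r1"
    using exponent_pos[OF P(1) fin0] exponent_pos[OF P(3) fin] by (auto simp: defs) (auto simp: r1_def)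
  have rel: "1 / P0 = r1 + 1 / P2"
    using P(1,3,4) fin fin0 by (auto simp: rexp_finite defs)
  have ex: "P2 * r1 + 1 = P2 / P0" unfolding divide_inverse[of P2 P0] using rel pos by (simp add: field_simps)
  obtain C1 where C1: "C1 > 0" "\<And>J E b. finite J \<Longrightarrow> sparse_on J (1/2) E \<Longrightarrow>
    (\<integral>\<^sup>+x. epow (SUP i\<in>J. b i * indicator (B i) x) P2 \<partial>lborel) \<le> ennreal C1 * (\<integral>\<^sup>+x. epow (SUP i\<in>J. b i * indicator (E i) x) P2 \<partial>lborel)"
    using sparse_SUP[of "1/2" P2] pos by auto
  obtain C2 where C2: "C2 > 0" "\<And>E a. sparse_on UNIV (1/2) E \<Longrightarrow> tseq_norm p1 q a \<le> ennreal C2 * mixed p1 q E a"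
    using tseq_norm_le_mixed[of "1/2", OF _ P(2) q] by auto
  have "tseq_norm p2 top (\<lambda>i. ennreal (b i)) \<le> ennreal (C1 powr (1 / P0) * C2 * K)"
    if b: "supp n b" and m: "mult_le p0 q p1 q n b K" for n b K
  proof -
    from greedy_selection[OF finite_lessThan, of n b] obtain S E where SE': "S \<subseteq> {..<n}"
      "\<forall>i\<in>S. E i \<in> sets borel \<and> E i \<subseteq> B i \<and> vol (B i) \<le> 2 * vol (E i)" "disjoint_family_on E S"
      "\<forall>i\<in>{..<n}. vol (B i) \<le> 2 * vol (B i \<inter> (\<Union>j\<in>{j\<in>S. b i \<le> b j}. B j))"
      by (elim exE conjE) (rule that)
    then have SE: "S \<subseteq> {..<n}" "\<And>j. j \<in> S \<Longrightarrow> E j \<in> sets borel" "\<And>j. j \<in> S \<Longrightarrow> E j \<subseteq> B j"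
      "\<And>j. j \<in> S \<Longrightarrow> vol (B j) \<le> 2 * vol (E j)" "disjoint_family_on E S"
      "\<And>k. k < n \<Longrightarrow> vol (B k) \<le> 2 * vol (B k \<inter> (\<Union>j\<in>{j\<in>S. b k \<le> b j}. B j))"
      by (blast intro: lessThan_iff[THEN iffD2])+
    have bn: "0 \<le> b i" for i using suppD(1)[OF b] .
    define A where "A x = (SUP i\<in>{..<n}. ennreal (b i) * indicator (B i) x)" for x
    have Am [measurable]: "A \<in> borel_measurable borel"
      unfolding A_def by (intro borel_measurable_SUP countable_finite) auto
    define X where "X = (\<integral>\<^sup>+x. epow (A x) P2 \<partial>lborel)"
    have D2: "tseq_norm p2 top (\<lambda>i. ennreal (b i)) = epow X (1 / P2)"
      using fin by (simp add: tseq_norm_def mixed_finite seqn_supp_top[OF b] defs X_def A_def)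
    have Xfin: "X < top" using tseq_norm_supp_finite[OF b P(3), of top] D2 by simp
    have Afin: "A x < top" for x
      using SUP_le_sum_ennreal[of "{..<n}" "\<lambda>i. ennreal (b i) * indicator (B i) x"]
      unfolding A_def by (rule le_less_trans) (auto intro!: sum_ennreal_less_top simp: indicator_def)
    \<comment> \<open>The exponent makes \<open>a i\<close> a power \<open>r1\<close> of
      \<open>b i^P2\<close>, and by \<open>ex\<close> the product \<open>a i * b i\<close> becomes
      \<open>b i\<close> raised to \<open>P2 / P0\<close>.\<close>
    define a where "a i = (if i \<in> S then b i powr (P2 * r1) else 0)" for i
    have a: "supp n a" using SE(1) by (auto simp: supp_def a_def)
    define Es where "Es i = (if i \<in> S then E i else B i)" for i
    have spB: "sparse_on T 1 B" for T by (rule sparse_onI_B) simp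
    have dbl: "vol (B i) \<le> 2 * vol (B i)" for i using mult_right_mono[of 1 2 "vol (B i)"] by simp
    have spE: "sparse_on UNIV (1/2) Es"
      using SE(2,3,4) dbl by (intro sparse_half_on[OF spB]) (auto simp: Es_def)
    have W: "tseq_norm p1 q (\<lambda>i. ennreal (a i)) \<le> ennreal C2 * epow X r1"
    proof -
      have "seqn q Es (\<lambda>i. ennreal (a i)) x \<le> epow (A x) (P2 * rexp p1)" for x
      proof (cases "\<exists>i\<in>S. x \<in> E i")
        case True
        then obtain i where i: "i \<in> S" "x \<in> E i" by auto
        have "x \<in> B i" "i < n" using i SE(1) SE(3)[OF i(1)] by auto
        then have "ennreal (b i) \<le> A x" unfolding A_def by (intro SUP_upper2[of i]) auto
        then have "epow (ennreal (b i)) (P2 * r1) \<le> epow (A x) (P2 * r1)" using pos by (intro epow_mono) auto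
        moreover have "j \<notin> S \<or> x \<notin> E j" if "j \<noteq> i" for j
          using that i SE(5) by (auto simp: disjoint_family_on_def)
        ultimately show ?thesis
          by (intro seqn_le_single[OF q, of _ _ _ i]) (use i bn in \<open>auto simp: a_def Es_def defs indicator_def\<close>)
      next
        case False
        then show ?thesis by (intro seqn_le_single[OF q, of _ _ _ 0]) (auto simp: a_def Es_def)
      qed
      then have "mixed p1 q Es (\<lambda>i. ennreal (a i)) \<le> lnorm lborel p1 (\<lambda>x. epow (A x) (P2 * rexp p1))"
        unfolding mixed_def by (intro lnorm_mono P)
      also have "\<dots> \<le> epow X r1"
        unfolding X_def r1_def using Afin pos by (intro lnorm_epow_le P) auto
      finally have "ennreal C2 * mixed p1 q Es (\<lambda>i. ennreal (a i)) \<le> ennreal C2 * epow X r1"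
        by (rule mult_left_mono) simp
      with C2(2)[OF spE] show ?thesis by (rule order_trans)
    qed
    define G where "G x = (SUP i\<in>S. ennreal (b i) * indicator (B i) x)" for x
    define Y where "Y = (\<integral>\<^sup>+x. epow (G x) P2 \<partial>lborel)"
    have Y: "epow Y (1 / P0) \<le> tseq_norm p0 q (\<lambda>i. ennreal (a i * b i))"
    proof -
      have "epow (G x) P2 \<le> epow (seqn q B (\<lambda>i. ennreal (a i * b i)) x) P0" for x
      proof -
        have "epow (G x) (P2 / P0) = (SUP i\<in>S. epow (ennreal (b i) * indicator (B i) x) (P2 / P0))"
          unfolding G_def using pos by (intro epow_SUP) auto
        also have "\<dots> \<le> seqn q B (\<lambda>i. ennreal (a i * b i)) x"
        proof (intro SUP_least)
          fix i assume i: "i \<in> S"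
          have "b i powr (P2 / P0) = a i * b i"
            unfolding ex[symmetric] using i bn[of i] by (cases "b i = 0") (auto simp: a_def powr_add)
          then have "epow (ennreal (b i) * indicator (B i) x) (P2 / P0) = ennreal (a i * b i) * indicator (B i) x"
            using bn[of i] by (simp add: epow_mult_indicator)
          then show "epow (ennreal (b i) * indicator (B i) x) (P2 / P0) \<le> seqn q B (\<lambda>i. ennreal (a i * b i)) x"
            using seqn_ge[OF q, of "\<lambda>i. ennreal (a i * b i)" i B x] by simp
        qed
        finally have "epow (epow (G x) (P2 / P0)) P0 \<le> epow (seqn q B (\<lambda>i. ennreal (a i * b i)) x) P0"
          using pos by (intro epow_mono) auto
        then show ?thesis using pos by (simp add: epow_epow)
      qed
      then have "Y \<le> (\<integral>\<^sup>+x. epow (seqn q B (\<lambda>i. ennreal (a i * b i)) x) P0 \<partial>lborel)"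
        unfolding Y_def by (intro nn_integral_mono)
      then have "epow Y (1 / P0) \<le> epow (\<integral>\<^sup>+x. epow (seqn q B (\<lambda>i. ennreal (a i * b i)) x) P0 \<partial>lborel) (1 / P0)"
        using pos by (intro epow_mono) auto
      then show ?thesis using fin0 by (simp add: tseq_norm_def mixed_finite defs)
    qed
    have XY: "X \<le> ennreal C1 * Y"
    proof -
      \<comment> \<open>The part of \<open>B i\<close> covered by selected balls with a value at
        least \<open>b i\<close>; on it \<open>G\<close> dominates \<open>b i\<close>.\<close>
      define E' where "E' i = B i \<inter> (\<Union>j\<in>{j\<in>S. b i \<le> b j}. B j)" for i
      have "sparse_on {..<n} (1/2) E'"
        using SE(6) by (intro sparse_half_on[OF spB]) (auto simp: E'_def)
      then have "X \<le> ennreal C1 * (\<integral>\<^sup>+x. epow (SUP i\<in>{..<n}. ennreal (b i) * indicator (E' i) x) P2 \<partial>lborel)"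
        unfolding X_def A_def by (intro C1(2)) auto
      also have "\<dots> \<le> ennreal C1 * Y"
        unfolding Y_def
      proof (intro mult_left_mono nn_integral_mono epow_mono SUP_least)
        fix x i
        show "ennreal (b i) * indicator (E' i) x \<le> G x"
        proof (cases "x \<in> E' i")
          case True
          then obtain j where "j \<in> S" "b i \<le> b j" "x \<in> B j" by (auto simp: E'_def)
          then show ?thesis using True unfolding G_def by (intro SUP_upper2[of j]) (auto intro: ennreal_leI)
        qed simp
      qed (use pos in auto)
      finally show ?thesis .
    qed
    show ?thesis unfolding D2
      by (rule ennreal_cancel_power[OF rel pos(1,2) C1(1) C2(1) mult_leD(1)[OF m] Xfin XY Y mult_leD(2)[OF m a] W])
  qed
  then show ?thesis using C1 C2(1) by (intro exI[of _ "C1 powr (1 / P0) * C2"]) auto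
qed


text \<open>Localise to a ball \<open>U\<close> that nearly attains the Carleson supremum and test
  with \<open>b_i^(Q2 k1)\<close> over the balls inside \<open>U\<close>. Witness sets turn the
  Carleson norm into an essential bound, so the test sequence has norm at most about
  \<open>N^(Q2 k1) |U|^(1/p)\<close>, while the product has norm at least about
  \<open>N^(Q2/Q0) |U|^(1/p)\<close>.\<close>

lemma tseq_norm_converse_top_fin:
  assumes p: "1 \<le> p" and cq: "Holder_triple q0 q1 q2" and fin: "q2 \<noteq> top"
  shows "\<exists>C>0. \<forall>n b K. supp n b \<longrightarrow> mult_le p q0 p q1 n b K \<longrightarrow> tseq_norm top q2 (\<lambda>i. ennreal (b i)) \<le> ennreal (C * K)"
proof -
  note Q = Holder_tripleD[OF cq]
  have fin0: "q0 \<noteq> top" using Q(5) fin by auto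
  define Q0 Q2 r1 k1 where "Q0 = enn2real q0" and "Q2 = enn2real q2" and "r1 = rexp p" and "k1 = rexp q1"
  note defs = Q0_def[symmetric] Q2_def[symmetric] r1_def[symmetric] k1_def[symmetric]
  have pos: "0 < Q0" "0 < Q2" "0 \<le> r1" "0 \<le> k1"
    using exponent_pos[OF Q(1) fin0] exponent_pos[OF Q(3) fin] by (auto simp: defs) (auto simp: r1_def k1_def)
  have rel: "1 / Q0 = k1 + 1 / Q2"
    using Q(1,3,4) fin fin0 by (auto simp: rexp_finite defs)
  have ex: "Q2 / Q0 = Q2 * k1 + 1" "(Q2 * k1 + 1) * Q0 = Q2" using rel pos by (simp_all add: field_simps)
  obtain Cw where Cw: "Cw > 0" "\<And>n b. supp n b \<Longrightarrow> \<exists>E. sparse_on UNIV (3/4) E \<and>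
     mixed top q2 E (\<lambda>i. ennreal (b i)) \<le> ennreal Cw * tseq_norm top q2 (\<lambda>i. ennreal (b i))"
    using sparse_witness[OF _ Q(3), of top] by auto
  obtain C2 where C2: "C2 > 0" "\<And>E a. sparse_on UNIV (3/4) E \<Longrightarrow> tseq_norm p q1 a \<le> ennreal C2 * mixed p q1 E a"
    using tseq_norm_le_mixed[of "3/4", OF _ p Q(2)] by auto
  define s where "s = enn2real p / Q0"
  \<comment> \<open>\<open>m * N^Q2\<close> is the end of the range between \<open>N^Q2 / 8\<close>
    and the essential bound \<open>(Cw N)^Q2\<close> at which \<open>y^(1-s)\<close> is largest: the
    lower end for \<open>s \<ge> 1\<close>, the upper one for \<open>s < 1\<close>.\<close>
  define m where "m = (if 1 \<le> s then 1 / 8 else Cw powr Q2)"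
  have m: "0 < m" using Cw(1) by (simp add: m_def)
  \<comment> \<open>The \<open>1/4\<close> is \<open>3/8 - 1/8\<close>, the mass left after the
    small values are discarded; for \<open>p = top\<close> only the factor \<open>1/2\<close> of the
    near-extremal ball remains.\<close>
  define cl where "cl = (if p = top then (1 / 2) powr (1 / Q0) else (1 / 4 * m powr (s - 1)) powr (1 / enn2real p))"
  have cl: "0 < cl" using m by (simp add: cl_def)
  have "tseq_norm top q2 (\<lambda>i. ennreal (b i)) \<le> ennreal ((C2 * Cw powr (Q2 * k1) / cl) * K)"
    if b: "supp n b" and mu: "mult_le p q0 p q1 n b K" for n b K
  proof -
    define N where "N = enn2real (tseq_norm top q2 (\<lambda>i. ennreal (b i)))"
    have N: "tseq_norm top q2 (\<lambda>i. ennreal (b i)) = ennreal N" "0 \<le> N"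
      using tseq_norm_supp_finite[OF b _ Q(3), of top] by (auto simp: N_def)
    have K: "0 \<le> K" by (rule mult_leD(1)[OF mu])
    show ?thesis
    proof (cases "N = 0")
      case True
      then show ?thesis using N by simp
    next
      case False
      then have N0: "0 < N" using N by simp
      have bn: "0 \<le> b i" for i using suppD(1)[OF b] .
      define e where "e i = b i powr Q2" for i
      have e0: "0 \<le> e i" for i by (simp add: e_def)
      have carlN: "carl q2 (\<lambda>i. ennreal (b i)) = ennreal N" using N(1) fin by (simp add: tseq_norm_def)
      \<comment> \<open>If every ball fell short by the factor \<open>1/2\<close>, the Carleson norm
        would be at most \<open>N * (1/2)^(1/Q2)\<close>, which is less than
        \<open>N\<close>.\<close>
      have "\<exists>z R. 0 < R \<and> ennreal (N powr Q2 / 2) * vol (ball z R) \<le>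
         (\<Sum>i. ennreal (e i) * (vol (B i) * of_bool (B i \<subseteq> ball z R)))"
      proof (rule ccontr)
        assume *: "\<not> ?thesis"
        have "carl q2 (\<lambda>i. ennreal (b i)) \<le> ennreal (N * (1 / 2) powr (1 / Q2))"
        proof (rule carl_leI, unfold defs)
          show "0 < Q2" by (rule pos)
          fix z :: 'a and R :: real assume "0 < R"
          then have "(\<Sum>i. ennreal (e i) * (vol (B i) * of_bool (B i \<subseteq> ball z R))) \<le> ennreal (N powr Q2 / 2) * vol (ball z R)"
            using * by (meson linear)
          moreover have "epow (ennreal (N * (1 / 2) powr (1 / Q2))) Q2 = ennreal (N powr Q2 / 2)"
            using N0 pos by (simp add: powr_mult powr_powr)
          ultimately show "(\<Sum>i. epow (ennreal (b i)) Q2 * (vol (B i) * of_bool (B i \<subseteq> ball z R)))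
             \<le> epow (ennreal (N * (1 / 2) powr (1 / Q2))) Q2 * vol (ball z R)"
            using bn by (simp add: e_def)
        qed
        then have "N \<le> N * (1 / 2) powr (1 / Q2)" using carlN N0 by (simp add: ennreal_le_iff)
        moreover have "(1 / 2 :: real) powr (1 / Q2) < 1 powr (1 / Q2)" using pos by (intro powr_less_mono2) auto
        ultimately show False using N0 by simp
      qed
      then obtain z R where R: "0 < R" and zR: "ennreal (N powr Q2 / 2) * vol (ball z R) \<le>
         (\<Sum>i. ennreal (e i) * (vol (B i) * of_bool (B i \<subseteq> ball z R)))" by blast
      let ?U = "ball z R"
      have volU: "0 < vol ?U" "vol ?U < top"
        using emeasure_ball_pos[OF R, of z] emeasure_lborel_ball_finite[of z R] by auto
      then obtain V where V: "vol ?U = ennreal V" "0 < V" by (cases "vol ?U") (auto simp: less_le)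
      have [measurable]: "?U \<in> sets borel" by simp
      define w where "w i = (of_bool (B i \<subseteq> ?U) :: real)" for i
      define a where "a i = w i * b i powr (Q2 * k1)" for i
      have a: "supp n a" using suppD(2)[OF b] by (auto simp: supp_def a_def w_def)
      obtain E where E: "sparse_on UNIV (3/4) E" "mixed top q2 E (\<lambda>i. ennreal (b i)) \<le> ennreal Cw * ennreal N"
        using Cw(2)[OF b] N(1) by auto
      have [measurable]: "E i \<in> sets borel" for i using sparse_onD(1)[OF E(1)] by simp
      have EB: "E i \<subseteq> B i" for i using sparse_onD(2)[OF E(1)] by simp
      \<comment> \<open>The essential bound that the witness sets give for the sum of
        \<open>b_i^Q2\<close>.\<close>
      define L where "L = (Cw * N) powr Q2"
      have AE: "AE x in lborel. (\<Sum>i. ennreal (e i) * indicator (E i) x) \<le> ennreal L"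
        using AE_le_lnorm_top[of "seqn q2 E (\<lambda>i. ennreal (b i))" lborel]
      proof eventually_elim
        case (elim x)
        then have "seqn q2 E (\<lambda>i. ennreal (b i)) x \<le> ennreal (Cw * N)"
          using E(2) Cw(1) N0 by (auto simp: mixed_def ennreal_mult)
        then show ?case using pos bn epow_le_iff[of "1 / Q2"] Cw(1) N0
          by (simp add: seqn_finite[OF fin] defs e_def L_def)
      qed
      \<comment> \<open>On the witness sets the inner norm of the test sequence is at most
        \<open>L^k1\<close> and vanishes outside \<open>U\<close>, so only the norm of an indicator
        remains.\<close>
      have W: "tseq_norm p q1 (\<lambda>i. ennreal (a i)) \<le> ennreal (C2 * (L powr k1 * V powr r1))"
      proof -
        have "AE x in lborel. seqn q1 E (\<lambda>i. ennreal (a i)) x \<le> ennreal (L powr k1) * indicator ?U x"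
          using AE
        proof eventually_elim
          case (elim x)
          have "seqn q1 E (\<lambda>i. ennreal (a i)) x \<le> seqn q1 E (\<lambda>i. indicator ?U x * epow (ennreal (e i)) k1) x"
          proof (rule seqn_mono[OF Q(2)])
            fix i
            show "ennreal (a i) * indicator (E i) x \<le> indicator ?U x * epow (ennreal (e i)) k1 * indicator (E i) x"
            proof (cases "B i \<subseteq> ?U \<and> x \<in> E i")
              case True
              then have "x \<in> ?U" using EB[of i] by blast
              then show ?thesis using True bn[of i] by (simp add: a_def w_def e_def powr_powr)
            qed (auto simp: a_def w_def)
          qed
          also have "\<dots> \<le> indicator ?U x * seqn q1 E (\<lambda>i. epow (ennreal (e i)) k1) x"
            by (rule seqn_cmult_le[OF Q(2)])
          also have "seqn q1 E (\<lambda>i. epow (ennreal (e i)) k1) x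
             = lnorm (count_space UNIV) q1 (\<lambda>i. epow (ennreal (e i) * indicator (E i) x) (1 * rexp q1))"
            unfolding seqn_def by (simp add: epow_mult_indicator defs)
          also have "\<dots> \<le> epow (\<integral>\<^sup>+i. epow (ennreal (e i) * indicator (E i) x) 1 \<partial>count_space UNIV) k1"
            unfolding k1_def by (rule lnorm_epow_le[OF Q(2)]) (auto simp: indicator_def)
          also have "(\<integral>\<^sup>+i. epow (ennreal (e i) * indicator (E i) x) 1 \<partial>count_space UNIV) = (\<Sum>i. ennreal (e i) * indicator (E i) x)"
            by (simp add: nn_integral_count_space_nat)
          also have "epow (\<Sum>i. ennreal (e i) * indicator (E i) x) k1 \<le> epow (ennreal L) k1"
            using elim pos by (intro epow_mono)
          finally have "seqn q1 E (\<lambda>i. ennreal (a i)) x \<le> indicator ?U x * epow (ennreal L) k1"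
            by (simp add: mult_left_mono)
          then show ?case by (simp add: L_def mult.commute)
        qed
        then have "mixed p q1 E (\<lambda>i. ennreal (a i)) \<le> lnorm lborel p (\<lambda>x. ennreal (L powr k1) * indicator ?U x)"
          unfolding mixed_def by (rule lnorm_mono_AE[OF p])
        also have "\<dots> \<le> ennreal (L powr k1) * lnorm lborel p (\<lambda>x. indicator ?U x)"
          by (rule lnorm_cmult_le[OF p]) (simp add: borel_measurable_indicator)
        also have "\<dots> \<le> ennreal (L powr k1) * epow (vol ?U) r1"
          unfolding r1_def using volU by (intro mult_left_mono lnorm_indicator_le p) auto
        also have "\<dots> = ennreal (L powr k1 * V powr r1)" using V by (simp add: ennreal_mult)
        finally have "ennreal C2 * mixed p q1 E (\<lambda>i. ennreal (a i)) \<le> ennreal C2 * ennreal (L powr k1 * V powr r1)"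
          by (rule mult_left_mono) simp
        with C2(2)[OF E(1)] have "tseq_norm p q1 (\<lambda>i. ennreal (a i)) \<le> ennreal C2 * ennreal (L powr k1 * V powr r1)"
          by (rule order_trans)
        then show ?thesis using C2(1) by (simp add: ennreal_mult)
      qed
      let ?ab = "\<lambda>i. ennreal (a i * b i)"
      have ab: "epow (?ab i) Q0 = ennreal (e i) * of_bool (B i \<subseteq> ?U)" for i
      proof -
        have "a i * b i = w i * b i powr (Q2 * k1 + 1)"
          using bn[of i] by (cases "b i = 0") (auto simp: a_def powr_add)
        moreover have "(w i * b i powr (Q2 * k1 + 1)) powr Q0 = w i * e i"
          using bn[of i] by (auto simp: powr_powr ex(2) e_def w_def)
        moreover have "0 \<le> a i * b i" using bn[of i] by (simp add: a_def w_def)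
        ultimately show ?thesis by (simp add: w_def)
      qed
      \<comment> \<open>For \<open>p = top\<close> the ball \<open>U\<close> is itself a test ball
        for the product. For finite \<open>p\<close> the power \<open>s\<close> of \<open>S0\<close>
        must be bounded below knowing only its integral and its essential bound.\<close>
      have Z: "ennreal (cl * (N powr (Q2 / Q0) * V powr r1)) \<le> tseq_norm p q0 ?ab"
      proof (cases "p = top")
        case True
        have "ennreal (N powr Q2 / 2) * vol ?U \<le> (\<Sum>i. epow (?ab i) Q0 * (vol (B i) * of_bool (B i \<subseteq> ?U)))"
          using zR by (rule order_trans) (intro suminf_mono_ennreal, simp add: ab)
        also have "\<dots> \<le> epow (carl q0 ?ab) Q0 * vol ?U"
          using carlD[of q0 R ?ab z] pos R by (simp add: defs)
        finally have "ennreal (N powr Q2 / 2) \<le> epow (carl q0 ?ab) Q0"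
          using volU by (simp add: ennreal_mult_le_mult_iff mult.commute[of _ "vol ?U"])
        then have "epow (ennreal (N powr Q2 / 2)) (1 / Q0) \<le> carl q0 ?ab"
          using pos by (subst epow_le_iff) auto
        moreover have "(N powr Q2 / 2) powr (1 / Q0) = cl * (N powr (Q2 / Q0) * V powr r1)"
          using True V by (simp add: cl_def powr_divide powr_powr r1_def)
        ultimately show ?thesis using True fin0 by (simp add: tseq_norm_def)
      next
        case pf: False
        define P where "P = enn2real p"
        have P: "0 < P" using exponent_pos[OF p pf] by (simp add: P_def)
        have r1P: "r1 = 1 / P" using p pf by (simp add: r1_def P_def rexp_finite)
        have s: "0 < s" using P pos by (simp add: s_def P_def)
        define S0 where "S0 x = (\<Sum>i. ennreal (e i) * of_bool (B i \<subseteq> ?U) * indicator (E i) x)" for x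
        have [measurable]: "S0 \<in> borel_measurable borel" unfolding S0_def by measurable
        define \<tau> where "\<tau> = N powr Q2 / 8"
        have tau: "0 < \<tau>" using N0 by (simp add: \<tau>_def)
        define M where "M = (m * N powr Q2) powr (1 - s)"
        have M: "0 < M" using m N0 by (simp add: M_def)
        \<comment> \<open>Values up to \<open>\<tau>\<close> are absorbed by the first term. Any
          larger value \<open>y\<close> lies between \<open>\<tau>\<close> and \<open>L\<close>,
          where \<open>y^(1-s) \<le> M\<close>, so \<open>y \<le> M y^s\<close>.\<close>
        have pt: "AE x in lborel. S0 x \<le> ennreal \<tau> * indicator ?U x + ennreal M * epow (S0 x) s"
          using AE
        proof eventually_elim
          case (elim x)
          have "S0 x \<le> (\<Sum>i. ennreal (e i) * indicator (E i) x)"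
            unfolding S0_def by (intro suminf_mono_ennreal) (auto simp: of_bool_def)
          then have "S0 x \<le> ennreal L" using elim by simp
          then obtain y where y: "S0 x = ennreal y" "0 \<le> y" "y \<le> L"
            by (cases "S0 x") (auto simp: top_unique L_def)
          show ?case
          proof (cases "x \<in> ?U")
            case False
            have "ennreal (e i) * of_bool (B i \<subseteq> ?U) * indicator (E i) x = 0" for i
              using False EB[of i] by (auto simp: indicator_def)
            then have "S0 x = 0" unfolding S0_def by (simp only: suminf_zero)
            then show ?thesis by simp
          next
            case True
            have "y \<le> \<tau> + M * y powr s"
            proof (cases "y \<le> \<tau>")
              case False
              then have y0: "0 < y" using tau by simp
              have "y powr (1 - s) \<le> M"
              proof (cases "1 \<le> s")
                case True
                then have "y powr (1 - s) \<le> \<tau> powr (1 - s)" using False tau by (intro powr_mono2') auto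
                then show ?thesis using True by (simp add: M_def m_def \<tau>_def)
              next
                case s1: False
                have "y powr (1 - s) \<le> L powr (1 - s)" using y s1 by (intro powr_mono2) auto
                then show ?thesis using s1 Cw(1) N0 by (simp add: M_def m_def L_def powr_mult)
              qed
              then have "y powr (1 - s) * y powr s \<le> M * y powr s" by (rule mult_right_mono) simp
              moreover have "y powr (1 - s) * y powr s = y" using y0 by (simp add: powr_add[symmetric])
              ultimately show ?thesis using tau by simp
            next
              case True
              have "0 \<le> M * y powr s" using M by simp
              with True show ?thesis by linarith
            qed
            then have "ennreal y \<le> ennreal (\<tau> + M * y powr s)" by (rule ennreal_leI)
            then show ?thesis using True y tau M by (simp add: ennreal_mult)
          qed
        qed
        define Y where "Y = (\<integral>\<^sup>+x. epow (S0 x) s \<partial>lborel)"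
        \<comment> \<open>The integral of \<open>S0\<close> is at least \<open>3/4 * 1/2\<close> of
          \<open>N^Q2 |U|\<close>: the proportion of the witness sets times the loss in the choice
          of \<open>U\<close>.\<close>
        have "ennreal (3/4) * (ennreal (N powr Q2 / 2) * vol ?U)
            \<le> ennreal (3/4) * (\<Sum>i. ennreal (e i) * (vol (B i) * of_bool (B i \<subseteq> ?U)))"
          by (rule mult_left_mono[OF zR]) simp
        also have "\<dots> = (\<Sum>i. ennreal (e i) * of_bool (B i \<subseteq> ?U) * (ennreal (3/4) * vol (B i)))"
          by (simp only: ennreal_suminf_cmult[symmetric] mult_ac)
        also have "\<dots> \<le> (\<Sum>i. ennreal (e i) * of_bool (B i \<subseteq> ?U) * vol (E i))"
          using sparse_onD(3)[OF E(1)] by (intro suminf_mono_ennreal mult_left_mono) auto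
        also have "\<dots> = (\<integral>\<^sup>+x. S0 x \<partial>lborel)"
          unfolding S0_def by (subst nn_integral_suminf) (auto simp: nn_integral_cmult_indicator)
        also have "\<dots> \<le> (\<integral>\<^sup>+x. ennreal \<tau> * indicator ?U x + ennreal M * epow (S0 x) s \<partial>lborel)"
          by (rule nn_integral_mono_AE[OF pt])
        also have "\<dots> = ennreal \<tau> * vol ?U + ennreal M * Y"
          unfolding Y_def by (subst nn_integral_add) (measurable, simp add: nn_integral_cmult nn_integral_cmult_indicator)
        finally have le: "ennreal (3 / 8 * (N powr Q2 * V)) \<le> ennreal (\<tau> * V) + ennreal M * Y"
          using V tau by (simp add: ennreal_mult[symmetric])
        have Yge: "ennreal (1 / 4 * m powr (s - 1) * (N powr (Q2 * s) * V)) \<le> Y"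
        proof (cases Y)
          case (real y)
          then have "3 / 8 * (N powr Q2 * V) \<le> \<tau> * V + M * y"
            using le V tau M by (simp add: ennreal_mult[symmetric] ennreal_plus[symmetric] del: ennreal_plus)
          moreover have "\<tau> * V = 1 / 8 * (N powr Q2 * V)" by (simp add: \<tau>_def)
          ultimately have "1 / 4 * (N powr Q2 * V) \<le> M * y" by linarith
          then have yM: "1 / 4 * (N powr Q2 * V) / M \<le> y" using M by (simp add: field_simps)
          have eq: "1 / 4 * (N powr Q2 * V) / M = 1 / 4 * m powr (s - 1) * (N powr (Q2 * s) * V)"
          proof -
            have "1 / M = (m * N powr Q2) powr (s - 1)"
              using m N0 unfolding M_def by (simp add: powr_minus_divide[symmetric])
            also have "\<dots> = m powr (s - 1) * N powr (Q2 * s - Q2)"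
              using m N0 by (simp add: powr_mult powr_powr algebra_simps)
            finally have "N powr Q2 * (1 / M) = m powr (s - 1) * (N powr Q2 * N powr (Q2 * s - Q2))" by simp
            also have "N powr Q2 * N powr (Q2 * s - Q2) = N powr (Q2 * s)"
              by (simp add: powr_add[symmetric])
            finally have NM: "N powr Q2 * (1 / M) = m powr (s - 1) * N powr (Q2 * s)" .
            have "1 / 4 * (N powr Q2 * V) / M = 1 / 4 * (N powr Q2 * (1 / M)) * V" by simp
            then show ?thesis unfolding NM by simp
          qed
          show ?thesis unfolding real(2) by (rule ennreal_leI) (use yM in \<open>unfold eq\<close>)
        qed simp
        have "Y \<le> (\<integral>\<^sup>+x. epow (seqn q0 B ?ab x) P \<partial>lborel)"
          unfolding Y_def
        proof (intro nn_integral_mono)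
          fix x
          have "S0 x \<le> (\<Sum>i. epow (?ab i) Q0 * indicator (B i) x)"
            unfolding S0_def ab by (intro suminf_mono_ennreal mult_left_mono indicator_leI subsetD[OF EB]) auto
          then have "epow (S0 x) s \<le> epow (\<Sum>i. epow (?ab i) Q0 * indicator (B i) x) s"
            using s by (intro epow_mono) auto
          then show "epow (S0 x) s \<le> epow (seqn q0 B ?ab x) P"
            using pos by (simp add: seqn_finite[OF fin0] defs epow_epow s_def P_def)
        qed
        with Yge have "epow (ennreal (1 / 4 * m powr (s - 1) * (N powr (Q2 * s) * V))) (1 / P)
            \<le> epow (\<integral>\<^sup>+x. epow (seqn q0 B ?ab x) P \<partial>lborel) (1 / P)"
          using P by (intro epow_mono order_trans[OF Yge]) auto
        moreover have "(1 / 4 * m powr (s - 1) * (N powr (Q2 * s) * V)) powr (1 / P) = cl * (N powr (Q2 / Q0) * V powr r1)"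
        proof -
          have "Q2 * s * (1 / P) = Q2 / Q0" using P by (simp add: s_def P_def)
          then have "(1 / 4 * m powr (s - 1) * (N powr (Q2 * s) * V)) powr (1 / P)
              = (1 / 4 * m powr (s - 1)) powr (1 / P) * (N powr (Q2 / Q0) * V powr (1 / P))"
            by (simp only: powr_mult[of _ "N powr (Q2 * s) * V"] powr_mult[of _ V] powr_powr[of N])
          then show ?thesis using pf by (simp only: cl_def r1P P_def if_False)
        qed
        ultimately show ?thesis using pf V m by (simp add: tseq_norm_def mixed_finite P_def[symmetric])
      qed
      have "ennreal (cl * (N powr (Q2 / Q0) * V powr r1)) \<le> ennreal K * ennreal (C2 * (L powr k1 * V powr r1))"
        by (rule order_trans[OF Z order_trans[OF mult_leD(2)[OF mu a] mult_left_mono[OF W]]]) simp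
      also have "\<dots> = ennreal (K * (C2 * (L powr k1 * V powr r1)))"
        using K by (simp add: ennreal_mult')
      finally have "cl * (N powr (Q2 / Q0) * V powr r1) \<le> K * (C2 * (L powr k1 * V powr r1))"
        using K C2(1) by (subst (asm) ennreal_le_iff) auto
      moreover have "N powr (Q2 / Q0) = N powr (Q2 * k1) * N" unfolding ex(1) using N0 by (simp add: powr_add)
      moreover have "L powr k1 = Cw powr (Q2 * k1) * N powr (Q2 * k1)"
        using Cw(1) N0 by (simp add: L_def powr_powr powr_mult)
      ultimately have "(N powr (Q2 * k1) * V powr r1) * (cl * N) \<le> (N powr (Q2 * k1) * V powr r1) * (K * C2 * Cw powr (Q2 * k1))"
        by (simp add: mult_ac)
      then have "cl * N \<le> K * C2 * Cw powr (Q2 * k1)" using N0 V by simp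
      then have "N \<le> (C2 * Cw powr (Q2 * k1) / cl) * K" using cl by (simp add: field_simps)
      then show ?thesis unfolding N(1) by (rule ennreal_leI)
    qed
  qed
  then show ?thesis using C2(1) Cw(1) cl by (intro exI[of _ "C2 * Cw powr (Q2 * k1) / cl"]) auto
qed

lemma tseq_norm_converse:
  assumes cp: "Holder_triple p0 p1 p2" and cq: "Holder_triple q0 q1 q2"
  shows "\<exists>C>0. \<forall>n b K. supp n b \<longrightarrow> mult_le p0 q0 p1 q1 n b K \<longrightarrow> tseq_norm p2 q2 (\<lambda>i. ennreal (b i)) \<le> ennreal (C * K)"
proof -
  note P = Holder_tripleD[OF cp] and Q = Holder_tripleD[OF cq]
  consider "p2 \<noteq> top" "q2 \<noteq> top" | "p2 \<noteq> top" "q2 = top" | "p2 = top" "q2 \<noteq> top" | "p2 = top" "q2 = top" by blast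
  then show ?thesis
  proof cases
    case 1
    then show ?thesis by (rule tseq_norm_converse_fin_fin[OF cp cq])
  next
    case 2
    then have "q0 = q1" using cq Holder_triple_top(2) by auto
    then show ?thesis using tseq_norm_converse_fin_top[OF cp Q(2) 2(1)] 2(2) by simp
  next
    case 3
    then have "p0 = p1" using cp Holder_triple_top(2) by auto
    then show ?thesis using tseq_norm_converse_top_fin[OF P(2) cq 3(2)] 3(1) by simp
  next
    case 4
    then have "p0 = p1" "q0 = q1" using cp cq Holder_triple_top(2) by auto
    then show ?thesis using tseq_norm_converse_top_top[OF P(2) Q(2)] 4 by (intro exI[of _ 1]) auto
  qed
qed

end

section \<open>Whitney boxes\<close>

lemma emeasure_Times_lborel:
  assumes "A \<in> sets borel" "C \<in> sets borel"
  shows "emeasure lborel (A \<times> C) = emeasure lborel (A :: 'a::euclidean_space set) * emeasure lborel (C :: 'b::euclidean_space set)"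
  using assms by (simp add: lborel_prod[symmetric] lborel.emeasure_pair_measure_Times)

lemma lnorm_uniform_finite:
  assumes r: "1 \<le> r" "r \<noteq> top" and [measurable]: "u \<in> borel_measurable lborel" "S \<in> sets lborel"
  shows "lnorm (uniform_measure lborel S) r u = epow ((\<integral>\<^sup>+x. epow (u x) (enn2real r) * indicator S x \<partial>lborel) / emeasure lborel S) (rexp r)"
  unfolding lnorm_finite[OF r(2)] rexp_finite[OF r]
  by (subst nn_integral_uniform_measure) (use assms(3,4) in auto)

text \<open>Enlarging the set of averaging costs only the ratio \<open>k\<close> of the volumes, to
  the power \<open>1 / r\<close>.\<close>

lemma lnorm_uniform_mono:
  fixes S T :: "'b::euclidean_space set"
  assumes r: "1 \<le> r" and [measurable]: "u \<in> borel_measurable borel" "S \<in> sets borel" "T \<in> sets borel"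
    and ST: "S \<subseteq> T" and S: "0 < emeasure lborel S" and T: "emeasure lborel T < top"
    and k: "0 < k" "emeasure lborel T \<le> ennreal k * emeasure lborel S"
  shows "lnorm (uniform_measure lborel S) r u \<le> ennreal (k powr rexp r) * lnorm (uniform_measure lborel T) r u"
proof (cases "r = top")
  case True
  have ne: "emeasure lborel S \<le> emeasure lborel T" using ST by (intro emeasure_mono) auto
  then have S': "emeasure lborel S < top" using T by (rule le_less_trans)
  have T': "0 < emeasure lborel T" using S ne by (rule less_le_trans)
  have "AE x in lborel. x \<in> T \<longrightarrow> u x \<le> lnorm (uniform_measure lborel T) top u"
    using AE_le_lnorm_top[of u "uniform_measure lborel T"] T T' by (subst (asm) AE_uniform_measure) auto
  then have "AE x in lborel. x \<in> S \<longrightarrow> u x \<le> lnorm (uniform_measure lborel T) top u"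
    by eventually_elim (use ST in auto)
  then have "lnorm (uniform_measure lborel S) top u \<le> lnorm (uniform_measure lborel T) top u"
    using S S' by (intro lnorm_top_leI) (subst AE_uniform_measure, auto)
  then show ?thesis using True k by simp
next
  case False
  let ?IS = "\<integral>\<^sup>+x. epow (u x) (enn2real r) * indicator S x \<partial>lborel" and ?IT = "\<integral>\<^sup>+x. epow (u x) (enn2real r) * indicator T x \<partial>lborel"
  have "emeasure lborel S \<le> emeasure lborel T" using ST by (intro emeasure_mono) auto
  then obtain a b where ab: "emeasure lborel S = ennreal a" "0 < a" "emeasure lborel T = ennreal b" "0 < b"
    using S T by (cases "emeasure lborel S"; cases "emeasure lborel T") (auto simp: top_unique)
  have ba: "b \<le> k * a" using k ab by (simp add: ennreal_mult[symmetric])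
  have "?IS / emeasure lborel S \<le> ?IT / emeasure lborel S"
    using ST by (intro divide_right_mono_ennreal nn_integral_mono) (auto simp: indicator_def)
  also have "\<dots> = ennreal (1 / a) * ?IT"
    using ab by (simp add: divide_ennreal_def inverse_ennreal divide_inverse mult.commute)
  also have "\<dots> \<le> ennreal (k / b) * ?IT"
    using ba ab by (intro mult_right_mono ennreal_leI) (auto simp: field_simps)
  also have "\<dots> = ennreal k * (?IT / emeasure lborel T)"
    using ab k by (simp add: divide_ennreal_def inverse_ennreal divide_inverse mult_ac ennreal_mult)
  finally have "epow (?IS / emeasure lborel S) (rexp r) \<le> epow (ennreal k * (?IT / emeasure lborel T)) (rexp r)"
    by (intro epow_mono) auto
  then show ?thesis using k r False by (simp add: lnorm_uniform_finite epow_mult)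
qed

text \<open>The comparison is asked for positive heights only, because that is where the Whitney
  averages are understood.\<close>

lemma tent_norm_mono:
  assumes "1 \<le> p" "1 \<le> q" "\<And>yt. 0 < snd yt \<Longrightarrow> g yt \<le> h yt"
  shows "tent_norm p q g \<le> tent_norm p q (h :: 'a::euclidean_space \<times> real \<Rightarrow> ennreal)"
proof -
  have c: "0 < snd yt" if "yt \<in> cone x" for x :: 'a and yt using that by (auto simp: cone_def)
  have t: "0 < snd yt" if "yt \<in> tent B" for B :: "'a set" and yt using that by (auto simp: tent_def)
  have u: "0 < snd yt" if "yt \<in> upper_half" for yt :: "'a \<times> real" using that by (auto simp: upper_half_def)
  have i1: "indicator (cone x) yt * epow (g yt) (enn2real q) \<le> indicator (cone x) yt * epow (h yt) (enn2real q)" for x yt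
    using assms(3)[OF c, of yt x] by (auto simp: indicator_def intro!: epow_mono)
  have i2: "indicator (tent B) yt * epow (g yt) (enn2real q) \<le> indicator (tent B) yt * epow (h yt) (enn2real q)" for B yt
    using assms(3)[OF t, of yt B] by (auto simp: indicator_def intro!: epow_mono)
  have i3: "ess_sup_on upper_half g \<le> ess_sup_on upper_half h"
    unfolding ess_sup_on_def
  proof (intro Inf_superset_mono subsetI)
    fix k assume "k \<in> {c. AE x in lborel. x \<in> upper_half \<longrightarrow> h x \<le> c}"
    then have "AE x in lborel. x \<in> upper_half \<longrightarrow> h x \<le> k" by simp
    then have "AE x in lborel. x \<in> upper_half \<longrightarrow> g x \<le> k"
      by eventually_elim (use assms(3)[OF u] in \<open>auto intro: order_trans\<close>)
    then show "k \<in> {c. AE x in lborel. x \<in> upper_half \<longrightarrow> g x \<le> c}" by simp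
  qed
  have i4: "(SUP yt\<in>cone x. g yt) \<le> (SUP yt\<in>cone x. h yt)" for x
    using assms(3)[OF c] by (intro SUP_mono) blast
  have Q: "0 \<le> enn2real p / enn2real q" "0 \<le> 1 / enn2real p" "0 \<le> 1 / enn2real q" "0 \<le> enn2real p" by auto
  consider "p \<noteq> top" "q \<noteq> top" | "p = top" "q \<noteq> top" | "p \<noteq> top" "q = top" | "p = top" "q = top" by blast
  then show ?thesis
  proof cases
    case 1
    then show ?thesis unfolding tent_norm_def
      by (simp, intro epow_mono[OF _ Q(1)] epow_mono[OF _ Q(2)] nn_integral_mono mult_right_mono i1) auto
  next
    case 2
    have "epow (inverse (emeasure lborel B) * (\<integral>\<^sup>+ yt. indicator (tent B) yt * epow (g yt) (enn2real q) * ennreal (1 / snd yt) \<partial>lborel)) (1 / enn2real q)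
      \<le> epow (inverse (emeasure lborel B) * (\<integral>\<^sup>+ yt. indicator (tent B) yt * epow (h yt) (enn2real q) * ennreal (1 / snd yt) \<partial>lborel)) (1 / enn2real q)" for B
      by (intro epow_mono[OF _ Q(3)] mult_left_mono nn_integral_mono mult_right_mono i2) auto
    then show ?thesis using 2 unfolding tent_norm_def by (auto intro!: SUP_mono' SUP_subset_mono)
  next
    case 3
    then show ?thesis unfolding tent_norm_def
      by (simp, intro epow_mono[OF _ Q(2)] epow_mono[OF _ Q(4)] nn_integral_mono i4)
  next
    case 4
    then show ?thesis unfolding tent_norm_def using i3 by simp
  qed
qed

text \<open>A partition of the upper half space into boxes of height and width about
  \<open>t i\<close>. Horizontally a box lies within \<open>\<alpha>1 / 2 * t i\<close> of
  \<open>c i\<close>; the halving puts any two of its points within \<open>\<alpha>1 * t i\<close>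
  of each other.\<close>

locale whitney_boxes =
  fixes \<alpha>1 \<alpha>2 :: real and c :: "nat \<Rightarrow> 'a::euclidean_space" and t :: "nat \<Rightarrow> real"
    and Q :: "nat \<Rightarrow> ('a \<times> real) set" and \<kappa> :: real
  assumes \<alpha>: "0 < \<alpha>1" "\<alpha>1 < 1" "1 < \<alpha>2"
    and t_pos: "0 < t i"
    and Q_sets [measurable]: "Q i \<in> sets borel"
    and Q_disj: "disjoint_family Q"
    and Q_cover: "(\<Union>i. Q i) = upper_half"
    and Q_bounds: "yt \<in> Q i \<Longrightarrow> dist (fst yt) (c i) < \<alpha>1 / 2 * t i \<and> t i \<le> snd yt \<and> snd yt < \<alpha>2 * t i"
    and \<kappa>: "0 < \<kappa>"
    and Q_vol: "ennreal (\<kappa> * t i ^ (DIM('a) + 1)) \<le> emeasure lborel (Q i)"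
begin


text \<open>The radius has to cover the shadow of the enlarged box \<open>dil i\<close>: its
  horizontal radius \<open>2 * \<alpha>2\<^sup>2 * t i\<close> plus its maximal height
  \<open>\<alpha>2\<^sup>2 * t i\<close>.\<close>

sublocale ball_family c "\<lambda>i. 3 * \<alpha>2\<^sup>2 * t i"
  using \<alpha> t_pos by unfold_locales auto

definition "\<omega> = measure lborel (ball (c 0) 1)"

lemma \<omega>_eq: "\<omega> = unit_ball_vol (real DIM('a))"
  by (simp add: \<omega>_def measure_def emeasure_ball)

lemma \<omega>: "0 < \<omega>" by (simp add: \<omega>_eq)

lemma ball_vol: "0 \<le> r \<Longrightarrow> vol (ball (z::'a) r) = ennreal (\<omega> * r ^ DIM('a))"
  by (simp add: emeasure_ball \<omega>_eq)

lemma cyl_vol: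
  assumes "0 \<le> r" "a \<le> b"
  shows "emeasure lborel (ball (z::'a) r \<times> {a<..<b}) = ennreal (\<omega> * r ^ DIM('a) * (b - a))"
  using assms using \<omega> by (simp add: emeasure_Times_lborel ball_vol ennreal_mult)

lemma Q_pos: "yt \<in> Q i \<Longrightarrow> 0 < snd yt"
  using Q_bounds[of yt i] t_pos[of i] by auto

lemma vol_Q_pos: "0 < emeasure lborel (Q i)"
  using Q_vol[of i] \<kappa> t_pos[of i] by (auto intro: less_le_trans[rotated])

lemma Q_sub_cyl: "Q i \<subseteq> ball (c i) (\<alpha>1 / 2 * t i) \<times> {0<..<\<alpha>2 * t i}"
  using Q_bounds[of _ i] t_pos[of i] by (force simp: dist_commute)

lemma vol_Q_finite: "emeasure lborel (Q i) < top"
proof -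
  have "emeasure lborel (Q i) \<le> emeasure lborel (ball (c i) (\<alpha>1 / 2 * t i) \<times> {0<..<\<alpha>2 * t i})"
    by (intro emeasure_mono Q_sub_cyl) (auto simp: borel_Times)
  also have "\<dots> < top" using \<alpha> t_pos[of i] by (subst cyl_vol) auto
  finally show ?thesis .
qed

abbreviation W :: "'a \<times> real \<Rightarrow> ('a \<times> real) set" where "W \<equiv> whitney \<alpha>1 \<alpha>2"

lemma W_eq: "W yt = ball (fst yt) (\<alpha>1 * snd yt) \<times> {snd yt / \<alpha>2<..<\<alpha>2 * snd yt}"
  by (auto simp: whitney_def dist_commute)

lemma W_sets [measurable]: "W yt \<in> sets borel"
  unfolding W_eq by (auto simp: borel_Times)

definition "cW = \<omega> * \<alpha>1 ^ DIM('a) * (\<alpha>2 - 1 / \<alpha>2)"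

lemma cW: "0 < cW"
proof -
  have "1 / \<alpha>2 < \<alpha>2" using \<alpha> less_trans[of "1 / \<alpha>2" 1 \<alpha>2] by simp
  then show ?thesis using \<alpha> \<omega> by (simp add: cW_def)
qed

lemma W_vol: "0 < snd yt \<Longrightarrow> emeasure lborel (W yt) = ennreal (cW * snd yt ^ (DIM('a) + 1))"
proof -
  assume s: "0 < snd yt"
  have "snd yt / \<alpha>2 \<le> \<alpha>2 * snd yt"
  proof -
    have "snd yt / \<alpha>2 \<le> snd yt" "snd yt \<le> \<alpha>2 * snd yt" using s \<alpha> by (simp_all add: field_simps)
    then show ?thesis by simp
  qed
  then show ?thesis unfolding W_eq using s \<alpha>
    by (subst cyl_vol) (auto simp: cW_def power_mult_distrib algebra_simps)
qed

text \<open>A cylinder containing every point whose Whitney region meets \<open>Q i\<close>, as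
  \<open>meets_dil\<close> shows.\<close>

definition dil :: "nat \<Rightarrow> ('a \<times> real) set" where
  "dil i = ball (c i) (2 * \<alpha>2\<^sup>2 * t i) \<times> {t i / \<alpha>2<..<\<alpha>2\<^sup>2 * t i}"

lemma dil_sets [measurable]: "dil i \<in> sets borel"
  unfolding dil_def by (auto simp: borel_Times)

lemma \<alpha>2_sq: "\<alpha>2 < \<alpha>2\<^sup>2" "1 < \<alpha>2\<^sup>2"
proof -
  show "\<alpha>2 < \<alpha>2\<^sup>2" using \<alpha> by (simp add: power2_eq_square)
  then show "1 < \<alpha>2\<^sup>2" using \<alpha> by linarith
qed

lemma meets_dil:
  assumes "0 < snd yt" "Q i \<inter> W yt \<noteq> {}" shows "yt \<in> dil i"
proof -
  obtain zs where zs: "zs \<in> Q i" "zs \<in> W yt" using assms by auto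
  define y s z s1 where "y = fst yt" and "s = snd yt" and "z = fst zs" and "s1 = snd zs"
  have a: "dist z (c i) < \<alpha>1 / 2 * t i" "t i \<le> s1" "s1 < \<alpha>2 * t i"
    using Q_bounds[OF zs(1)] by (auto simp: z_def s1_def)
  have b: "dist z y < \<alpha>1 * s" "s / \<alpha>2 < s1" "s1 < \<alpha>2 * s"
    using zs(2) by (auto simp: W_eq z_def s1_def y_def s_def dist_commute)
  have s: "0 < s" using assms(1) by (simp add: s_def)
  have 1: "s < \<alpha>2\<^sup>2 * t i"
  proof -
    have "s < \<alpha>2 * s1" using b(2) \<alpha> by (simp add: field_simps)
    also have "\<dots> < \<alpha>2 * (\<alpha>2 * t i)" using a(3) \<alpha> by simp
    finally show ?thesis by (simp add: power2_eq_square)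
  qed
  have 2: "t i / \<alpha>2 < s" using a(2) b(3) \<alpha> by (simp add: field_simps)
  have "dist (c i) y \<le> dist z (c i) + dist z y" using dist_triangle[of "c i" y z] by (simp add: dist_commute)
  also have "\<dots> < \<alpha>1 / 2 * t i + \<alpha>1 * s" using a b by simp
  also have "\<dots> \<le> \<alpha>2\<^sup>2 * t i + \<alpha>2\<^sup>2 * t i"
  proof (rule add_mono)
    show "\<alpha>1 / 2 * t i \<le> \<alpha>2\<^sup>2 * t i" using \<alpha> \<alpha>2_sq t_pos[of i] by (intro mult_right_mono) auto
    have "\<alpha>1 * s \<le> 1 * s" using \<alpha> s by (intro mult_right_mono) auto
    then show "\<alpha>1 * s \<le> \<alpha>2\<^sup>2 * t i" using 1 by simp
  qed
  finally have "dist (c i) y < 2 * \<alpha>2\<^sup>2 * t i" by (simp add: mult_ac)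
  then show ?thesis using 1 2 by (simp add: dil_def y_def s_def mem_Times_iff)
qed

text \<open>Horizontally this is the halved \<open>\<alpha>1\<close>; vertically it holds because
  the heights in a box differ by a factor less than \<open>\<alpha>2\<close>.\<close>

lemma Q_sub_W:
  assumes "yt \<in> Q i" shows "Q i \<subseteq> W yt"
proof
  fix zs assume zs: "zs \<in> Q i"
  note a = Q_bounds[OF assms] and b = Q_bounds[OF zs]
  have "dist (fst yt) (fst zs) \<le> dist (fst yt) (c i) + dist (fst zs) (c i)"
    using dist_triangle[of "fst yt" "fst zs" "c i"] by (simp add: dist_commute)
  also have "\<dots> < \<alpha>1 * t i" using a b by (simp add: field_simps)
  also have "\<dots> \<le> \<alpha>1 * snd yt" using a \<alpha> by simp
  finally have 1: "dist (fst yt) (fst zs) < \<alpha>1 * snd yt" .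
  have "snd yt < \<alpha>2 * t i" "\<alpha>2 * t i \<le> \<alpha>2 * snd zs" using a b \<alpha> by auto
  then have "snd yt < \<alpha>2 * snd zs" by linarith
  then have 2: "snd yt / \<alpha>2 < snd zs" using \<alpha> by (simp add: field_simps)
  have "snd zs < \<alpha>2 * t i" "\<alpha>2 * t i \<le> \<alpha>2 * snd yt" using a b \<alpha> by auto
  then have 3: "snd zs < \<alpha>2 * snd yt" by linarith
  show "zs \<in> W yt" using 1 2 3 by (simp add: W_eq mem_Times_iff)
qed

section \<open>Averages over Whitney regions compared with averages over boxes\<close>

definition wavg :: "ennreal \<Rightarrow> ('a \<times> real \<Rightarrow> ennreal) \<Rightarrow> 'a \<times> real \<Rightarrow> ennreal" where
  "wavg r u yt = lnorm (uniform_measure lborel (W yt)) r u"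

definition qavg :: "ennreal \<Rightarrow> ('a \<times> real \<Rightarrow> ennreal) \<Rightarrow> nat \<Rightarrow> ennreal" where
  "qavg r u i = lnorm (uniform_measure lborel (Q i)) r u"

text \<open>The box is contained in the Whitney region of each of its points, and the two volumes
  are comparable.\<close>

lemma qavg_le_wavg:
  assumes r: "1 \<le> r"
  shows "\<exists>C>0. \<forall>u i yt. u \<in> borel_measurable borel \<longrightarrow> yt \<in> Q i \<longrightarrow> qavg r u i \<le> ennreal C * wavg r u yt"
proof -
  define k where "k = cW * \<alpha>2 ^ (DIM('a) + 1) / \<kappa>"
  have k: "0 < k" using cW \<kappa> \<alpha> by (simp add: k_def)
  have "qavg r u i \<le> ennreal (k powr rexp r) * wavg r u yt"
    if [measurable]: "u \<in> borel_measurable borel" and yt: "yt \<in> Q i" for u i yt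
  proof -
    have s: "0 < snd yt" by (rule Q_pos[OF yt])
    have "snd yt ^ (DIM('a) + 1) \<le> (\<alpha>2 * t i) ^ (DIM('a) + 1)"
      using Q_bounds[OF yt] s by (intro power_mono) auto
    then have "cW * snd yt ^ (DIM('a) + 1) \<le> cW * (\<alpha>2 * t i) ^ (DIM('a) + 1)"
      using cW by (intro mult_left_mono) auto
    also have "\<dots> = k * (\<kappa> * t i ^ (DIM('a) + 1))"
      using \<kappa> by (simp add: k_def power_mult_distrib)
    finally have "emeasure lborel (W yt) \<le> ennreal (k * (\<kappa> * t i ^ (DIM('a) + 1)))"
      using s by (simp add: W_vol ennreal_leI del: power_Suc)
    also have "\<dots> = ennreal k * ennreal (\<kappa> * t i ^ (DIM('a) + 1))"
      using k \<kappa> t_pos[of i] by (intro ennreal_mult) auto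
    also have "\<dots> \<le> ennreal k * emeasure lborel (Q i)"
      by (intro mult_left_mono Q_vol) simp
    finally show ?thesis unfolding qavg_def wavg_def
      using s by (intro lnorm_uniform_mono r Q_sub_W[OF yt] vol_Q_pos k) (auto simp: W_vol)
  qed
  then show ?thesis using k by (intro exI[of _ "k powr rexp r"]) auto
qed

text \<open>The region is covered by the boxes that it meets. They need not be counted: being
  disjoint and inside a cylinder comparable to the region, they have controlled total volume, so the
  average is at most a constant times the largest box average. That box has the point in its
  \<open>dil i\<close>.\<close>

lemma wavg_le_qavg:
  assumes r: "1 \<le> r"
  shows "\<exists>C>0. \<forall>u yt. u \<in> borel_measurable borel \<longrightarrow> 0 < snd yt \<longrightarrow>
    wavg r u yt \<le> (SUP i. ennreal C * qavg r u i * indicator (dil i) yt)"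
proof -
  define cb where "cb = \<omega> * (3 * \<alpha>2) ^ DIM('a) * \<alpha>2\<^sup>2"
  have cb: "0 < cb" using \<omega> \<alpha> by (simp add: cb_def)
  define C where "C = (cb / cW) powr rexp r"
  have C: "0 < C" using cb cW by (simp add: C_def)
  have "wavg r u yt \<le> (SUP i. ennreal C * qavg r u i * indicator (dil i) yt)"
    if [measurable]: "u \<in> borel_measurable borel" and s: "0 < snd yt" for u yt
  proof -
    define M where "M = (SUP i. qavg r u i * indicator (dil i) yt)"
    have le: "qavg r u i \<le> M" if "Q i \<inter> W yt \<noteq> {}" for i
      unfolding M_def using meets_dil[OF s that] by (intro SUP_upper2[of i]) auto
    have Wup: "\<exists>i. x \<in> Q i" if "x \<in> W yt" for x
    proof -
      have "0 < snd yt / \<alpha>2" using s \<alpha> by simp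
      then have "x \<in> upper_half" using that by (auto simp: W_eq upper_half_def mem_Times_iff)
      then show ?thesis unfolding Q_cover[symmetric] by auto
    qed
    have fin: "emeasure lborel (W yt) \<noteq> 0" "emeasure lborel (W yt) \<noteq> top" using cW s by (auto simp: W_vol)
    have "wavg r u yt \<le> ennreal C * M"
    proof (cases "r = top")
      case True
      have "AE x in lborel. \<forall>i. x \<in> Q i \<longrightarrow> u x \<le> qavg r u i"
      proof (subst AE_all_countable, intro allI)
        fix i
        show "AE x in lborel. x \<in> Q i \<longrightarrow> u x \<le> qavg r u i"
          using AE_le_lnorm_top[of u "uniform_measure lborel (Q i)"] vol_Q_pos[of i] vol_Q_finite[of i] True
          unfolding qavg_def by (subst (asm) AE_uniform_measure) auto
      qed
      then have "AE x in lborel. x \<in> W yt \<longrightarrow> u x \<le> M"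
      proof eventually_elim
        case (elim x)
        show ?case
        proof
          assume x: "x \<in> W yt"
          then obtain i where i: "x \<in> Q i" using Wup by blast
          then have "u x \<le> qavg r u i" using elim by auto
          also have "\<dots> \<le> M" using i x by (intro le) auto
          finally show "u x \<le> M" .
        qed
      qed
      then have "wavg r u yt \<le> M"
        unfolding wavg_def True using fin by (intro lnorm_top_leI) (subst AE_uniform_measure, auto simp: less_top)
      then show ?thesis using True cb cW by (simp add: C_def)
    next
      case False
      define R where "R = enn2real r"
      have R: "0 < R" using exponent_pos[OF r False] by (simp add: R_def)
      have qint: "(\<integral>\<^sup>+x. epow (u x) R * indicator (Q i) x \<partial>lborel) = epow (qavg r u i) R * emeasure lborel (Q i)" for i
      proof -
        have "epow (qavg r u i) R = (\<integral>\<^sup>+x. epow (u x) R * indicator (Q i) x \<partial>lborel) / emeasure lborel (Q i)"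
          unfolding qavg_def using r False R
          by (simp add: lnorm_uniform_finite R_def[symmetric] epow_epow rexp_finite)
        then show ?thesis using vol_Q_pos[of i] vol_Q_finite[of i]
          by (simp add: ennreal_divide_times ennreal_divide_self)
      qed
      \<comment> \<open>The boxes meeting the region, with the empty set elsewhere, so that
        countable additivity applies to the full index set.\<close>
      define T where "T i = (if Q i \<inter> W yt \<noteq> {} then Q i else {})" for i
      have [measurable]: "T i \<in> sets borel" for i by (simp add: T_def)
      have "disjoint_family T" using Q_disj by (auto simp: T_def disjoint_family_on_def)
      then have Tsum: "(\<Sum>i. emeasure lborel (T i)) = emeasure lborel (\<Union>i. T i)"
        by (intro suminf_emeasure) auto
      have Tbig: "(\<Union>i. T i) \<subseteq> ball (fst yt) (3 * \<alpha>2 * snd yt) \<times> {0<..<\<alpha>2\<^sup>2 * snd yt}"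
      proof
        fix w assume "w \<in> (\<Union>i. T i)"
        then obtain i z s' where w: "w = (z, s')" and "(z, s') \<in> T i" by (cases w) auto
        then have zs: "(z, s') \<in> Q i" and ne: "Q i \<inter> W yt \<noteq> {}" by (auto simp: T_def split: if_splits)
        then obtain x where x: "x \<in> Q i" "x \<in> W yt" by auto
        have a: "dist z (c i) < \<alpha>1 / 2 * t i" "t i \<le> s'" "s' < \<alpha>2 * t i" using Q_bounds[OF zs] by auto
        have b: "dist (fst x) (c i) < \<alpha>1 / 2 * t i" "t i \<le> snd x" using Q_bounds[OF x(1)] by auto
        have e: "dist (fst yt) (fst x) < \<alpha>1 * snd yt" "snd x < \<alpha>2 * snd yt" using x(2) by (auto simp: W_eq mem_Times_iff)
        have tis: "t i < \<alpha>2 * snd yt" using b e by simp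
        have "s' < \<alpha>2 * (\<alpha>2 * snd yt)"
          using a(3) tis \<alpha> by (meson less_trans mult_strict_left_mono)
        then have 1: "s' < \<alpha>2\<^sup>2 * snd yt" by (simp add: power2_eq_square)
        have "dist (fst yt) z \<le> dist (fst yt) (fst x) + dist (fst x) (c i) + dist z (c i)"
          using dist_triangle[of "fst yt" z "fst x"] dist_triangle[of "fst x" z "c i"] by (simp add: dist_commute)
        also have "\<dots> < \<alpha>1 * snd yt + \<alpha>1 / 2 * t i + \<alpha>1 / 2 * t i" using a b e by simp
        also have "\<dots> \<le> 1 * (\<alpha>2 * snd yt) + 1 / 2 * (\<alpha>2 * snd yt) + 1 / 2 * (\<alpha>2 * snd yt)"
          using \<alpha> s tis t_pos[of i] by (intro add_mono mult_mono) auto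
        also have "\<dots> \<le> 3 * \<alpha>2 * snd yt" using \<alpha> s by simp
        finally have "dist (fst yt) z < 3 * \<alpha>2 * snd yt" .
        then show "w \<in> ball (fst yt) (3 * \<alpha>2 * snd yt) \<times> {0<..<\<alpha>2\<^sup>2 * snd yt}"
          using 1 a t_pos[of i] w by auto
      qed
      have Tvol: "(\<Sum>i. emeasure lborel (T i)) \<le> ennreal (cb / cW) * emeasure lborel (W yt)"
      proof -
        have "emeasure lborel (\<Union>i. T i) \<le> emeasure lborel (ball (fst yt) (3 * \<alpha>2 * snd yt) \<times> {0<..<\<alpha>2\<^sup>2 * snd yt})"
          by (intro emeasure_mono Tbig) (auto simp: borel_Times)
        also have "\<dots> = ennreal (\<omega> * (3 * \<alpha>2 * snd yt) ^ DIM('a) * (\<alpha>2\<^sup>2 * snd yt - 0))"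
          using \<alpha> s by (intro cyl_vol) auto
        also have "\<omega> * (3 * \<alpha>2 * snd yt) ^ DIM('a) * (\<alpha>2\<^sup>2 * snd yt - 0) = (cb / cW) * (cW * snd yt ^ (DIM('a) + 1))"
          using cW by (simp add: cb_def power_mult_distrib)
        also have "ennreal \<dots> = ennreal (cb / cW) * emeasure lborel (W yt)"
          using cb cW s by (subst ennreal_mult) (auto simp: W_vol)
        finally show ?thesis by (simp add: Tsum)
      qed
      have "(\<integral>\<^sup>+x. epow (u x) R * indicator (W yt) x \<partial>lborel) \<le> (\<integral>\<^sup>+x. (\<Sum>i. epow (u x) R * indicator (T i) x) \<partial>lborel)"
      proof (intro nn_integral_mono)
        fix x
        show "epow (u x) R * indicator (W yt) x \<le> (\<Sum>i. epow (u x) R * indicator (T i) x)"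
        proof (cases "x \<in> W yt")
          case True
          then obtain i where "x \<in> Q i" using Wup by blast
          then have "x \<in> T i" using True by (auto simp: T_def)
          then show ?thesis using le_suminf_ennreal[of "\<lambda>i. epow (u x) R * indicator (T i) x" i] by (simp add: indicator_def)
        qed simp
      qed
      also have "\<dots> = (\<Sum>i. \<integral>\<^sup>+x. epow (u x) R * indicator (T i) x \<partial>lborel)"
        by (intro nn_integral_suminf) measurable
      also have "\<dots> \<le> (\<Sum>i. epow M R * emeasure lborel (T i))"
      proof (intro suminf_mono_ennreal)
        fix i show "(\<integral>\<^sup>+x. epow (u x) R * indicator (T i) x \<partial>lborel) \<le> epow M R * emeasure lborel (T i)"
          using le[of i] R by (auto simp: T_def qint intro!: mult_right_mono epow_mono)
      qed
      also have "\<dots> \<le> epow M R * (ennreal (cb / cW) * emeasure lborel (W yt))"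
        using Tvol by (simp add: mult_left_mono)
      finally have "(\<integral>\<^sup>+x. epow (u x) R * indicator (W yt) x \<partial>lborel) / emeasure lborel (W yt)
         \<le> epow M R * (ennreal (cb / cW) * emeasure lborel (W yt)) / emeasure lborel (W yt)"
        by (rule divide_right_mono_ennreal)
      also have "\<dots> = ennreal (cb / cW) * epow M R"
        using fin mult_divide_eq_ennreal[of "emeasure lborel (W yt)" "epow M R * ennreal (cb / cW)"] by (simp add: mult_ac)
      finally have "epow ((\<integral>\<^sup>+x. epow (u x) R * indicator (W yt) x \<partial>lborel) / emeasure lborel (W yt)) (rexp r)
         \<le> epow (ennreal (cb / cW) * epow M R) (rexp r)"
        by (intro epow_mono) auto
      then show ?thesis using cb cW r False R
        by (simp add: wavg_def lnorm_uniform_finite R_def[symmetric] epow_mult epow_epow C_def rexp_finite[OF r False])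
    qed
    then show ?thesis unfolding M_def by (simp add: SUP_mult_left_ennreal mult.assoc)
  qed
  then show ?thesis using C by blast
qed

end

section \<open>Discretisation of the tent norms\<close>

lemma ennreal_mult3: "0 \<le> x \<Longrightarrow> 0 \<le> y \<Longrightarrow> 0 \<le> z \<Longrightarrow> ennreal (x * y * z) = ennreal x * ennreal y * ennreal z"
  by (simp add: ennreal_mult)

text \<open>Stated for arbitrary \<open>G\<close> because the integrands built from Whitney averages are never shown to be measurable.\<close>
lemma nn_integral_cmult_le:
  assumes z: "0 < z" shows "(\<integral>\<^sup>+x. ennreal z * G x \<partial>M) \<le> ennreal z * (\<integral>\<^sup>+x. G x \<partial>M)"
proof -
  have inv: "ennreal z * ennreal (1 / z) = 1" using z by (simp add: ennreal_mult[symmetric])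
  have "(\<integral>\<^sup>+x. ennreal z * G x \<partial>M) = (SUP h \<in> {h. simple_function M h \<and> h \<le> (\<lambda>x. ennreal z * G x)}. integral\<^sup>S M h)"
    by (simp add: nn_integral_def)
  also have "\<dots> \<le> ennreal z * (\<integral>\<^sup>+x. G x \<partial>M)"
  proof (intro SUP_least, clarify)
    fix h assume h: "simple_function M h" "h \<le> (\<lambda>x. ennreal z * G x)"
    have [measurable]: "h \<in> borel_measurable M" using h(1) by (rule borel_measurable_simple_function)
    have "integral\<^sup>S M h = (\<integral>\<^sup>+x. h x \<partial>M)" using h(1) by (rule nn_integral_eq_simple_integral[symmetric])
    also have "\<dots> = (\<integral>\<^sup>+x. ennreal z * (ennreal (1 / z) * h x) \<partial>M)"
      by (simp only: mult.assoc[symmetric] inv mult_1)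
    also have "\<dots> = ennreal z * (\<integral>\<^sup>+x. ennreal (1 / z) * h x \<partial>M)" by (rule nn_integral_cmult) simp
    also have "\<dots> \<le> ennreal z * (\<integral>\<^sup>+x. G x \<partial>M)"
    proof (intro mult_left_mono nn_integral_mono)
      fix x
      have "ennreal (1 / z) * h x \<le> ennreal (1 / z) * (ennreal z * G x)"
        using h(2) by (intro mult_left_mono) (auto simp: le_fun_def)
      also have "\<dots> = G x" using inv by (simp only: mult.assoc[symmetric] mult.commute[of "ennreal (1 / z)"] mult_1)
      finally show "ennreal (1 / z) * h x \<le> G x" .
    qed simp
    finally show "integral\<^sup>S M h \<le> ennreal z * (\<integral>\<^sup>+x. G x \<partial>M)" .
  qed
  finally show ?thesis .
qed

context whitney_boxes
begin

text \<open>The upper envelope of a sequence: up to a constant it dominates the Whitney averages of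
  a function with these box averages.\<close>

definition tmax :: "(nat \<Rightarrow> ennreal) \<Rightarrow> 'a \<times> real \<Rightarrow> ennreal" where
  "tmax a yt = (SUP i. a i * indicator (dil i) yt)"

lemma dil_cone:
  assumes "yt \<in> dil i" "yt \<in> cone x" shows "x \<in> B i"
proof -
  have a: "dist (c i) (fst yt) < 2 * \<alpha>2\<^sup>2 * t i" "snd yt < \<alpha>2\<^sup>2 * t i"
    using assms(1) by (auto simp: dil_def)
  have "dist (fst yt) x < snd yt" using assms(2) by (auto simp: cone_def)
  then have "dist (c i) x < 2 * \<alpha>2\<^sup>2 * t i + \<alpha>2\<^sup>2 * t i"
    using a dist_triangle[of "c i" x "fst yt"] by linarith
  then show ?thesis by (simp add: algebra_simps)
qed

text \<open>The point gives \<open>t i < \<alpha>2 * R\<close>, and the distances add up to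
  \<open>R + 5 * \<alpha>2\<^sup>2 * t i\<close>; this explains the factor
  \<open>6 * \<alpha>2 ^ 3\<close>.\<close>

lemma dil_tent:
  assumes "yt \<in> dil i" "yt \<in> tent (ball z R)" shows "B i \<subseteq> ball z (6 * \<alpha>2 ^ 3 * R)"
proof
  fix x assume x: "x \<in> B i"
  have a: "dist (c i) (fst yt) < 2 * \<alpha>2\<^sup>2 * t i" "t i / \<alpha>2 < snd yt"
    using assms(1) by (auto simp: dil_def)
  have s: "0 < snd yt" and sub: "ball (fst yt) (snd yt) \<subseteq> ball z R" using assms(2) by (auto simp: tent_def)
  have "dist (fst yt) z + snd yt \<le> R" using sub s by (auto simp: ball_subset_ball_iff)
  then have b: "dist (fst yt) z < R" "snd yt \<le> R" using s zero_le_dist[of "fst yt" z] by linarith+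
  have R: "0 < R" using b s by simp
  have ti: "t i < \<alpha>2 * R"
  proof -
    have "t i < \<alpha>2 * snd yt" using a(2) \<alpha> by (simp add: field_simps)
    also have "\<dots> \<le> \<alpha>2 * R" using b(2) \<alpha> by (intro mult_left_mono) auto
    finally show ?thesis .
  qed
  have "\<alpha>2\<^sup>2 * t i \<le> \<alpha>2\<^sup>2 * (\<alpha>2 * R)" using ti by (intro mult_left_mono) auto
  then have ti3: "\<alpha>2\<^sup>2 * t i \<le> \<alpha>2 ^ 3 * R" by (simp add: power3_eq_cube power2_eq_square mult_ac)
  have R3: "R \<le> \<alpha>2 ^ 3 * R" using R \<alpha> one_le_power[of \<alpha>2 3] by simp
  have "dist z x \<le> dist (fst yt) z + dist (c i) (fst yt) + dist (c i) x"
    using dist_triangle[of z x "fst yt"] dist_triangle[of "fst yt" x "c i"] by (simp add: dist_commute)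
  also have "\<dots> < R + 2 * \<alpha>2\<^sup>2 * t i + 3 * \<alpha>2\<^sup>2 * t i"
    using b(1) a(1) x unfolding mem_ball by linarith
  also have "\<dots> \<le> 6 * \<alpha>2 ^ 3 * R" using ti3 R3 by linarith
  finally show "x \<in> ball z (6 * \<alpha>2 ^ 3 * R)" by simp
qed

definition "cdil = \<omega> * (2 * \<alpha>2\<^sup>2) ^ DIM('a) * (\<alpha>2\<^sup>2 - 1 / \<alpha>2)"

lemma cdil: "0 < cdil"
proof -
  have "1 / \<alpha>2 < 1" using \<alpha> by simp
  then have "1 / \<alpha>2 < \<alpha>2\<^sup>2" using \<alpha>2_sq by linarith
  then show ?thesis using \<omega> \<alpha> by (simp add: cdil_def)
qed

lemma dil_vol: "emeasure lborel (dil i) = ennreal (cdil * t i ^ (DIM('a) + 1))"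
proof -
  have "1 / \<alpha>2 < 1" using \<alpha> by simp
  then have "1 / \<alpha>2 \<le> \<alpha>2\<^sup>2" using \<alpha>2_sq by linarith
  then have "1 / \<alpha>2 * t i \<le> \<alpha>2\<^sup>2 * t i" using t_pos[of i] by (intro mult_right_mono) auto
  then have "emeasure lborel (dil i) = ennreal (\<omega> * (2 * \<alpha>2\<^sup>2 * t i) ^ DIM('a) * (\<alpha>2\<^sup>2 * t i - t i / \<alpha>2))"
    unfolding dil_def using t_pos[of i] by (intro cyl_vol) auto
  also have "\<omega> * (2 * \<alpha>2\<^sup>2 * t i) ^ DIM('a) * (\<alpha>2\<^sup>2 * t i - t i / \<alpha>2) = cdil * t i ^ (DIM('a) + 1)"
    by (simp add: cdil_def power_mult_distrib algebra_simps)
  finally show ?thesis .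
qed

lemma tmax_epow_le:
  assumes "0 < R" shows "epow (tmax a yt) R \<le> (\<Sum>i. epow (a i) R * indicator (dil i) yt)"
  unfolding tmax_def using assms
  by (subst epow_SUP) (auto simp: epow_mult_indicator intro!: SUP_least le_suminf_ennreal)

lemma cone_sets [measurable]: "cone (x::'a) \<in> sets borel"
proof -
  have "open (cone x)" unfolding cone_def
    by (simp add: case_prod_unfold) (intro open_Collect_conj open_Collect_less continuous_intros)
  then show ?thesis by simp
qed

text \<open>A cone at x meets \<open>dil i\<close> only if x lies in \<open>B i\<close>, and a tent
  meets it only if \<open>B i\<close> lies in an enlarged ball. On \<open>dil i\<close> the height
  is about \<open>t i\<close>, so its weighted volume is a constant in the cone integral and a
  multiple of \<open>vol (B i)\<close> in the Carleson integral.\<close>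

lemma tent_norm_le_D:
  assumes p: "1 \<le> p" and q: "1 \<le> q"
  shows "\<exists>C>0. \<forall>a. tent_norm p q (tmax a) \<le> ennreal C * tseq_norm p q a"
proof -
  consider "p \<noteq> top" "q \<noteq> top" | "p = top" "q \<noteq> top" | "p \<noteq> top" "q = top" | "p = top" "q = top" by blast
  then show ?thesis
  proof cases
    case 1
    define P R where "P = enn2real p" and "R = enn2real q"
    have PR: "0 < P" "0 < R" using exponent_pos[OF p 1(1)] exponent_pos[OF q 1(2)] by (auto simp: P_def R_def)
    \<comment> \<open>The volume of \<open>dil i\<close> times the largest weight on it, that at
      height \<open>t i / \<alpha>2\<close>.\<close>
    define k where "k = cdil * \<alpha>2 ^ (DIM('a) + 1)"
    have k: "0 < k" using cdil \<alpha> by (simp add: k_def)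
    have "tent_norm p q (tmax a) \<le> ennreal (k powr (1 / R)) * tseq_norm p q a" for a
    proof -
      have inner: "(\<integral>\<^sup>+ yt. indicator (cone x) yt * epow (tmax a yt) R * ennreal (1 / snd yt ^ (DIM('a) + 1)) \<partial>lborel)
         \<le> ennreal k * (\<Sum>i. epow (a i) R * indicator (B i) x)" for x
      proof -
        have "(\<integral>\<^sup>+ yt. indicator (cone x) yt * epow (tmax a yt) R * ennreal (1 / snd yt ^ (DIM('a) + 1)) \<partial>lborel)
          \<le> (\<integral>\<^sup>+ yt. (\<Sum>i. epow (a i) R * indicator (B i) x * ennreal ((\<alpha>2 / t i) ^ (DIM('a) + 1)) * indicator (dil i) yt) \<partial>lborel)"
        proof (intro nn_integral_mono)
          fix yt :: "'a \<times> real"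
          have "indicator (cone x) yt * epow (tmax a yt) R * ennreal (1 / snd yt ^ (DIM('a) + 1))
            \<le> indicator (cone x) yt * (\<Sum>i. epow (a i) R * indicator (dil i) yt) * ennreal (1 / snd yt ^ (DIM('a) + 1))"
            by (intro mult_right_mono mult_left_mono tmax_epow_le PR) auto
          also have "\<dots> = (\<Sum>i. indicator (cone x) yt * (epow (a i) R * indicator (dil i) yt) * ennreal (1 / snd yt ^ (DIM('a) + 1)))"
            by simp
          also have "\<dots> \<le> (\<Sum>i. epow (a i) R * indicator (B i) x * ennreal ((\<alpha>2 / t i) ^ (DIM('a) + 1)) * indicator (dil i) yt)"
          proof (intro suminf_mono_ennreal)
            fix i
            show "indicator (cone x) yt * (epow (a i) R * indicator (dil i) yt) * ennreal (1 / snd yt ^ (DIM('a) + 1))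
              \<le> epow (a i) R * indicator (B i) x * ennreal ((\<alpha>2 / t i) ^ (DIM('a) + 1)) * indicator (dil i) yt"
            proof (cases "yt \<in> dil i \<and> yt \<in> cone x")
              case True
              have s: "t i / \<alpha>2 < snd yt" using True by (auto simp: dil_def)
              moreover have "0 < t i / \<alpha>2" using t_pos[of i] \<alpha> by simp
              ultimately have "1 / snd yt \<le> 1 / (t i / \<alpha>2)" by (intro divide_left_mono mult_pos_pos) linarith+
              then have "(1 / snd yt) ^ (DIM('a) + 1) \<le> (\<alpha>2 / t i) ^ (DIM('a) + 1)"
                using s \<open>0 < t i / \<alpha>2\<close> by (intro power_mono) auto
              then have "ennreal (1 / snd yt ^ (DIM('a) + 1)) \<le> ennreal ((\<alpha>2 / t i) ^ (DIM('a) + 1))"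
                by (intro ennreal_leI) (simp only: power_one_over)
              then have "epow (a i) R * ennreal (1 / snd yt ^ (DIM('a) + 1)) \<le> epow (a i) R * ennreal ((\<alpha>2 / t i) ^ (DIM('a) + 1))"
                by (rule mult_left_mono) simp
              then show ?thesis using True dil_cone[of yt i x] by (simp only: indicator_simps conjunct1 conjunct2 mult_1 mult_1_right)
            qed auto
          qed
          finally show "indicator (cone x) yt * epow (tmax a yt) R * ennreal (1 / snd yt ^ (DIM('a) + 1))
            \<le> (\<Sum>i. epow (a i) R * indicator (B i) x * ennreal ((\<alpha>2 / t i) ^ (DIM('a) + 1)) * indicator (dil i) yt)" .
        qed
        also have "\<dots> = (\<Sum>i. epow (a i) R * indicator (B i) x * ennreal ((\<alpha>2 / t i) ^ (DIM('a) + 1)) * emeasure lborel (dil i))"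
          by (subst nn_integral_suminf) (measurable, intro suminf_cong nn_integral_cmult_indicator, simp)
        also have "\<dots> = (\<Sum>i. ennreal k * (epow (a i) R * indicator (B i) x))"
        proof (intro suminf_cong)
          fix i
          have "ennreal ((\<alpha>2 / t i) ^ (DIM('a) + 1)) * emeasure lborel (dil i) = ennreal ((\<alpha>2 / t i) ^ (DIM('a) + 1) * (cdil * t i ^ (DIM('a) + 1)))"
            unfolding dil_vol using \<alpha> t_pos[of i] by (intro ennreal_mult[symmetric]) (use cdil in auto)
          also have "(\<alpha>2 / t i) ^ (DIM('a) + 1) * (cdil * t i ^ (DIM('a) + 1)) = k"
            unfolding k_def power_divide using t_pos[of i] by simp
          finally have eq: "ennreal ((\<alpha>2 / t i) ^ (DIM('a) + 1)) * emeasure lborel (dil i) = ennreal k" .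
          show "epow (a i) R * indicator (B i) x * ennreal ((\<alpha>2 / t i) ^ (DIM('a) + 1)) * emeasure lborel (dil i)
             = ennreal k * (epow (a i) R * indicator (B i) x)"
            unfolding mult.assoc[of _ "ennreal ((\<alpha>2 / t i) ^ (DIM('a) + 1))"] eq by (rule mult.commute)
        qed
        finally show ?thesis by simp
      qed
      have "tent_norm p q (tmax a) \<le> epow (\<integral>\<^sup>+ x. ennreal (k powr (P / R)) * epow (seqn q B a x) P \<partial>lborel) (1 / P)"
      proof -
        have "epow (\<integral>\<^sup>+ yt. indicator (cone x) yt * epow (tmax a yt) R * ennreal (1 / snd yt ^ (DIM('a) + 1)) \<partial>lborel) (P / R)
            \<le> ennreal (k powr (P / R)) * epow (seqn q B a x) P" for x
        proof -
          have "epow (\<integral>\<^sup>+ yt. indicator (cone x) yt * epow (tmax a yt) R * ennreal (1 / snd yt ^ (DIM('a) + 1)) \<partial>lborel) (P / R)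
            \<le> epow (ennreal k * (\<Sum>i. epow (a i) R * indicator (B i) x)) (P / R)"
            using PR by (intro epow_mono inner) auto
          then show ?thesis using k 1 by (simp add: epow_mult seqn_finite R_def[symmetric] epow_epow)
        qed
        then show ?thesis unfolding tent_norm_def using 1 PR
          by (simp add: P_def[symmetric] R_def[symmetric], intro epow_mono nn_integral_mono) auto
      qed
      also have "\<dots> = ennreal (k powr (1 / R)) * tseq_norm p q a"
        using 1 PR k by (simp add: nn_integral_cmult epow_mult tseq_norm_def mixed_finite P_def[symmetric] powr_powr)
      finally show ?thesis .
    qed
    then show ?thesis using k by (intro exI[of _ "k powr (1 / R)"]) auto
  next
    case 2
    define R where "R = enn2real q"
    have R: "0 < R" using exponent_pos[OF q 2(2)] by (auto simp: R_def)
    \<comment> \<open>The quotient compares the weighted volume of \<open>dil i\<close> with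
      \<open>vol (B i)\<close>; the last factor pays for the enlarged test ball.\<close>
    define k where "k = cdil * \<alpha>2 / (\<omega> * (3 * \<alpha>2\<^sup>2) ^ DIM('a)) * (6 * \<alpha>2 ^ 3) ^ DIM('a)"
    have k: "0 < k" using cdil \<alpha> \<omega> by (simp add: k_def)
    have "tent_norm p q (tmax a) \<le> ennreal (k powr (1 / R)) * tseq_norm p q a" for a
    proof -
      have main: "epow (inverse (vol (ball z \<rho>)) * (\<integral>\<^sup>+ yt. indicator (tent (ball z \<rho>)) yt * epow (tmax a yt) R * ennreal (1 / snd yt) \<partial>lborel)) (1 / R)
        \<le> ennreal (k powr (1 / R)) * carl q a" if \<rho>: "0 < \<rho>" for z :: 'a and \<rho>
      proof -
        let ?w = "\<lambda>i. of_bool (B i \<subseteq> ball z (6 * \<alpha>2 ^ 3 * \<rho>)) :: ennreal"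
        have "(\<integral>\<^sup>+ yt. indicator (tent (ball z \<rho>)) yt * epow (tmax a yt) R * ennreal (1 / snd yt) \<partial>lborel)
          \<le> (\<integral>\<^sup>+ yt. (\<Sum>i. epow (a i) R * ?w i * ennreal (\<alpha>2 / t i) * indicator (dil i) yt) \<partial>lborel)"
        proof (intro nn_integral_mono)
          fix yt :: "'a \<times> real"
          have "indicator (tent (ball z \<rho>)) yt * epow (tmax a yt) R * ennreal (1 / snd yt)
            \<le> indicator (tent (ball z \<rho>)) yt * (\<Sum>i. epow (a i) R * indicator (dil i) yt) * ennreal (1 / snd yt)"
            by (intro mult_right_mono mult_left_mono tmax_epow_le R) auto
          also have "\<dots> = (\<Sum>i. indicator (tent (ball z \<rho>)) yt * (epow (a i) R * indicator (dil i) yt) * ennreal (1 / snd yt))"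
            by simp
          also have "\<dots> \<le> (\<Sum>i. epow (a i) R * ?w i * ennreal (\<alpha>2 / t i) * indicator (dil i) yt)"
          proof (intro suminf_mono_ennreal)
            fix i
            show "indicator (tent (ball z \<rho>)) yt * (epow (a i) R * indicator (dil i) yt) * ennreal (1 / snd yt)
              \<le> epow (a i) R * ?w i * ennreal (\<alpha>2 / t i) * indicator (dil i) yt"
            proof (cases "yt \<in> dil i \<and> yt \<in> tent (ball z \<rho>)")
              case True
              have s: "t i / \<alpha>2 < snd yt" using True by (auto simp: dil_def)
              moreover have "0 < t i / \<alpha>2" using t_pos[of i] \<alpha> by simp
              ultimately have "1 / snd yt \<le> 1 / (t i / \<alpha>2)" by (intro divide_left_mono mult_pos_pos) linarith+
              then have "ennreal (1 / snd yt) \<le> ennreal (\<alpha>2 / t i)" by (intro ennreal_leI) simp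
              then have "epow (a i) R * ennreal (1 / snd yt) \<le> epow (a i) R * ennreal (\<alpha>2 / t i)"
                by (rule mult_left_mono) simp
              moreover have "?w i = 1" using True dil_tent[of yt i z \<rho>] by simp
              ultimately show ?thesis using True by (simp only: indicator_simps conjunct1 conjunct2 mult_1 mult_1_right)
            qed auto
          qed
          finally show "indicator (tent (ball z \<rho>)) yt * epow (tmax a yt) R * ennreal (1 / snd yt)
            \<le> (\<Sum>i. epow (a i) R * ?w i * ennreal (\<alpha>2 / t i) * indicator (dil i) yt)" .
        qed
        also have "\<dots> = (\<Sum>i. epow (a i) R * ?w i * ennreal (\<alpha>2 / t i) * emeasure lborel (dil i))"
          by (subst nn_integral_suminf) (measurable, intro suminf_cong nn_integral_cmult_indicator, simp)
        also have "\<dots> = (\<Sum>i. ennreal (cdil * \<alpha>2 / (\<omega> * (3 * \<alpha>2\<^sup>2) ^ DIM('a))) * (epow (a i) R * (vol (B i) * ?w i)))"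
        proof (intro suminf_cong)
          fix i
          have "ennreal (\<alpha>2 / t i) * emeasure lborel (dil i) = ennreal (\<alpha>2 / t i * (cdil * t i ^ (DIM('a) + 1)))"
            unfolding dil_vol using \<alpha> t_pos[of i] by (intro ennreal_mult[symmetric]) (use cdil in auto)
          also have "\<alpha>2 / t i * (cdil * t i ^ (DIM('a) + 1)) = cdil * \<alpha>2 / (\<omega> * (3 * \<alpha>2\<^sup>2) ^ DIM('a)) * (\<omega> * (3 * \<alpha>2\<^sup>2 * t i) ^ DIM('a))"
            using t_pos[of i] \<omega> \<alpha> by (simp add: power_mult_distrib)
          also have "ennreal \<dots> = ennreal (cdil * \<alpha>2 / (\<omega> * (3 * \<alpha>2\<^sup>2) ^ DIM('a))) * vol (B i)"
            using t_pos[of i] \<omega> \<alpha> cdil by (subst ennreal_mult) (auto simp: ball_vol)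
          finally have eq: "ennreal (\<alpha>2 / t i) * emeasure lborel (dil i)
            = ennreal (cdil * \<alpha>2 / (\<omega> * (3 * \<alpha>2\<^sup>2) ^ DIM('a))) * vol (B i)" .
          show "epow (a i) R * ?w i * ennreal (\<alpha>2 / t i) * emeasure lborel (dil i)
            = ennreal (cdil * \<alpha>2 / (\<omega> * (3 * \<alpha>2\<^sup>2) ^ DIM('a))) * (epow (a i) R * (vol (B i) * ?w i))"
            unfolding mult.assoc[of _ "ennreal (\<alpha>2 / t i)"] eq by (simp only: mult.assoc mult.commute mult.left_commute)
        qed
        also have "\<dots> = ennreal (cdil * \<alpha>2 / (\<omega> * (3 * \<alpha>2\<^sup>2) ^ DIM('a))) * (\<Sum>i. epow (a i) R * (vol (B i) * ?w i))"
          by simp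
        also have "\<dots> \<le> ennreal (cdil * \<alpha>2 / (\<omega> * (3 * \<alpha>2\<^sup>2) ^ DIM('a))) * (epow (carl q a) R * vol (ball z (6 * \<alpha>2 ^ 3 * \<rho>)))"
          unfolding R_def using R \<rho> \<alpha> by (intro mult_left_mono carlD) (auto simp: R_def)
        also have "vol (ball z (6 * \<alpha>2 ^ 3 * \<rho>)) = ennreal ((6 * \<alpha>2 ^ 3) ^ DIM('a)) * vol (ball z \<rho>)"
          using \<rho> \<alpha> by (intro emeasure_ball_scale) auto
        also have "ennreal (cdil * \<alpha>2 / (\<omega> * (3 * \<alpha>2\<^sup>2) ^ DIM('a))) * (epow (carl q a) R * (ennreal ((6 * \<alpha>2 ^ 3) ^ DIM('a)) * vol (ball z \<rho>)))
           = ennreal k * epow (carl q a) R * vol (ball z \<rho>)"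
        proof -
          have "ennreal k = ennreal (cdil * \<alpha>2 / (\<omega> * (3 * \<alpha>2\<^sup>2) ^ DIM('a))) * ennreal ((6 * \<alpha>2 ^ 3) ^ DIM('a))"
            unfolding k_def using \<alpha> by (intro ennreal_mult'') auto
          then show ?thesis by (simp only: mult_ac)
        qed
        finally have "inverse (vol (ball z \<rho>)) * (\<integral>\<^sup>+ yt. indicator (tent (ball z \<rho>)) yt * epow (tmax a yt) R * ennreal (1 / snd yt) \<partial>lborel)
           \<le> inverse (vol (ball z \<rho>)) * (ennreal k * epow (carl q a) R * vol (ball z \<rho>))"
          by (rule mult_left_mono) simp
        also have "\<dots> = ennreal k * epow (carl q a) R"
        proof -
          have "inverse (vol (ball z \<rho>)) * vol (ball z \<rho>) = 1"
            using emeasure_ball_pos[OF \<rho>, of z] emeasure_lborel_ball_finite[of z \<rho>]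
            by (metis ennreal_divide_self divide_ennreal_def infinity_ennreal_def less_irrefl mult.commute)
          then show ?thesis by (metis mult.assoc mult.commute mult_1_right)
        qed
        finally have "epow (inverse (vol (ball z \<rho>)) * (\<integral>\<^sup>+ yt. indicator (tent (ball z \<rho>)) yt * epow (tmax a yt) R * ennreal (1 / snd yt) \<partial>lborel)) (1 / R)
          \<le> epow (ennreal k * epow (carl q a) R) (1 / R)"
          using R by (intro epow_mono) auto
        then show ?thesis using R k by (simp add: epow_mult epow_epow)
      qed
      have "tent_norm p q (tmax a) = (SUP x::'a. SUP B \<in> {ball c \<rho> | c \<rho>. \<rho> > 0 \<and> x \<in> ball c \<rho>}.
          epow (inverse (emeasure lborel B) *
             (\<integral>\<^sup>+ yt. indicator (tent B) yt * epow (tmax a yt) R * ennreal (1 / snd yt) \<partial>lborel)) (1 / R))"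
        using 2 by (simp add: tent_norm_def R_def)
      also have "\<dots> \<le> ennreal (k powr (1 / R)) * tseq_norm p q a"
        using 2 by (intro SUP_least) (auto simp: tseq_norm_def intro!: main)
      finally show ?thesis .
    qed
    then show ?thesis using k by (intro exI[of _ "k powr (1 / R)"]) auto
  next
    case 3
    have "(SUP yt\<in>cone x. tmax a yt) \<le> seqn q B a x" for a x
      unfolding tmax_def 3(2) seqn_top
    proof (intro SUP_least)
      fix yt i assume "yt \<in> cone x"
      then show "a i * indicator (dil i) yt \<le> (SUP i. a i * indicator (B i) x)"
        using dil_cone[of yt i x] by (intro SUP_upper2[of i]) (auto simp: indicator_def)
    qed
    then have "tent_norm p q (tmax a) \<le> ennreal 1 * tseq_norm p q a" for a
      using 3 by (simp add: tent_norm_def tseq_norm_def mixed_finite) (intro epow_mono nn_integral_mono, auto)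
    then show ?thesis by (intro exI[of _ 1]) auto
  next
    case 4
    have "tent_norm p q (tmax a) \<le> ennreal 1 * tseq_norm p q a" for a
    proof -
      have "tmax a yt \<le> (SUP i. a i)" for yt
        unfolding tmax_def by (intro SUP_mono) (auto simp: indicator_def)
      then show ?thesis using 4 by (auto simp: tent_norm_def tseq_norm_def ess_sup_on_def intro!: Inf_lower)
    qed
    then show ?thesis by (intro exI[of _ 1]) auto
  qed
qed

text \<open>The boxes are disjoint, so at most one summand is nonzero.\<close>

lemma suminf_disjoint_le:
  assumes "\<And>i. yt \<in> Q i \<Longrightarrow> f i \<le> X" shows "(\<Sum>i. f i * indicator (Q i) yt) \<le> (X :: ennreal)"
proof -
  have "(\<Sum>i. f i * indicator (Q i) yt) \<le> (\<Sum>i. X * indicator (Q i) yt)"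
    using assms by (intro suminf_mono_ennreal) (auto simp: indicator_def)
  also have "\<dots> = X * indicator (\<Union>i. Q i) yt"
    using suminf_indicator[OF Q_disj, of yt] by simp
  also have "\<dots> \<le> X" by (simp add: indicator_def)
  finally show ?thesis .
qed

text \<open>For finite \<open>p\<close>, cones contain \<open>Q i\<close> only when their vertex
  lies in a small ball \<open>E i\<close>, not in all of \<open>B i\<close>; the change of aperture
  makes up for this. In the Carleson case \<open>Q i\<close> lies in the tent over any ball
  containing \<open>B i\<close>.\<close>

lemma tseq_norm_le_tent_norm:
  assumes p: "1 \<le> p" and q: "1 \<le> q"
  shows "\<exists>C>0. \<forall>a g. (\<forall>i. \<forall>yt\<in>Q i. a i \<le> g yt) \<longrightarrow> tseq_norm p q a \<le> ennreal C * tent_norm p q g"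
proof -
  \<comment> \<open>From a vertex within \<open>(1 - \<alpha>1) * t i\<close> of \<open>c i\<close>
    the box is at horizontal distance below \<open>(1 - \<alpha>1 / 2) * t i\<close>, hence inside
    the cone.\<close>
  define E where "E i = ball (c i) ((1 - \<alpha>1) * t i)" for i
  define \<eta> where "\<eta> = ((1 - \<alpha>1) / (3 * \<alpha>2\<^sup>2)) ^ DIM('a)"
  have \<eta>: "0 < \<eta>" using \<alpha> by (simp add: \<eta>_def)
  have E [measurable]: "E i \<in> sets borel" for i by (simp add: E_def)
  have spE: "sparse_on UNIV \<eta> E"
    unfolding sparse_on_def
  proof (intro ballI conjI)
    fix i
    have "(1 - \<alpha>1) * t i \<le> 3 * \<alpha>2\<^sup>2 * t i"
      using t_pos[of i] \<alpha> \<alpha>2_sq by (intro mult_right_mono) auto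
    then show "E i \<subseteq> B i" unfolding E_def by (intro subset_ball)
    have "E i = ball (c i) ((1 - \<alpha>1) / (3 * \<alpha>2\<^sup>2) * (3 * \<alpha>2\<^sup>2 * t i))"
      using \<alpha> by (simp add: E_def)
    then show "ennreal \<eta> * vol (B i) \<le> vol (E i)"
      using \<alpha> t_pos[of i] emeasure_ball_scale[of "3 * \<alpha>2\<^sup>2 * t i" "(1 - \<alpha>1) / (3 * \<alpha>2\<^sup>2)" "c i" "c i"]
      by (simp add: \<eta>_def)
  qed simp
  have Qcone: "Q i \<subseteq> cone x" if "x \<in> E i" for i x
  proof
    fix yt assume yt: "yt \<in> Q i"
    note b = Q_bounds[OF yt] Q_pos[OF yt]
    have "dist (fst yt) x \<le> dist (fst yt) (c i) + dist (c i) x" by (rule dist_triangle)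
    also have "\<dots> < \<alpha>1 / 2 * t i + (1 - \<alpha>1) * t i" using b that by (simp add: E_def)
    also have "\<dots> \<le> t i" using \<alpha> t_pos[of i] by (simp add: algebra_simps)
    also have "\<dots> \<le> snd yt" using b by simp
    finally show "yt \<in> cone x" using b by (simp add: cone_def case_prod_unfold)
  qed
  have Qne: "Q i \<noteq> {}" for i using vol_Q_pos[of i] by auto
  obtain C0 where C0: "C0 > 0" "\<And>a. tseq_norm p q a \<le> ennreal C0 * mixed p q E a"
    using tseq_norm_le_mixed[OF \<eta> p q] spE by blast
  consider "p \<noteq> top" "q \<noteq> top" | "p = top" "q \<noteq> top" | "p \<noteq> top" "q = top" | "p = top" "q = top" by blast
  then show ?thesis
  proof cases
    case 1
    define P R where "P = enn2real p" and "R = enn2real q"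
    have PR: "0 < P" "0 < R" using exponent_pos[OF p 1(1)] exponent_pos[OF q 1(2)] by (auto simp: P_def R_def)
    \<comment> \<open>The reciprocal of the guaranteed weighted volume of a box: volume at least
      \<open>\<kappa> * t i^(n+1)\<close>, height below \<open>\<alpha>2 * t i\<close>.\<close>
    define k where "k = \<alpha>2 ^ (DIM('a) + 1) / \<kappa>"
    have k: "0 < k" using \<kappa> \<alpha> by (simp add: k_def)
    have "tseq_norm p q a \<le> ennreal (C0 * k powr (1 / R)) * tent_norm p q g" if ag: "\<And>i yt. yt \<in> Q i \<Longrightarrow> a i \<le> g yt" for a g
    proof -
      define I where "I x = (\<integral>\<^sup>+ yt. indicator (cone x) yt * epow (g yt) R * ennreal (1 / snd yt ^ (DIM('a) + 1)) \<partial>lborel)" for x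
      have inner: "(\<Sum>i. epow (a i) R * indicator (E i) x) \<le> ennreal k * I x" for x
      proof -
        have "(\<Sum>i. epow (a i) R * indicator (E i) x) \<le> (\<Sum>i. ennreal k * (epow (a i) R * indicator (E i) x * ennreal (1 / (\<alpha>2 * t i) ^ (DIM('a) + 1)) * emeasure lborel (Q i)))"
        proof (intro suminf_mono_ennreal)
          fix i
          have "1 = k * (1 / (\<alpha>2 * t i) ^ (DIM('a) + 1)) * (\<kappa> * t i ^ (DIM('a) + 1))"
            unfolding k_def power_mult_distrib using \<kappa> \<alpha> t_pos[of i] by simp
          then have "1 = ennreal (k * (1 / (\<alpha>2 * t i) ^ (DIM('a) + 1)) * (\<kappa> * t i ^ (DIM('a) + 1)))" by simp
          also have "\<dots> = ennreal k * ennreal (1 / (\<alpha>2 * t i) ^ (DIM('a) + 1)) * ennreal (\<kappa> * t i ^ (DIM('a) + 1))"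
            by (rule ennreal_mult3) (use k \<kappa> \<alpha> t_pos[of i] in auto)
          also have "\<dots> \<le> ennreal k * ennreal (1 / (\<alpha>2 * t i) ^ (DIM('a) + 1)) * emeasure lborel (Q i)"
            by (intro mult_left_mono Q_vol) auto
          finally have "epow (a i) R * indicator (E i) x * 1 \<le> epow (a i) R * indicator (E i) x * (ennreal k * ennreal (1 / (\<alpha>2 * t i) ^ (DIM('a) + 1)) * emeasure lborel (Q i))"
            by (rule mult_left_mono) simp
          then show "epow (a i) R * indicator (E i) x \<le> ennreal k * (epow (a i) R * indicator (E i) x * ennreal (1 / (\<alpha>2 * t i) ^ (DIM('a) + 1)) * emeasure lborel (Q i))"
            by (simp only: mult_1 mult_1_right mult_ac)
        qed
        also have "\<dots> = ennreal k * (\<Sum>i. epow (a i) R * indicator (E i) x * ennreal (1 / (\<alpha>2 * t i) ^ (DIM('a) + 1)) * emeasure lborel (Q i))"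
          by simp
        also have "(\<Sum>i. epow (a i) R * indicator (E i) x * ennreal (1 / (\<alpha>2 * t i) ^ (DIM('a) + 1)) * emeasure lborel (Q i))
           = (\<integral>\<^sup>+yt. (\<Sum>i. epow (a i) R * indicator (E i) x * ennreal (1 / (\<alpha>2 * t i) ^ (DIM('a) + 1)) * indicator (Q i) yt) \<partial>lborel)"
          by (subst nn_integral_suminf) (measurable, intro suminf_cong nn_integral_cmult_indicator[symmetric], simp)
        also have "\<dots> \<le> I x"
          unfolding I_def
        proof (intro nn_integral_mono suminf_disjoint_le)
          fix yt i assume yt: "yt \<in> Q i"
          show "epow (a i) R * indicator (E i) x * ennreal (1 / (\<alpha>2 * t i) ^ (DIM('a) + 1)) \<le> indicator (cone x) yt * epow (g yt) R * ennreal (1 / snd yt ^ (DIM('a) + 1))"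
          proof (cases "x \<in> E i")
            case True
            then have "yt \<in> cone x" using Qcone yt by blast
            moreover have "snd yt \<le> \<alpha>2 * t i" "0 < snd yt" using Q_bounds[OF yt] Q_pos[OF yt] by auto
            then have "1 / (\<alpha>2 * t i) ^ (DIM('a) + 1) \<le> 1 / snd yt ^ (DIM('a) + 1)"
              using \<alpha> t_pos[of i] by (intro divide_left_mono power_mono mult_pos_pos zero_less_power) auto
            then have "epow (a i) R * ennreal (1 / (\<alpha>2 * t i) ^ (DIM('a) + 1)) \<le> epow (g yt) R * ennreal (1 / snd yt ^ (DIM('a) + 1))"
              using PR ag[OF yt] by (intro mult_mono epow_mono ennreal_leI) auto
            ultimately show ?thesis using True by (simp only: indicator_simps mult_1 mult_1_right)
          qed simp
        qed
        finally show ?thesis by (simp add: mult_left_mono)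
      qed
      have "mixed p q E a \<le> epow (\<integral>\<^sup>+x. ennreal (k powr (P / R)) * epow (I x) (P / R) \<partial>lborel) (1 / P)"
      proof -
        have "epow (seqn q E a x) P \<le> ennreal (k powr (P / R)) * epow (I x) (P / R)" for x
        proof -
          have "epow (\<Sum>i. epow (a i) R * indicator (E i) x) (P / R) \<le> epow (ennreal k * I x) (P / R)"
            using PR by (intro epow_mono inner) auto
          then show ?thesis using k 1 by (simp add: epow_mult seqn_finite R_def[symmetric] epow_epow)
        qed
        then show ?thesis using 1 PR unfolding mixed_finite[OF 1(1)] P_def[symmetric]
          by (intro epow_mono nn_integral_mono) auto
      qed
      also have "\<dots> \<le> epow (ennreal (k powr (P / R)) * (\<integral>\<^sup>+x. epow (I x) (P / R) \<partial>lborel)) (1 / P)"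
        using PR k
      proof (intro epow_mono)
        show "(\<integral>\<^sup>+x. ennreal (k powr (P / R)) * epow (I x) (P / R) \<partial>lborel) \<le> ennreal (k powr (P / R)) * (\<integral>\<^sup>+x. epow (I x) (P / R) \<partial>lborel)"
          using k by (intro nn_integral_cmult_le) simp
      qed auto
      also have "\<dots> = ennreal (k powr (1 / R)) * tent_norm p q g"
        using 1 PR k by (simp add: epow_mult tent_norm_def P_def[symmetric] R_def[symmetric] I_def powr_powr)
      finally have "ennreal C0 * mixed p q E a \<le> ennreal C0 * (ennreal (k powr (1 / R)) * tent_norm p q g)"
        by (rule mult_left_mono) simp
      then show ?thesis using C0(2)[of a] C0(1) by (simp add: ennreal_mult mult.assoc)
    qed
    then show ?thesis using k C0(1) by (intro exI[of _ "C0 * k powr (1 / R)"]) auto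
  next
    case 2
    define R where "R = enn2real q"
    have R: "0 < R" using exponent_pos[OF q 2(2)] by (auto simp: R_def)
    define k where "k = \<omega> * (3 * \<alpha>2\<^sup>2) ^ DIM('a) * \<alpha>2 / \<kappa>"
    have k: "0 < k" using \<kappa> \<alpha> \<omega> by (simp add: k_def)
    have "tseq_norm p q a \<le> ennreal (k powr (1 / R)) * tent_norm p q g" if ag: "\<And>i yt. yt \<in> Q i \<Longrightarrow> a i \<le> g yt" for a g
    proof -
      define N where "N = tent_norm p q g"
      have "carl q a \<le> ennreal (k powr (1 / R)) * N"
      proof (rule carl_leI, unfold R_def[symmetric])
        show "0 < R" by (rule R)
        fix z :: 'a and \<rho> :: real assume \<rho>: "0 < \<rho>"
        let ?w = "\<lambda>i. of_bool (B i \<subseteq> ball z \<rho>) :: ennreal"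
        define I where "I = (\<integral>\<^sup>+ yt. indicator (tent (ball z \<rho>)) yt * epow (g yt) R * ennreal (1 / snd yt) \<partial>lborel)"
        have "(\<Sum>i. epow (a i) R * (vol (B i) * ?w i)) \<le> (\<Sum>i. ennreal k * (epow (a i) R * ?w i * ennreal (1 / (\<alpha>2 * t i)) * emeasure lborel (Q i)))"
        proof (intro suminf_mono_ennreal)
          fix i
          have "vol (B i) = ennreal (k * (1 / (\<alpha>2 * t i)) * (\<kappa> * t i ^ (DIM('a) + 1)))"
            using \<kappa> \<alpha> t_pos[of i] by (simp add: ball_vol k_def power_mult_distrib mult.assoc)
          also have "\<dots> = ennreal k * ennreal (1 / (\<alpha>2 * t i)) * ennreal (\<kappa> * t i ^ (DIM('a) + 1))"
            by (rule ennreal_mult3) (use k \<kappa> \<alpha> t_pos[of i] in auto)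
          also have "\<dots> \<le> ennreal k * ennreal (1 / (\<alpha>2 * t i)) * emeasure lborel (Q i)"
            by (intro mult_left_mono Q_vol) auto
          finally have "epow (a i) R * ?w i * vol (B i) \<le> epow (a i) R * ?w i * (ennreal k * ennreal (1 / (\<alpha>2 * t i)) * emeasure lborel (Q i))"
            by (rule mult_left_mono) simp
          then show "epow (a i) R * (vol (B i) * ?w i) \<le> ennreal k * (epow (a i) R * ?w i * ennreal (1 / (\<alpha>2 * t i)) * emeasure lborel (Q i))"
            by (simp only: mult_ac)
        qed
        also have "\<dots> = ennreal k * (\<Sum>i. epow (a i) R * ?w i * ennreal (1 / (\<alpha>2 * t i)) * emeasure lborel (Q i))"
          by simp
        also have "(\<Sum>i. epow (a i) R * ?w i * ennreal (1 / (\<alpha>2 * t i)) * emeasure lborel (Q i))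
          = (\<integral>\<^sup>+yt. (\<Sum>i. epow (a i) R * ?w i * ennreal (1 / (\<alpha>2 * t i)) * indicator (Q i) yt) \<partial>lborel)"
          by (subst nn_integral_suminf) (measurable, intro suminf_cong nn_integral_cmult_indicator[symmetric], simp)
        also have "\<dots> \<le> I"
          unfolding I_def
        proof (intro nn_integral_mono suminf_disjoint_le)
          fix yt i assume yt: "yt \<in> Q i"
          show "epow (a i) R * ?w i * ennreal (1 / (\<alpha>2 * t i)) \<le> indicator (tent (ball z \<rho>)) yt * epow (g yt) R * ennreal (1 / snd yt)"
          proof (cases "B i \<subseteq> ball z \<rho>")
            case True
            have b: "dist (fst yt) (c i) < \<alpha>1 / 2 * t i" "snd yt < \<alpha>2 * t i" "0 < snd yt"
              using Q_bounds[OF yt] Q_pos[OF yt] by auto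
            \<comment> \<open>The distance is below
              \<open>(\<alpha>1 / 2 + \<alpha>2) * t i\<close>, within the radius of
              \<open>B i\<close>; hence \<open>yt\<close> lies in the tent over
              \<open>ball z \<rho>\<close>.\<close>
            have "ball (fst yt) (snd yt) \<subseteq> B i"
            proof
              fix x assume x: "x \<in> ball (fst yt) (snd yt)"
              have "dist (c i) x \<le> dist (fst yt) (c i) + dist (fst yt) x"
                using dist_triangle[of "c i" x "fst yt"] by (simp add: dist_commute)
              also have "\<dots> < \<alpha>1 / 2 * t i + \<alpha>2 * t i" using b x by simp
              also have "\<dots> \<le> \<alpha>2\<^sup>2 * t i + \<alpha>2\<^sup>2 * t i"
                using \<alpha> \<alpha>2_sq t_pos[of i] by (intro add_mono mult_right_mono) auto
              also have "\<dots> \<le> 3 * \<alpha>2\<^sup>2 * t i" using \<alpha> t_pos[of i] by simp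
              finally show "x \<in> B i" by simp
            qed
            then have "yt \<in> tent (ball z \<rho>)" using True b by (auto simp: tent_def case_prod_unfold)
            moreover have "1 / (\<alpha>2 * t i) \<le> 1 / snd yt"
              using b \<alpha> t_pos[of i] by (intro divide_left_mono mult_pos_pos) auto
            then have "epow (a i) R * ennreal (1 / (\<alpha>2 * t i)) \<le> epow (g yt) R * ennreal (1 / snd yt)"
              using R ag[OF yt] by (intro mult_mono epow_mono ennreal_leI) auto
            ultimately show ?thesis using True by (simp only: indicator_simps mult_1 mult_1_right of_bool_eq simp_thms)
          qed simp
        qed
        finally have 1: "(\<Sum>i. epow (a i) R * (vol (B i) * ?w i)) \<le> ennreal k * I" by (simp add: mult_left_mono)
        have "epow (inverse (vol (ball z \<rho>)) * I) (1 / R) \<le> N"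
          unfolding N_def tent_norm_def using 2 \<rho>
          by (simp add: I_def R_def[symmetric]) (rule SUP_upper2[of z], simp, rule SUP_upper2[of "ball z \<rho>"], auto intro!: exI[of _ z] exI[of _ \<rho>])
        then have "inverse (vol (ball z \<rho>)) * I \<le> epow N R"
          using R epow_le_iff[of "1 / R" "inverse (vol (ball z \<rho>)) * I" N] by simp
        then have "vol (ball z \<rho>) * (inverse (vol (ball z \<rho>)) * I) \<le> vol (ball z \<rho>) * epow N R"
          by (rule mult_left_mono) simp
        moreover have "vol (ball z \<rho>) * inverse (vol (ball z \<rho>)) = 1"
          using emeasure_ball_pos[OF \<rho>, of z] emeasure_lborel_ball_finite[of z \<rho>]
          by (metis ennreal_divide_self divide_ennreal_def infinity_ennreal_def less_irrefl)
        ultimately have "I \<le> vol (ball z \<rho>) * epow N R" by (simp only: mult.assoc[symmetric] mult_1)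
        then have "ennreal k * I \<le> ennreal k * (vol (ball z \<rho>) * epow N R)" by (rule mult_left_mono) simp
        also have "\<dots> = epow (ennreal (k powr (1 / R)) * N) R * vol (ball z \<rho>)"
          using k R by (simp add: epow_mult powr_powr mult_ac)
        finally show "(\<Sum>i. epow (a i) R * (vol (B i) * ?w i)) \<le> epow (ennreal (k powr (1 / R)) * N) R * vol (ball z \<rho>)"
          using 1 by (rule order_trans[rotated])
      qed
      then show ?thesis using 2 by (simp add: tseq_norm_def N_def)
    qed
    then show ?thesis using k by (intro exI[of _ "k powr (1 / R)"]) auto
  next
    case 3
    have "tseq_norm p q a \<le> ennreal C0 * tent_norm p q g" if ag: "\<And>i yt. yt \<in> Q i \<Longrightarrow> a i \<le> g yt" for a g
    proof -
      have "seqn q E a x \<le> (SUP yt\<in>cone x. g yt)" for x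
        unfolding 3(2) seqn_top
      proof (intro SUP_least)
        fix i
        show "a i * indicator (E i) x \<le> (SUP yt\<in>cone x. g yt)"
        proof (cases "x \<in> E i")
          case True
          obtain yt where yt: "yt \<in> Q i" using Qne by blast
          then have "yt \<in> cone x" using Qcone[OF True] by blast
          then show ?thesis using True ag[OF yt] by (auto intro: SUP_upper2[of yt])
        qed simp
      qed
      then have "mixed p q E a \<le> tent_norm p q g"
        using 3 by (simp add: tent_norm_def mixed_finite) (intro epow_mono nn_integral_mono, auto)
      then have "ennreal C0 * mixed p q E a \<le> ennreal C0 * tent_norm p q g" by (rule mult_left_mono) simp
      with C0(2)[of a] show ?thesis by (rule order_trans)
    qed
    then show ?thesis using C0(1) by blast
  next
    case 4
    have "tseq_norm p q a \<le> ennreal 1 * tent_norm p q g" if ag: "\<And>i yt. yt \<in> Q i \<Longrightarrow> a i \<le> g yt" for a g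
    proof -
      have "a i \<le> k" if k: "AE x in lborel. x \<in> upper_half \<longrightarrow> g x \<le> k" for i k
      proof (rule ccontr)
        assume n: "\<not> a i \<le> k"
        have "AE x in lborel. x \<notin> Q i" using k
        proof eventually_elim
          case (elim x)
          then show ?case using n ag[of x i] Q_cover by auto
        qed
        then have "emeasure lborel (Q i) = 0"
          using AE_iff_measurable[of "Q i" lborel "\<lambda>x. x \<notin> Q i"] by simp
        then show False using vol_Q_pos[of i] by simp
      qed
      then show ?thesis using 4 by (auto simp: tseq_norm_def tent_norm_def ess_sup_on_def intro!: SUP_least Inf_greatest)
    qed
    then show ?thesis by (intro exI[of _ 1]) auto
  qed
qed

end

section \<open>Existence of Whitney boxes\<close>

text \<open>Cut the heights into layers between consecutive powers of \<open>\<alpha>2\<close> and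
  tile each layer by half-open cubes with side proportional to its height. The pair of lower corner
  and height labels a box; equal labels define the partition.\<close>

lemma whitney_boxes_exist:
  assumes \<alpha>: "0 < \<alpha>1" "\<alpha>1 < 1" "1 < \<alpha>2"
  shows "\<exists>(c :: nat \<Rightarrow> 'a::euclidean_space) t Q \<kappa>. whitney_boxes \<alpha>1 \<alpha>2 c t Q \<kappa>"
proof -
  \<comment> \<open>The distance to the corner is estimated by the sum of the coordinates, so the
    side must be \<open>\<alpha>1 / 2\<close> divided by the dimension.\<close>
  define \<epsilon> where "\<epsilon> = \<alpha>1 / (2 * real DIM('a))"
  have \<epsilon>: "0 < \<epsilon>" using \<alpha> by (simp add: \<epsilon>_def)
  \<comment> \<open>\<open>\<tau> s\<close> is the largest integral power of
    \<open>\<alpha>2\<close> not exceeding \<open>s\<close>; below, \<open>corner h y\<close> is the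
    lower corner of the grid cube of side \<open>h\<close> containing \<open>y\<close>.\<close>
  define \<tau> where "\<tau> s = \<alpha>2 powr real_of_int \<lfloor>log \<alpha>2 s\<rfloor>" for s
  define corner where "corner h y = (\<Sum>b\<in>Basis. (h * real_of_int \<lfloor>(y \<bullet> b) / h\<rfloor>) *\<^sub>R b)" for h and y :: 'a
  have \<tau>_pos: "0 < \<tau> s" for s using \<alpha> by (simp add: \<tau>_def)
  have \<tau>_bounds: "\<tau> s \<le> s" "s < \<alpha>2 * \<tau> s" if "0 < s" for s
  proof -
    have "\<alpha>2 powr real_of_int \<lfloor>log \<alpha>2 s\<rfloor> \<le> \<alpha>2 powr log \<alpha>2 s" using \<alpha> by (intro powr_mono) auto
    then show "\<tau> s \<le> s" using that \<alpha> by (simp add: \<tau>_def)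
    have "\<alpha>2 powr log \<alpha>2 s < \<alpha>2 powr (1 + real_of_int \<lfloor>log \<alpha>2 s\<rfloor>)" using \<alpha> by (intro powr_less_mono) linarith+
    then show "s < \<alpha>2 * \<tau> s" using that \<alpha> by (simp add: \<tau>_def powr_add)
  qed
  have \<tau>_eq: "\<tau> s = \<tau> s0" if "\<tau> s0 \<le> s" "s < \<alpha>2 * \<tau> s0" for s s0
  proof -
    have s: "0 < s" using that \<tau>_pos[of s0] by linarith
    let ?k = "\<lfloor>log \<alpha>2 s0\<rfloor>"
    have "log \<alpha>2 (\<tau> s0) \<le> log \<alpha>2 s" using that(1) s \<tau>_pos[of s0] \<alpha> by simp
    moreover have "log \<alpha>2 s < log \<alpha>2 (\<alpha>2 * \<tau> s0)" using that(2) s \<alpha> \<tau>_pos[of s0] by simp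
    moreover have "log \<alpha>2 (\<tau> s0) = ?k" using \<alpha> by (simp add: \<tau>_def)
    moreover have "log \<alpha>2 (\<alpha>2 * \<tau> s0) = 1 + ?k" using \<alpha> \<tau>_pos[of s0] calculation(3) by (simp add: log_mult)
    ultimately have "\<lfloor>log \<alpha>2 s\<rfloor> = ?k" by (intro floor_unique) auto
    then show ?thesis by (simp add: \<tau>_def)
  qed
  have corner_b: "corner h y \<bullet> b = h * real_of_int \<lfloor>(y \<bullet> b) / h\<rfloor>" if "b \<in> Basis" for h y b
    unfolding corner_def using that by (simp add: inner_sum_left_Basis)
  have corner_bounds: "corner h y \<bullet> b \<le> y \<bullet> b" "y \<bullet> b < corner h y \<bullet> b + h" if "b \<in> Basis" "0 < h" for h y b
  proof -
    have "real_of_int \<lfloor>(y \<bullet> b) / h\<rfloor> \<le> (y \<bullet> b) / h" "(y \<bullet> b) / h < real_of_int \<lfloor>(y \<bullet> b) / h\<rfloor> + 1" by linarith+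
    note fl = mult_left_mono[OF this(1) less_imp_le[OF that(2)]] mult_strict_left_mono[OF this(2) that(2)]
    have eq: "h * ((y \<bullet> b) / h) = y \<bullet> b" using that(2) by simp
    show "corner h y \<bullet> b \<le> y \<bullet> b" unfolding corner_b[OF that(1)] using fl(1) unfolding eq .
    show "y \<bullet> b < corner h y \<bullet> b + h"
      unfolding corner_b[OF that(1)] using fl(2) unfolding eq by (simp add: distrib_left)
  qed
  have corner_eq: "corner h y = corner h y0"
    if "0 < h" "\<And>b. b \<in> Basis \<Longrightarrow> corner h y0 \<bullet> b \<le> y \<bullet> b" "\<And>b. b \<in> Basis \<Longrightarrow> y \<bullet> b < corner h y0 \<bullet> b + h" for h y y0
  proof (rule euclidean_eqI)
    fix b :: 'a assume b: "b \<in> Basis"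
    have "\<lfloor>(y \<bullet> b) / h\<rfloor> = \<lfloor>(y0 \<bullet> b) / h\<rfloor>"
    proof (rule floor_unique)
      show "real_of_int \<lfloor>(y0 \<bullet> b) / h\<rfloor> \<le> (y \<bullet> b) / h"
        using that(2)[OF b] that(1) unfolding corner_b[OF b] by (simp add: field_simps)
      show "(y \<bullet> b) / h < real_of_int \<lfloor>(y0 \<bullet> b) / h\<rfloor> + 1"
        using that(3)[OF b] that(1) unfolding corner_b[OF b] by (simp add: field_simps)
    qed
    then show "corner h y \<bullet> b = corner h y0 \<bullet> b" by (simp add: corner_b[OF b])
  qed
  define lab where "lab p = (corner (\<epsilon> * \<tau> (snd p)) (fst p), \<tau> (snd p))" for p :: "'a \<times> real"
  define I where "I = lab ` upper_half"
  have "I \<subseteq> (\<lambda>(k, f). (\<Sum>b\<in>Basis. (\<epsilon> * \<alpha>2 powr real_of_int k * real_of_int (f b)) *\<^sub>R b, \<alpha>2 powr real_of_int k)) ` (UNIV \<times> PiE Basis (\<lambda>_. UNIV :: int set))"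
  proof
    fix v assume "v \<in> I"
    then obtain p where p: "v = lab p" by (auto simp: I_def)
    let ?k = "\<lfloor>log \<alpha>2 (snd p)\<rfloor>" and ?f = "restrict (\<lambda>b. \<lfloor>(fst p \<bullet> b) / (\<epsilon> * \<tau> (snd p))\<rfloor>) Basis"
    have "v = (\<lambda>(k, f). (\<Sum>b\<in>Basis. (\<epsilon> * \<alpha>2 powr real_of_int k * real_of_int (f b)) *\<^sub>R b, \<alpha>2 powr real_of_int k)) (?k, ?f)"
      unfolding p lab_def corner_def by (auto simp: \<tau>_def intro!: sum.cong)
    moreover have "(?k, ?f) \<in> UNIV \<times> PiE Basis (\<lambda>_. UNIV :: int set)" by auto
    ultimately show "v \<in> (\<lambda>(k, f). (\<Sum>b\<in>Basis. (\<epsilon> * \<alpha>2 powr real_of_int k * real_of_int (f b)) *\<^sub>R b, \<alpha>2 powr real_of_int k)) ` (UNIV \<times> PiE Basis (\<lambda>_. UNIV :: int set))"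
      by (rule image_eqI)
  qed
  moreover have "countable ((UNIV :: int set) \<times> PiE (Basis :: 'a set) (\<lambda>_. UNIV :: int set))"
    by (intro countable_SIGMA countable_PiE) auto
  ultimately have cI: "countable I" by (meson countable_image countable_subset)
  \<comment> \<open>The boxes are indexed by all natural numbers without repetition, so the
    countable set of labels has to be infinite; the heights alone show it.\<close>
  have "infinite (snd ` I)"
  proof
    assume fin: "finite (snd ` I)"
    have "range (\<lambda>k::nat. \<alpha>2 powr real k) \<subseteq> snd ` I"
    proof (rule image_subsetI)
      fix k :: nat
      have "\<tau> (\<alpha>2 powr real k) = \<alpha>2 powr real k" using \<alpha> by (simp add: \<tau>_def)
      then have "\<alpha>2 powr real k = snd (lab (0, \<alpha>2 powr real k))" by (simp add: lab_def)
      moreover have "(0, \<alpha>2 powr real k) \<in> upper_half" using \<alpha> by (simp add: upper_half_def)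
      ultimately show "\<alpha>2 powr real k \<in> snd ` I" unfolding I_def by blast
    qed
    then have "finite (range (\<lambda>k::nat. \<alpha>2 powr real k))" using fin by (rule finite_subset)
    moreover have "inj (\<lambda>k::nat. \<alpha>2 powr real k)" using \<alpha> by (intro injI) (simp add: powr_inj)
    ultimately show False using finite_imageD infinite_UNIV_nat by blast
  qed
  then have iI: "infinite I" by auto
  define e where "e = from_nat_into I"
  have bij: "bij_betw e UNIV I" unfolding e_def by (rule bij_betw_from_nat_into[OF cI iI])
  define c where "c i = fst (e i)" for i
  define t where "t i = snd (e i)" for i
  define Q where "Q i = {p \<in> upper_half. lab p = e i}" for i
  define \<kappa> where "\<kappa> = \<epsilon> ^ DIM('a) * (\<alpha>2 - 1)"
  have ei: "e i \<in> I" for i using bij by (auto simp: bij_betw_def)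
  have t_pos: "0 < t i" for i using ei[of i] \<tau>_pos by (auto simp: t_def I_def lab_def)
  have Q_eq: "Q i = {y. \<forall>b\<in>Basis. c i \<bullet> b \<le> y \<bullet> b \<and> y \<bullet> b < c i \<bullet> b + \<epsilon> * t i} \<times> {t i..<\<alpha>2 * t i}" for i
  proof -
    obtain p0 where p0: "e i = lab p0" using ei[of i] by (auto simp: I_def)
    define h where "h = \<epsilon> * \<tau> (snd p0)"
    have h: "0 < h" using \<epsilon> \<tau>_pos by (simp add: h_def)
    have ct: "c i = corner h (fst p0)" "t i = \<tau> (snd p0)" by (simp_all add: c_def t_def p0 lab_def h_def)
    show ?thesis
    proof (intro set_eqI iffI)
      fix p assume "p \<in> Q i"
      then have s: "0 < snd p" and l: "lab p = lab p0" by (auto simp: Q_def p0 upper_half_def)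
      have ts: "\<tau> (snd p) = t i" and cs: "corner h (fst p) = c i"
        using l by (auto simp: lab_def ct h_def)
      show "p \<in> {y. \<forall>b\<in>Basis. c i \<bullet> b \<le> y \<bullet> b \<and> y \<bullet> b < c i \<bullet> b + \<epsilon> * t i} \<times> {t i..<\<alpha>2 * t i}"
        using \<tau>_bounds[OF s] corner_bounds[OF _ h, of _ "fst p"] unfolding ts cs mem_Times_iff
        by (auto simp: h_def ct(2))
    next
      fix p assume p: "p \<in> {y. \<forall>b\<in>Basis. c i \<bullet> b \<le> y \<bullet> b \<and> y \<bullet> b < c i \<bullet> b + \<epsilon> * t i} \<times> {t i..<\<alpha>2 * t i}"
      then have s: "t i \<le> snd p" "snd p < \<alpha>2 * t i" by (auto simp: mem_Times_iff)
      have 1: "\<tau> (snd p) = \<tau> (snd p0)" using s unfolding ct by (rule \<tau>_eq)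
      have 2: "corner h (fst p) = corner h (fst p0)"
        using p unfolding ct h_def[symmetric] by (intro corner_eq h) (auto simp: mem_Times_iff)
      have "0 < snd p" using s t_pos[of i] by linarith
      then show "p \<in> Q i" using 1 2 by (auto simp: Q_def p0 lab_def upper_half_def h_def case_prod_unfold)
    qed
  qed
  have "whitney_boxes \<alpha>1 \<alpha>2 c t Q \<kappa>"
  proof
    fix i
    have cube: "{y. \<forall>b\<in>Basis. c i \<bullet> b \<le> y \<bullet> b \<and> y \<bullet> b < c i \<bullet> b + \<epsilon> * t i} \<in> sets borel"
      by measurable
    show "Q i \<in> sets borel" unfolding Q_eq using cube by (auto simp: borel_Times)
    show "ennreal (\<kappa> * t i ^ (DIM('a) + 1)) \<le> emeasure lborel (Q i)"
    proof -
      have h: "0 < \<epsilon> * t i" using \<epsilon> t_pos[of i] by simp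
      let ?b = "c i + (\<epsilon> * t i) *\<^sub>R (\<Sum>b\<in>Basis. b)"
      have bb: "?b \<bullet> b = c i \<bullet> b + \<epsilon> * t i" if "b \<in> Basis" for b
        using that by (simp add: inner_add_left inner_sum_left_Basis[of b "\<lambda>_. 1", simplified])
      have "emeasure lborel (box (c i) ?b) = ennreal (\<Prod>b\<in>Basis. (?b - c i) \<bullet> b)"
        using h by (intro emeasure_lborel_box) (simp add: bb)
      also have "(\<Prod>b\<in>Basis. (?b - c i) \<bullet> b) = (\<Prod>b\<in>(Basis::'a set). \<epsilon> * t i)"
        by (intro prod.cong refl) (simp add: inner_diff_left bb del: add_diff_cancel_left')
      finally have v: "emeasure lborel (box (c i) ?b) = ennreal ((\<epsilon> * t i) ^ DIM('a))" by simp
      have "\<kappa> * t i ^ (DIM('a) + 1) = (\<epsilon> * t i) ^ DIM('a) * (\<alpha>2 * t i - t i)"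
        by (simp add: \<kappa>_def power_mult_distrib algebra_simps)
      also have "ennreal \<dots> = emeasure lborel (box (c i) ?b \<times> {t i<..<\<alpha>2 * t i})"
        using h \<alpha> t_pos[of i] by (simp add: emeasure_Times_lborel v ennreal_mult')
      also have "\<dots> \<le> emeasure lborel (Q i)"
        using \<open>Q i \<in> sets borel\<close> by (intro emeasure_mono) (auto simp: Q_eq mem_box bb less_imp_le)
      finally show ?thesis .
    qed
    fix yt assume "yt \<in> Q i"
    then have yt: "\<And>b. b \<in> Basis \<Longrightarrow> c i \<bullet> b \<le> fst yt \<bullet> b" "\<And>b. b \<in> Basis \<Longrightarrow> fst yt \<bullet> b < c i \<bullet> b + \<epsilon> * t i"
      "t i \<le> snd yt" "snd yt < \<alpha>2 * t i" by (auto simp: Q_eq mem_Times_iff)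
    have "dist (fst yt) (c i) \<le> (\<Sum>b\<in>Basis. \<bar>(fst yt - c i) \<bullet> b\<bar>)"
      unfolding dist_norm by (rule norm_le_l1)
    also have "\<dots> < (\<Sum>b\<in>(Basis::'a set). \<epsilon> * t i)"
      using yt(1,2) by (intro sum_strict_mono) (force simp: inner_diff_left abs_less_iff)+
    also have "\<dots> = \<alpha>1 / 2 * t i" by (simp add: \<epsilon>_def)
    finally show "dist (fst yt) (c i) < \<alpha>1 / 2 * t i \<and> t i \<le> snd yt \<and> snd yt < \<alpha>2 * t i"
      using yt by simp
  next
    show "disjoint_family Q"
      unfolding disjoint_family_on_def
    proof (intro ballI impI)
      fix i j :: nat assume "i \<noteq> j"
      then have "e i \<noteq> e j" using bij by (auto simp: bij_betw_def inj_on_def)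
      then show "Q i \<inter> Q j = {}" by (auto simp: Q_def)
    qed
    show "(\<Union>i. Q i) = upper_half"
    proof
      show "upper_half \<subseteq> (\<Union>i. Q i)"
      proof
        fix p :: "'a \<times> real" assume p: "p \<in> upper_half"
        then have "lab p \<in> I" by (auto simp: I_def)
        then obtain i where "e i = lab p" using bij by (metis bij_betw_imp_surj_on imageE)
        then have "p \<in> Q i" using p by (simp add: Q_def)
        then show "p \<in> (\<Union>i. Q i)" by blast
      qed
    qed (auto simp: Q_def)
    show "0 < \<kappa>" using \<epsilon> \<alpha> by (simp add: \<kappa>_def)
  qed (use \<alpha> t_pos in auto)
  then show ?thesis by blast
qed

section \<open>The converse of Hoelder's inequality on a probability space\<close>

lemma lnorm_cmult_real:
  assumes p: "1 \<le> p" and [measurable]: "f \<in> borel_measurable M" and k: "0 \<le> k"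
  shows "lnorm M p (\<lambda>x. ennreal k * f x) = ennreal k * lnorm M p f"
proof (cases "k = 0")
  case True
  then show ?thesis using p by simp
next
  case False
  then have k0: "0 < k" using k by simp
  have inv: "ennreal k * ennreal (1 / k) = 1" "ennreal (1 / k) * ennreal k = 1"
    using k0 by (simp_all add: ennreal_mult[symmetric])
  have "ennreal k * lnorm M p f = ennreal k * lnorm M p (\<lambda>x. ennreal (1 / k) * (ennreal k * f x))"
    by (simp only: mult.assoc[symmetric] inv mult_1)
  also have "\<dots> \<le> ennreal k * (ennreal (1 / k) * lnorm M p (\<lambda>x. ennreal k * f x))"
    by (intro mult_left_mono lnorm_cmult_le p) auto
  also have "\<dots> = lnorm M p (\<lambda>x. ennreal k * f x)"
    by (simp only: mult.assoc[symmetric] inv mult_1)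
  finally show ?thesis using lnorm_cmult_le[OF p, of f M "ennreal k"] by (intro antisym) auto
qed

lemma lnorm_one:
  assumes "1 \<le> p" "emeasure M (space M) = 1"
  shows "lnorm M p (\<lambda>x. 1) = 1"
proof (cases "p = top")
  case True
  have "AE x in M. 1 \<le> lnorm M top (\<lambda>x. 1)" by (rule AE_le_lnorm_top)
  then have "1 \<le> lnorm M top (\<lambda>x. 1)"
  proof (rule contrapos_pp)
    assume n: "\<not> 1 \<le> lnorm M top (\<lambda>x. 1)"
    have "\<not> (AE x in M. False)" using assms(2) by (simp add: AE_iff_null_sets[of "space M", symmetric] eventually_False ae_filter_eq_bot_iff)
    then show "\<not> (AE x in M. 1 \<le> lnorm M top (\<lambda>x. 1))" using n by simp
  qed
  moreover have "lnorm M top (\<lambda>x. 1) \<le> 1" by (intro lnorm_top_leI) simp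
  ultimately show ?thesis using True by simp
qed (simp add: lnorm_finite assms)

text \<open>The level \<open>b\<close> stays strictly below the norm of \<open>u\<close>: an
  essential supremum need not be attained, and the norm may be infinite. A constant function works
  for \<open>r1 = top\<close> or \<open>b = 0\<close>, a normalised indicator for
  \<open>r2 = top\<close>, and a normalised power of a truncation of \<open>u\<close>
  otherwise.\<close>

lemma Holder_extremiser:
  assumes c: "Holder_triple r0 r1 r2" and M: "emeasure M (space M) = 1" and [measurable]: "u \<in> borel_measurable M"
    and b: "0 \<le> b" "b = 0 \<or> ennreal b < lnorm M r2 u"
  shows "\<exists>\<phi>. \<phi> \<in> borel_measurable M \<and> (\<forall>x. 0 \<le> \<phi> x) \<and> lnorm M r1 (\<lambda>x. ennreal (\<phi> x)) = 1 \<and>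
    ennreal b \<le> lnorm M r0 (\<lambda>x. ennreal (\<phi> x) * u x)"
proof -
  note r = Holder_tripleD[OF c]
  consider "b = 0" | "b \<noteq> 0" "r1 = top" | "b \<noteq> 0" "r1 \<noteq> top" "r2 = top" | "b \<noteq> 0" "r1 \<noteq> top" "r2 \<noteq> top" by blast
  then show ?thesis
  proof cases
    case 1
    then show ?thesis using lnorm_one[OF r(2) M] by (intro exI[of _ "\<lambda>_. 1"]) auto
  next
    case 2
    then have "r0 = r2" using c Holder_triple_top(1) by auto
    then show ?thesis using lnorm_one[OF r(2) M] 2 b by (intro exI[of _ "\<lambda>_. 1"]) auto
  next
    case 3
    then have r01: "r0 = r1" using c Holder_triple_top(2) by auto
    \<comment> \<open>Not null, since \<open>b\<close> is below the essential supremum; on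
      \<open>S\<close> the product with \<open>u\<close> gains the factor \<open>b\<close>.\<close>
    define S where "S = {x \<in> space M. ennreal b < u x}"
    have [measurable]: "S \<in> sets M" unfolding S_def by measurable
    have "emeasure M S \<noteq> 0"
    proof
      assume "emeasure M S = 0"
      then have "AE x in M. u x \<le> ennreal b"
        by (intro AE_I'[of S]) (auto simp: S_def not_le null_sets_def)
      then have "lnorm M r2 u \<le> ennreal b" using 3 by (auto intro: lnorm_top_leI)
      then show False using b 3 by simp
    qed
    moreover have "emeasure M S \<le> 1" unfolding M[symmetric] by (intro emeasure_mono) (auto simp: S_def)
    ultimately obtain v where v: "emeasure M S = ennreal v" "0 < v"
      by (cases "emeasure M S") (auto simp: less_le top_unique)
    define k where "k = v powr (- rexp r1)"
    have k: "0 < k" using v by (simp add: k_def)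
    have S1: "lnorm M r1 (\<lambda>x. indicator S x) = ennreal (v powr rexp r1)"
      using 3 v r by (simp add: lnorm_finite epow_mult_indicator[of 1, simplified] rexp_finite)
    define \<phi> where "\<phi> x = k * indicator S x" for x
    have [measurable]: "\<phi> \<in> borel_measurable M" unfolding \<phi>_def by measurable
    have eq: "ennreal (\<phi> x) = ennreal k * indicator S x" for x
      by (auto simp: \<phi>_def indicator_def)
    have n1: "lnorm M r1 (\<lambda>x. ennreal (\<phi> x)) = 1"
      unfolding eq using k v by (subst lnorm_cmult_real[OF r(2)]) (auto simp: S1 k_def ennreal_mult[symmetric] powr_add[symmetric])
    have "ennreal b = ennreal b * lnorm M r1 (\<lambda>x. ennreal (\<phi> x))" by (simp add: n1)
    also have "\<dots> = lnorm M r1 (\<lambda>x. ennreal b * ennreal (\<phi> x))"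
      using b r by (intro lnorm_cmult_real[symmetric]) (auto simp: \<phi>_def)
    also have "\<dots> \<le> lnorm M r1 (\<lambda>x. ennreal (\<phi> x) * u x)"
    proof (rule lnorm_mono[OF r(2)])
      fix x
      show "ennreal b * ennreal (\<phi> x) \<le> ennreal (\<phi> x) * u x"
      proof (cases "x \<in> S")
        case True
        then have "ennreal (\<phi> x) * ennreal b \<le> ennreal (\<phi> x) * u x"
          by (intro mult_left_mono) (auto simp: S_def)
        then show ?thesis by (simp only: mult.commute)
      qed (simp add: \<phi>_def)
    qed
    finally show ?thesis using n1 k r01 by (intro exI[of _ \<phi>]) (simp, simp add: \<phi>_def)
  next
    case 4
    have r0: "r0 \<noteq> top" using r 4 by auto
    define R0 R1 R2 where "R0 = enn2real r0" and "R1 = enn2real r1" and "R2 = enn2real r2"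
    note defs = R0_def[symmetric] R1_def[symmetric] R2_def[symmetric]
    have R: "0 < R0" "0 < R1" "0 < R2"
      using exponent_pos[OF r(1) r0] exponent_pos[OF r(2) 4(2)] exponent_pos[OF r(3) 4(3)] by (auto simp: defs)
    have rel: "1 / R0 = 1 / R1 + 1 / R2" using r 4 r0 by (simp add: rexp_finite defs)
    have ex: "(R2 / R1 + 1) * R0 = R2" using rel R by (simp add: field_simps)
    \<comment> \<open>Truncation makes the norm finite, so that it can be divided by; by monotone
      convergence some truncation still has norm above \<open>b\<close>.\<close>
    define f where "f n x = min (u x) (of_nat n)" for n :: nat and x
    have [measurable]: "f n \<in> borel_measurable M" for n unfolding f_def by measurable
    have fsup: "(SUP n. f n x) = u x" for x
    proof -
      have "(SUP n. f n x) = min (u x) (SUP n. of_nat n)"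
        unfolding f_def inf_min[symmetric] by (simp add: inf_SUP)
      then show ?thesis by (simp add: ennreal_SUP_of_nat_eq_top)
    qed
    have "lnorm M r2 (\<lambda>x. SUP n. f n x) = (SUP n. lnorm M r2 (f n))"
      by (intro lnorm_monotone_convergence r) (auto simp: incseq_def f_def min_def intro: order_trans)
    then have "ennreal b < (SUP n. lnorm M r2 (f n))" using b 4 by (simp add: fsup)
    then obtain n where n: "ennreal b < lnorm M r2 (f n)" by (auto simp: less_SUP_iff)
    define g where "g x = enn2real (f n x)" for x
    have fn: "f n x = ennreal (g x)" for x
      unfolding g_def by (rule ennreal_enn2real[symmetric]) (auto simp: f_def min_less_iff_disj of_nat_less_top)
    have g0: "0 \<le> g x" for x by (simp add: g_def)
    have [measurable]: "g \<in> borel_measurable M" unfolding g_def by measurable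
    have gu: "ennreal (g x) \<le> u x" for x unfolding fn[symmetric] by (simp add: f_def)
    define X where "X = lnorm M r2 (f n)"
    have "X \<le> lnorm M r2 (\<lambda>x. of_nat n)" unfolding X_def by (intro lnorm_mono r) (simp add: f_def)
    also have "\<dots> < top" using 4 R M by (simp add: lnorm_finite defs ennreal_of_nat_eq_real_of_nat)
    finally obtain x0 where x0: "X = ennreal x0" "0 < x0"
      using n b by (cases X) (auto simp: X_def less_le)
    have Xint: "(\<integral>\<^sup>+x. ennreal (g x powr R2) \<partial>M) = ennreal (x0 powr R2)"
    proof -
      have "ennreal (x0 powr R2) = epow X R2" using x0 by simp
      also have "\<dots> = (\<integral>\<^sup>+x. ennreal (g x powr R2) \<partial>M)"
        unfolding X_def using 4 R g0 by (simp add: lnorm_finite defs epow_epow fn)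
      finally show ?thesis by simp
    qed
    \<comment> \<open>Normalises \<open>g^(R2/R1)\<close>, whose \<open>r1\<close>-norm is
      \<open>x0^(R2/R1)\<close>.\<close>
    define k where "k = x0 powr (- (R2 / R1))"
    have k: "0 < k" using x0 by (simp add: k_def)
    define \<phi> where "\<phi> x = k * g x powr (R2 / R1)" for x
    have \<phi>0: "0 \<le> \<phi> x" for x using k by (simp add: \<phi>_def)
    have [measurable]: "\<phi> \<in> borel_measurable M" unfolding \<phi>_def by measurable
    have n1: "lnorm M r1 (\<lambda>x. ennreal (\<phi> x)) = 1"
    proof -
      have "lnorm M r1 (\<lambda>x. ennreal (\<phi> x)) = ennreal k * lnorm M r1 (\<lambda>x. ennreal (g x powr (R2 / R1)))"
        unfolding \<phi>_def using k by (simp add: ennreal_mult lnorm_cmult_real r)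
      also have "lnorm M r1 (\<lambda>x. ennreal (g x powr (R2 / R1))) = ennreal (x0 powr (R2 / R1))"
        using 4 R x0 by (simp add: lnorm_finite defs powr_powr Xint)
      finally show ?thesis using k x0 by (simp add: k_def ennreal_mult[symmetric] powr_add[symmetric])
    qed
    have "ennreal b \<le> X" using n by (simp add: X_def)
    also have "X = ennreal k * lnorm M r0 (\<lambda>x. ennreal (g x powr (R2 / R1 + 1)))"
    proof -
      have "lnorm M r0 (\<lambda>x. ennreal (g x powr (R2 / R1 + 1))) = ennreal (x0 powr (R2 / R0))"
        using r0 R x0 by (simp add: lnorm_finite defs powr_powr ex Xint)
      moreover have "k * x0 powr (R2 / R0) = x0"
      proof -
        have "- (R2 / R1) + R2 / R0 = 1" using rel R by (simp add: field_simps)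
        then show ?thesis using x0 by (simp add: k_def powr_add[symmetric])
      qed
      ultimately show ?thesis using k x0 by (simp add: ennreal_mult[symmetric])
    qed
    also have "\<dots> = lnorm M r0 (\<lambda>x. ennreal k * ennreal (g x powr (R2 / R1 + 1)))"
      using k by (intro lnorm_cmult_real[symmetric] r) auto
    also have "\<dots> \<le> lnorm M r0 (\<lambda>x. ennreal (\<phi> x) * u x)"
    proof (rule lnorm_mono[OF r(1)])
      fix x
      have "g x powr (R2 / R1 + 1) = g x powr (R2 / R1) * g x"
        using g0[of x] by (cases "g x = 0") (auto simp: powr_add)
      then have "ennreal k * ennreal (g x powr (R2 / R1 + 1)) = ennreal (\<phi> x) * ennreal (g x)"
        using k g0[of x] by (simp add: \<phi>_def ennreal_mult[symmetric])
      also have "\<dots> \<le> ennreal (\<phi> x) * u x" by (intro mult_left_mono gu) simp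
      finally show "ennreal k * ennreal (g x powr (R2 / R1 + 1)) \<le> ennreal (\<phi> x) * u x" .
    qed
    finally show ?thesis using n1 \<phi>0 by (intro exI[of _ \<phi>]) auto
  qed
qed

section \<open>Weighted tent spaces\<close>

context whitney_boxes
begin

lemma whitney_avg_eq_wavg:
  assumes r: "1 \<le> r" and s: "0 < snd yt" and [measurable]: "u \<in> borel_measurable borel"
    and uF: "AE x in lborel. u x = ennreal (cmod (F x))"
  shows "whitney_avg \<alpha>1 \<alpha>2 r F yt = wavg r u yt"
proof -
  have fin: "emeasure lborel (W yt) \<noteq> 0" "emeasure lborel (W yt) < top" using cW s by (auto simp: W_vol)
  show ?thesis
  proof (cases "r = top")
    case True
    have "(AE x in lborel. x \<in> W yt \<longrightarrow> ennreal (cmod (F x)) \<le> k) \<longleftrightarrow> (AE x in uniform_measure lborel (W yt). u x \<le> k)" for k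
    proof -
      have "(AE x in uniform_measure lborel (W yt). u x \<le> k) \<longleftrightarrow> (AE x in lborel. x \<in> W yt \<longrightarrow> u x \<le> k)"
        using fin by (subst AE_uniform_measure) auto
      also have "\<dots> \<longleftrightarrow> (AE x in lborel. x \<in> W yt \<longrightarrow> ennreal (cmod (F x)) \<le> k)"
        using uF by (intro eventually_cong) auto
      finally show ?thesis by simp
    qed
    then show ?thesis using True by (simp add: whitney_avg_def ess_sup_on_def wavg_def lnorm_top)
  next
    case False
    have R: "0 < enn2real r" using exponent_pos[OF r False] by simp
    have "(\<integral>\<^sup>+ x. indicator (W yt) x * ennreal (cmod (F x) powr enn2real r) \<partial>lborel)
       = (\<integral>\<^sup>+ x. epow (u x) (enn2real r) * indicator (W yt) x \<partial>lborel)"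
    proof (rule nn_integral_cong_AE)
      show "AE x in lborel. indicator (W yt) x * ennreal (cmod (F x) powr enn2real r) = epow (u x) (enn2real r) * indicator (W yt) x"
        using uF by eventually_elim (simp add: mult.commute)
    qed
    then show ?thesis using False r
      by (simp add: whitney_avg_def wavg_def lnorm_uniform_finite rexp_finite divide_ennreal_def mult.commute)
  qed
qed

lemma measurable_snd_borel [measurable]: "(snd :: 'a \<times> real \<Rightarrow> real) \<in> borel_measurable borel"
  by (intro borel_measurable_continuous_onI continuous_intros)

text \<open>The norms see \<open>f\<close> only through \<open>|f| s^(-\<beta>)\<close>. Functions
  in the space are Lebesgue measurable, whereas averages are developed for Borel functions, so an
  almost everywhere equal Borel version is carried along.\<close>

definition represents :: "real \<Rightarrow> ('a \<times> real \<Rightarrow> complex) \<Rightarrow> ('a \<times> real \<Rightarrow> ennreal) \<Rightarrow> bool" where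
  "represents \<beta> f u \<longleftrightarrow> u \<in> borel_measurable borel \<and>
     (AE x in lborel. u x = ennreal (cmod (f x * complex_of_real (snd x powr (- \<beta>)))))"

lemma represents_measurable: "represents \<beta> f u \<Longrightarrow> u \<in> borel_measurable borel"
  by (simp add: represents_def)

lemma represents_exists:
  assumes f: "f \<in> borel_measurable lebesgue" shows "\<exists>u. represents \<beta> f u"
proof -
  have [measurable]: "f \<in> borel_measurable (completion lborel)" using f by simp
  have "(\<lambda>x. ennreal (cmod (f x))) \<in> borel_measurable (completion lborel)" by measurable
  from completion_ex_borel_measurable[OF this] obtain g where g: "g \<in> borel_measurable lborel"
    "AE x in lborel. ennreal (cmod (f x)) = g x" by auto
  have [measurable]: "g \<in> borel_measurable (borel :: ('a \<times> real) measure)" using g(1) by simp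
  have "(\<lambda>x. g x * ennreal (snd x powr (- \<beta>))) \<in> borel_measurable (borel :: ('a \<times> real) measure)" by measurable
  moreover have "AE x in lborel. g x * ennreal (snd x powr (- \<beta>)) = ennreal (cmod (f x * complex_of_real (snd x powr (- \<beta>))))"
    using g(2)
  proof eventually_elim
    case (elim x)
    show ?case by (simp add: elim[symmetric] norm_mult ennreal_mult)
  qed
  ultimately show ?thesis unfolding represents_def by blast
qed

lemma represents_mult:
  assumes "represents \<beta>1 f u" "represents \<beta>2 g v"
  shows "represents (\<beta>1 + \<beta>2) (\<lambda>x. f x * g x) (\<lambda>x. u x * v x)"
proof -
  have [measurable]: "u \<in> borel_measurable borel" "v \<in> borel_measurable borel"
    using assms by (auto simp: represents_def)
  have "AE x in lborel. u x = ennreal (cmod (f x * complex_of_real (snd x powr (- \<beta>1))))"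
    "AE x in lborel. v x = ennreal (cmod (g x * complex_of_real (snd x powr (- \<beta>2))))"
    using assms by (auto simp: represents_def)
  then have "AE x in lborel. u x * v x = ennreal (cmod (f x * g x * complex_of_real (snd x powr (- (\<beta>1 + \<beta>2)))))"
  proof eventually_elim
    case (elim x)
    have "snd x powr (- (\<beta>1 + \<beta>2)) = snd x powr (- \<beta>1) * snd x powr (- \<beta>2)"
      using powr_add[of "snd x" "- \<beta>1" "- \<beta>2"] by simp
    then show ?case by (simp add: elim norm_mult ennreal_mult[symmetric] mult_ac)
  qed
  then show ?thesis by (simp add: represents_def)
qed

text \<open>The two kinds of averages agree at positive heights, and monotonicity in both directions
  needs no more.\<close>

lemma wtent_norm_eq:
  assumes "1 \<le> p" "1 \<le> q" and r: "1 \<le> r" and u: "represents \<beta> f u"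
  shows "wtent_norm \<alpha>1 \<alpha>2 p q r \<beta> f = tent_norm p q (wavg r u)"
proof -
  have "whitney_avg \<alpha>1 \<alpha>2 r (\<lambda>(z, s). f (z, s) * complex_of_real (s powr (- \<beta>))) yt = wavg r u yt" if "0 < snd yt" for yt
    using u by (intro whitney_avg_eq_wavg r that) (auto simp: represents_def case_prod_unfold)
  then show ?thesis unfolding wtent_norm_def
    by (intro antisym tent_norm_mono assms) auto
qed

text \<open>The transfer principle: the weighted tent norm is comparable with the sequence norm of
  the box averages, with a constant independent of the function.\<close>

lemma wtent_norm_equiv:
  assumes p: "1 \<le> p" and q: "1 \<le> q" and r: "1 \<le> r"
  shows "\<exists>C>0. (\<forall>f u. represents \<beta> f u \<longrightarrow> wtent_norm \<alpha>1 \<alpha>2 p q r \<beta> f \<le> ennreal C * tseq_norm p q (qavg r u))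
    \<and> (\<forall>f u. represents \<beta> f u \<longrightarrow> tseq_norm p q (qavg r u) \<le> ennreal C * wtent_norm \<alpha>1 \<alpha>2 p q r \<beta> f)"
proof -
  obtain C1 where C1: "C1 > 0" "\<And>u yt. u \<in> borel_measurable borel \<Longrightarrow> 0 < snd yt \<Longrightarrow>
    wavg r u yt \<le> (SUP i. ennreal C1 * qavg r u i * indicator (dil i) yt)"
    using wavg_le_qavg[OF r] by blast
  obtain C2 where C2: "C2 > 0" "\<And>a. tent_norm p q (tmax a) \<le> ennreal C2 * tseq_norm p q a"
    using tent_norm_le_D[OF p q] by blast
  obtain C3 where C3: "C3 > 0" "\<And>u i yt. u \<in> borel_measurable borel \<Longrightarrow> yt \<in> Q i \<Longrightarrow> qavg r u i \<le> ennreal C3 * wavg r u yt"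
    using qavg_le_wavg[OF r] by blast
  obtain C4 where C4: "C4 > 0" "\<And>a g. (\<forall>i. \<forall>yt\<in>Q i. a i \<le> g yt) \<Longrightarrow> tseq_norm p q a \<le> ennreal C4 * tent_norm p q g"
    using tseq_norm_le_tent_norm[OF p q] by blast
  define C where "C = max (C2 * C1) (C3 * C4)"
  have equiv: "wtent_norm \<alpha>1 \<alpha>2 p q r \<beta> f \<le> ennreal C * tseq_norm p q (qavg r u)"
    "tseq_norm p q (qavg r u) \<le> ennreal C * wtent_norm \<alpha>1 \<alpha>2 p q r \<beta> f" if u: "represents \<beta> f u" for f u
  proof -
    note um = represents_measurable[OF u]
    have "tent_norm p q (wavg r u) \<le> tent_norm p q (tmax (\<lambda>i. ennreal C1 * qavg r u i))"
      unfolding tmax_def by (intro tent_norm_mono p q C1(2) um)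
    also have "\<dots> \<le> ennreal C2 * tseq_norm p q (\<lambda>i. ennreal C1 * qavg r u i)" by (rule C2)
    also have "\<dots> \<le> ennreal C2 * (ennreal C1 * tseq_norm p q (qavg r u))" by (intro mult_left_mono tseq_norm_cmult_le p q) simp
    also have "\<dots> = ennreal (C2 * C1) * tseq_norm p q (qavg r u)" using C1 C2 by (simp add: ennreal_mult mult.assoc)
    also have "\<dots> \<le> ennreal C * tseq_norm p q (qavg r u)" by (intro mult_right_mono ennreal_leI) (auto simp: C_def)
    finally show "wtent_norm \<alpha>1 \<alpha>2 p q r \<beta> f \<le> ennreal C * tseq_norm p q (qavg r u)"
      by (simp add: wtent_norm_eq[OF p q r u])
    \<comment> \<open>The constant \<open>C3\<close> is moved into the sequence to meet the
      pointwise hypothesis of \<open>C4\<close>, then taken out again by homogeneity.\<close>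
    have inv: "ennreal C3 * ennreal (1 / C3) = 1" "ennreal (1 / C3) * ennreal C3 = 1"
      using C3 by (simp_all add: ennreal_mult[symmetric])
    have "tseq_norm p q (\<lambda>i. ennreal (1 / C3) * qavg r u i) \<le> ennreal C4 * tent_norm p q (wavg r u)"
    proof (rule C4(2), intro allI ballI)
      fix i yt assume "yt \<in> Q i"
      then have "ennreal (1 / C3) * qavg r u i \<le> ennreal (1 / C3) * (ennreal C3 * wavg r u yt)"
        by (intro mult_left_mono C3(2) um) auto
      then show "ennreal (1 / C3) * qavg r u i \<le> wavg r u yt" by (simp only: mult.assoc[symmetric] inv mult_1)
    qed
    then have le: "ennreal C3 * tseq_norm p q (\<lambda>i. ennreal (1 / C3) * qavg r u i) \<le> ennreal C3 * (ennreal C4 * tent_norm p q (wavg r u))"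
      by (rule mult_left_mono) simp
    have "qavg r u = (\<lambda>i. ennreal C3 * (ennreal (1 / C3) * qavg r u i))"
      by (simp only: mult.assoc[symmetric] inv mult_1)
    then have "tseq_norm p q (qavg r u) = tseq_norm p q (\<lambda>i. ennreal C3 * (ennreal (1 / C3) * qavg r u i))"
      by (rule arg_cong)
    also have "\<dots> \<le> ennreal C3 * tseq_norm p q (\<lambda>i. ennreal (1 / C3) * qavg r u i)"
      by (rule tseq_norm_cmult_le[OF p q])
    also note le
    also have "ennreal C3 * (ennreal C4 * tent_norm p q (wavg r u)) = ennreal (C3 * C4) * tent_norm p q (wavg r u)" using C3 C4 by (simp add: ennreal_mult mult.assoc)
    also have "\<dots> \<le> ennreal C * tent_norm p q (wavg r u)" by (intro mult_right_mono ennreal_leI) (auto simp: C_def)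
    finally show "tseq_norm p q (qavg r u) \<le> ennreal C * wtent_norm \<alpha>1 \<alpha>2 p q r \<beta> f"
      by (simp add: wtent_norm_eq[OF p q r u])
  qed
  have "0 < C" using C1(1) C2(1) by (simp add: C_def less_max_iff_disj)
  then show ?thesis using equiv by (intro exI[of _ C] conjI allI impI)
qed

lemma qavg_mult_le:
  assumes "Holder_triple r0 r1 r2" "u \<in> borel_measurable borel" "v \<in> borel_measurable borel"
  shows "qavg r0 (\<lambda>x. u x * v x) i \<le> qavg r1 u i * qavg r2 v i"
  unfolding qavg_def by (rule lnorm_Holder[OF assms(1)]) (use assms in auto)

lemma uniform_Q: "emeasure (uniform_measure lborel (Q i)) (space (uniform_measure lborel (Q i))) = 1"
  using vol_Q_pos[of i] vol_Q_finite[of i] by (simp add: ennreal_divide_self)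

lemma qavg_cong:
  assumes "1 \<le> r" "\<And>x. x \<in> Q i \<Longrightarrow> u x = v x" "u \<in> borel_measurable borel" "v \<in> borel_measurable borel"
  shows "qavg r u i = qavg r v i"
  unfolding qavg_def
proof (rule lnorm_cong_AE[OF assms(1)])
  show "AE x in uniform_measure lborel (Q i). u x = v x"
    using vol_Q_pos[of i] vol_Q_finite[of i] assms by (subst AE_uniform_measure) auto
qed

text \<open>Hoelder's inequality for \<open>r\<close> inside each box, then for the sequences of box
  averages.\<close>

lemma mult_norm_le:
  assumes cp: "Holder_triple p0 p1 p2" and cq: "Holder_triple q0 q1 q2" and cr: "Holder_triple r0 r1 r2"
  shows "\<exists>C>0. \<forall>w :: 'a \<times> real \<Rightarrow> complex. w \<in> wtent \<alpha>1 \<alpha>2 p2 q2 r2 \<beta>2 \<longrightarrow>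
    mult_norm (wtent \<alpha>1 \<alpha>2 p1 q1 r1 \<beta>1) (wtent_norm \<alpha>1 \<alpha>2 p1 q1 r1 \<beta>1) (wtent_norm \<alpha>1 \<alpha>2 p0 q0 r0 (\<beta>1 + \<beta>2)) w
      \<le> ennreal C * wtent_norm \<alpha>1 \<alpha>2 p2 q2 r2 \<beta>2 w"
proof -
  note P = Holder_tripleD[OF cp] and Q' = Holder_tripleD[OF cq] and R = Holder_tripleD[OF cr]
  let ?N0 = "wtent_norm \<alpha>1 \<alpha>2 p0 q0 r0 (\<beta>1 + \<beta>2) :: ('a \<times> real \<Rightarrow> complex) \<Rightarrow> ennreal"
  let ?N1 = "wtent_norm \<alpha>1 \<alpha>2 p1 q1 r1 \<beta>1 :: ('a \<times> real \<Rightarrow> complex) \<Rightarrow> ennreal"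
  let ?N2 = "wtent_norm \<alpha>1 \<alpha>2 p2 q2 r2 \<beta>2 :: ('a \<times> real \<Rightarrow> complex) \<Rightarrow> ennreal"
  obtain C0 where C0: "C0 > 0"
    "\<forall>f u. represents (\<beta>1 + \<beta>2) f u \<longrightarrow> ?N0 f \<le> ennreal C0 * tseq_norm p0 q0 (qavg r0 u)"
    "\<forall>f u. represents (\<beta>1 + \<beta>2) f u \<longrightarrow> tseq_norm p0 q0 (qavg r0 u) \<le> ennreal C0 * ?N0 f"
    using wtent_norm_equiv[OF P(1) Q'(1) R(1), where \<beta> = "\<beta>1 + \<beta>2"] by (elim exE conjE) (rule that)
  obtain C1 where C1: "C1 > 0"
    "\<forall>f u. represents \<beta>1 f u \<longrightarrow> ?N1 f \<le> ennreal C1 * tseq_norm p1 q1 (qavg r1 u)"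
    "\<forall>f u. represents \<beta>1 f u \<longrightarrow> tseq_norm p1 q1 (qavg r1 u) \<le> ennreal C1 * ?N1 f"
    using wtent_norm_equiv[OF P(2) Q'(2) R(2), where \<beta> = \<beta>1] by (elim exE conjE) (rule that)
  obtain C2 where C2: "C2 > 0"
    "\<forall>f u. represents \<beta>2 f u \<longrightarrow> ?N2 f \<le> ennreal C2 * tseq_norm p2 q2 (qavg r2 u)"
    "\<forall>f u. represents \<beta>2 f u \<longrightarrow> tseq_norm p2 q2 (qavg r2 u) \<le> ennreal C2 * ?N2 f"
    using wtent_norm_equiv[OF P(3) Q'(3) R(3), where \<beta> = \<beta>2] by (elim exE conjE) (rule that)
  obtain C3 where C3: "C3 > 0" "\<forall>a b. tseq_norm p1 q1 a < top \<longrightarrow> tseq_norm p2 q2 b < top \<longrightarrow>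
    tseq_norm p0 q0 (\<lambda>i. a i * b i) \<le> ennreal C3 * (tseq_norm p1 q1 a * tseq_norm p2 q2 b)"
    using tseq_norm_Holder[OF cp cq] by (elim exE conjE) (rule that)
  define C where "C = C0 * (C3 * (C1 * C2))"
  have "mult_norm (wtent \<alpha>1 \<alpha>2 p1 q1 r1 \<beta>1) ?N1 ?N0 w \<le> ennreal C * ?N2 w" if w: "w \<in> wtent \<alpha>1 \<alpha>2 p2 q2 r2 \<beta>2" for w
    unfolding mult_norm_def
  proof (rule SUP_least)
    fix v assume "v \<in> {v \<in> wtent \<alpha>1 \<alpha>2 p1 q1 r1 \<beta>1. ?N1 v \<noteq> 0}"
    then have v: "v \<in> borel_measurable lebesgue" "?N1 v < top" "?N1 v \<noteq> 0" by (auto simp: wtent_def)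
    have w': "w \<in> borel_measurable lebesgue" "?N2 w < top" using w by (auto simp: wtent_def)
    obtain u1 where u1: "represents \<beta>1 v u1" using represents_exists[OF v(1)] by blast
    obtain u2 where u2: "represents \<beta>2 w u2" using represents_exists[OF w'(1)] by blast
    let ?a = "qavg r1 u1" and ?b = "qavg r2 u2"
    have "ennreal C1 * ?N1 v < top" "ennreal C2 * ?N2 w < top" using v w' by (simp_all add: ennreal_mult_less_top)
    note fin = le_less_trans[OF C1(3)[rule_format, OF u1] this(1)] le_less_trans[OF C2(3)[rule_format, OF u2] this(2)]
    have "?N0 (\<lambda>x. v x * w x) \<le> ennreal C0 * tseq_norm p0 q0 (qavg r0 (\<lambda>x. u1 x * u2 x))"
      by (rule C0(2)[rule_format, OF represents_mult[OF u1 u2]])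
    also have "\<dots> \<le> ennreal C0 * tseq_norm p0 q0 (\<lambda>i. ?a i * ?b i)"
      by (intro mult_left_mono tseq_norm_mono P Q' qavg_mult_le[OF cr] represents_measurable[OF u1] represents_measurable[OF u2]) simp
    also have "\<dots> \<le> ennreal C0 * (ennreal C3 * (tseq_norm p1 q1 ?a * tseq_norm p2 q2 ?b))"
      by (intro mult_left_mono C3(2)[rule_format, OF fin]) simp
    also have "\<dots> \<le> ennreal C0 * (ennreal C3 * ((ennreal C1 * ?N1 v) * (ennreal C2 * ?N2 w)))"
      by (intro mult_left_mono mult_mono C1(3)[rule_format, OF u1] C2(3)[rule_format, OF u2]) auto
    also have "\<dots> = ennreal C * ?N2 w * ?N1 v"
      using C0(1) C1(1) C2(1) C3(1) by (simp add: C_def ennreal_mult mult_ac)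
    finally have "?N0 (\<lambda>x. v x * w x) / ?N1 v \<le> ennreal C * ?N2 w * ?N1 v / ?N1 v"
      by (rule divide_right_mono_ennreal)
    also have "\<dots> = ennreal C * ?N2 w" using v by (intro mult_divide_eq_ennreal) auto
    finally show "?N0 (\<lambda>x. v x * w x) / ?N1 v \<le> ennreal C * ?N2 w" .
  qed
  moreover have "0 < C" using C0(1) C1(1) C2(1) C3(1) by (simp add: C_def)
  ultimately show ?thesis by blast
qed

text \<open>A test sequence \<open>a\<close> is lifted to the function equal to \<open>a i\<close>
  times a local extremiser on \<open>Q i\<close>. Its box averages are exactly \<open>a\<close>, and
  those of its product with \<open>w\<close> are at least \<open>a i * b i / 2\<close>. Hence
  \<open>b / 2\<close> is a multiplier of sequences, where the converse is known.\<close>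

lemma le_mult_norm:
  assumes cp: "Holder_triple p0 p1 p2" and cq: "Holder_triple q0 q1 q2" and cr: "Holder_triple r0 r1 r2"
  shows "\<exists>C>0. \<forall>w :: 'a \<times> real \<Rightarrow> complex. w \<in> mult_space (wtent \<alpha>1 \<alpha>2 p1 q1 r1 \<beta>1) (wtent_norm \<alpha>1 \<alpha>2 p1 q1 r1 \<beta>1) (wtent_norm \<alpha>1 \<alpha>2 p0 q0 r0 (\<beta>1 + \<beta>2)) \<longrightarrow>
    wtent_norm \<alpha>1 \<alpha>2 p2 q2 r2 \<beta>2 w \<le> ennreal C *
      mult_norm (wtent \<alpha>1 \<alpha>2 p1 q1 r1 \<beta>1) (wtent_norm \<alpha>1 \<alpha>2 p1 q1 r1 \<beta>1) (wtent_norm \<alpha>1 \<alpha>2 p0 q0 r0 (\<beta>1 + \<beta>2)) w"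
proof -
  note P = Holder_tripleD[OF cp] and Q' = Holder_tripleD[OF cq] and R = Holder_tripleD[OF cr]
  let ?N0 = "wtent_norm \<alpha>1 \<alpha>2 p0 q0 r0 (\<beta>1 + \<beta>2) :: ('a \<times> real \<Rightarrow> complex) \<Rightarrow> ennreal"
  let ?N1 = "wtent_norm \<alpha>1 \<alpha>2 p1 q1 r1 \<beta>1 :: ('a \<times> real \<Rightarrow> complex) \<Rightarrow> ennreal"
  let ?N2 = "wtent_norm \<alpha>1 \<alpha>2 p2 q2 r2 \<beta>2 :: ('a \<times> real \<Rightarrow> complex) \<Rightarrow> ennreal"
  let ?X1 = "wtent \<alpha>1 \<alpha>2 p1 q1 r1 \<beta>1 :: ('a \<times> real \<Rightarrow> complex) set"
  obtain C0 where C0: "C0 > 0"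
    "\<forall>f u. represents (\<beta>1 + \<beta>2) f u \<longrightarrow> ?N0 f \<le> ennreal C0 * tseq_norm p0 q0 (qavg r0 u)"
    "\<forall>f u. represents (\<beta>1 + \<beta>2) f u \<longrightarrow> tseq_norm p0 q0 (qavg r0 u) \<le> ennreal C0 * ?N0 f"
    using wtent_norm_equiv[OF P(1) Q'(1) R(1), where \<beta> = "\<beta>1 + \<beta>2"] by (elim exE conjE) (rule that)
  obtain C1 where C1: "C1 > 0"
    "\<forall>f u. represents \<beta>1 f u \<longrightarrow> ?N1 f \<le> ennreal C1 * tseq_norm p1 q1 (qavg r1 u)"
    "\<forall>f u. represents \<beta>1 f u \<longrightarrow> tseq_norm p1 q1 (qavg r1 u) \<le> ennreal C1 * ?N1 f"
    using wtent_norm_equiv[OF P(2) Q'(2) R(2), where \<beta> = \<beta>1] by (elim exE conjE) (rule that)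
  obtain C2 where C2: "C2 > 0"
    "\<forall>f u. represents \<beta>2 f u \<longrightarrow> ?N2 f \<le> ennreal C2 * tseq_norm p2 q2 (qavg r2 u)"
    "\<forall>f u. represents \<beta>2 f u \<longrightarrow> tseq_norm p2 q2 (qavg r2 u) \<le> ennreal C2 * ?N2 f"
    using wtent_norm_equiv[OF P(3) Q'(3) R(3), where \<beta> = \<beta>2] by (elim exE conjE) (rule that)
  obtain C3 where C3: "C3 > 0" "\<forall>n b K. supp n b \<longrightarrow> mult_le p0 q0 p1 q1 n b K \<longrightarrow> tseq_norm p2 q2 (\<lambda>i. ennreal (b i)) \<le> ennreal (C3 * K)"
    using tseq_norm_converse[OF cp cq] by (elim exE conjE) (rule that)
  define C where "C = C2 * (2 * (C3 * (C0 * C1)))"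
  have "?N2 w \<le> ennreal C * mult_norm ?X1 ?N1 ?N0 w" if w: "w \<in> mult_space ?X1 ?N1 ?N0" for w
  proof -
    have wm [measurable]: "w \<in> borel_measurable lebesgue" and "mult_norm ?X1 ?N1 ?N0 w < top"
      using w by (auto simp: mult_space_def)
    then obtain Km where Km: "mult_norm ?X1 ?N1 ?N0 w = ennreal Km" "0 \<le> Km"
      by (cases "mult_norm ?X1 ?N1 ?N0 w") auto
    obtain u2 where u2: "represents \<beta>2 w u2" using represents_exists[OF wm] by blast
    have u2m [measurable]: "u2 \<in> borel_measurable borel" by (rule represents_measurable[OF u2])
    have "tseq_norm p2 q2 (qavg r2 u2) \<le> 2 * ennreal (C3 * (C0 * C1 * Km))"
    proof (rule tseq_norm_truncI[OF P(3) Q'(3)])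
      fix n b assume b: "supp n b" and bu: "\<And>i. ennreal (b i) \<le> qavg r2 u2 i"
      have bn: "0 \<le> b i" for i by (rule suppD(1)[OF b])
      \<comment> \<open>Halving \<open>b i\<close> creates the strict inequality that the extremiser
        asks for; the factor \<open>2\<close> reappears in the final constant.\<close>
      have "\<exists>\<phi>. \<phi> \<in> borel_measurable borel \<and> (\<forall>x. 0 \<le> \<phi> x) \<and> qavg r1 (\<lambda>x. ennreal (\<phi> x)) i = 1 \<and>
        ennreal (b i / 2) \<le> qavg r0 (\<lambda>x. ennreal (\<phi> x) * u2 x) i" for i
      proof -
        have "b i / 2 = 0 \<or> ennreal (b i / 2) < qavg r2 u2 i"
        proof (cases "b i = 0")
          case False
          then have "ennreal (b i / 2) < ennreal (b i)" using bn[of i] by (simp add: ennreal_less_iff)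
          then show ?thesis using bu[of i] by (blast intro: less_le_trans)
        qed simp
        moreover have eqm: "borel_measurable (uniform_measure lborel (Q i)) = (borel_measurable borel :: (_ \<Rightarrow> 'c::topological_space) set)"
          by (rule measurable_cong_sets) simp_all
        ultimately show ?thesis
          using Holder_extremiser[OF cr uniform_Q[of i], of u2 "b i / 2"] bn[of i] u2m
          unfolding qavg_def eqm by simp
      qed
      then have "\<forall>i. \<exists>\<phi>. \<phi> \<in> borel_measurable borel \<and> (\<forall>x. 0 \<le> \<phi> x) \<and> qavg r1 (\<lambda>x. ennreal (\<phi> x)) i = 1 \<and>
        ennreal (b i / 2) \<le> qavg r0 (\<lambda>x. ennreal (\<phi> x) * u2 x) i" ..
      from choice[OF this] obtain \<phi> where \<phi>: "\<And>i. \<phi> i \<in> borel_measurable borel" "\<And>i x. 0 \<le> \<phi> i x"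
        "\<And>i. qavg r1 (\<lambda>x. ennreal (\<phi> i x)) i = 1" "\<And>i. ennreal (b i / 2) \<le> qavg r0 (\<lambda>x. ennreal (\<phi> i x) * u2 x) i"
        by (elim exE) blast
      note [measurable] = \<phi>(1)
      have supp2: "supp n (\<lambda>i. b i / 2)" using b by (auto simp: supp_def)
      have "mult_le p0 q0 p1 q1 n (\<lambda>i. b i / 2) (C0 * C1 * Km)"
        unfolding mult_le_def
      proof (intro conjI allI impI)
        show "0 \<le> C0 * C1 * Km" using C0(1) C1(1) Km(2) by simp
        fix a assume a: "supp n a"
        have an: "0 \<le> a i" for i by (rule suppD(1)[OF a])
        define g where "g x = (\<Sum>i<n. a i * \<phi> i x * indicator (Q i) x)" for x
        have gm [measurable]: "g \<in> borel_measurable borel" unfolding g_def by measurable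
        have gQ: "g x = a i * \<phi> i x" if "x \<in> Q i" for x i
        proof -
          have "x \<notin> Q j" if "j \<noteq> i" for j
            using disjoint_family_onD[OF Q_disj, of j i] that \<open>x \<in> Q i\<close> by blast
          then have "g x = (\<Sum>j<n. if j = i then a i * \<phi> i x else 0)"
            unfolding g_def using that by (intro sum.cong) (auto simp: indicator_def)
          also have "\<dots> = a i * \<phi> i x" using suppD(2)[OF a, of i] by (auto simp: not_less)
          finally show ?thesis .
        qed
        have g0: "g x = 0" if "snd x \<le> 0" for x
          unfolding g_def using Q_pos[of x] that by (intro sum.neutral) (auto simp: indicator_def)
        have gn: "0 \<le> g x" for x unfolding g_def using an \<phi>(2) by (intro sum_nonneg) auto
        \<comment> \<open>The power of the height cancels the weight in the norm with exponent
          \<open>\<beta>1\<close>, so that \<open>g\<close> represents \<open>v\<close>.\<close>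
        define v where "v x = complex_of_real (g x * snd x powr \<beta>1)" for x
        have "v \<in> borel_measurable borel" unfolding v_def by measurable
        then have vm: "v \<in> borel_measurable lebesgue" by (simp add: borel_measurable_if_I measurable_completion)
        have v: "represents \<beta>1 v (\<lambda>x. ennreal (g x))"
          unfolding represents_def
        proof (intro conjI AE_I2)
          fix x :: "'a \<times> real"
          show "ennreal (g x) = ennreal (cmod (v x * complex_of_real (snd x powr - \<beta>1)))"
          proof (cases "0 < snd x")
            case True
            then have "v x * complex_of_real (snd x powr - \<beta>1) = complex_of_real (g x)"
              by (simp add: v_def powr_minus)
            then show ?thesis using gn[of x] by simp
          next
            case False
            then show ?thesis using g0[of x] by (simp add: v_def)
          qed
        qed simp
        have q1: "qavg r1 (\<lambda>x. ennreal (g x)) i = ennreal (a i)" for i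
        proof -
          have "qavg r1 (\<lambda>x. ennreal (g x)) i = qavg r1 (\<lambda>x. ennreal (a i) * ennreal (\<phi> i x)) i"
            using an[of i] \<phi>(2)[of i] by (intro qavg_cong R) (auto simp: gQ ennreal_mult)
          also have "\<dots> = ennreal (a i) * qavg r1 (\<lambda>x. ennreal (\<phi> i x)) i"
            unfolding qavg_def using an by (intro lnorm_cmult_real R) auto
          finally show ?thesis using \<phi>(3) by simp
        qed
        have q0: "ennreal (a i * (b i / 2)) \<le> qavg r0 (\<lambda>x. ennreal (g x) * u2 x) i" for i
        proof -
          have "ennreal (a i * (b i / 2)) = ennreal (a i) * ennreal (b i / 2)" using an[of i] bn[of i] by (intro ennreal_mult) auto
          also have "\<dots> \<le> ennreal (a i) * qavg r0 (\<lambda>x. ennreal (\<phi> i x) * u2 x) i"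
            by (intro mult_left_mono \<phi>(4)) simp
          also have "\<dots> = qavg r0 (\<lambda>x. ennreal (a i) * (ennreal (\<phi> i x) * u2 x)) i"
            unfolding qavg_def using an by (intro lnorm_cmult_real[symmetric] R) auto
          also have "\<dots> = qavg r0 (\<lambda>x. ennreal (g x) * u2 x) i"
            using an[of i] \<phi>(2)[of i] by (intro qavg_cong R) (auto simp: gQ ennreal_mult mult.assoc)
          finally show ?thesis .
        qed
        define D1 where "D1 = tseq_norm p1 q1 (\<lambda>i. ennreal (a i))"
        have D1fin: "D1 < top" unfolding D1_def by (rule tseq_norm_supp_finite[OF a P(2) Q'(2)])
        have N1: "?N1 v \<le> ennreal C1 * D1" "D1 \<le> ennreal C1 * ?N1 v"
        proof -
          have "qavg r1 (\<lambda>x. ennreal (g x)) = (\<lambda>i. ennreal (a i))" using q1 by (rule ext)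
          then show "?N1 v \<le> ennreal C1 * D1" "D1 \<le> ennreal C1 * ?N1 v"
            using C1(2,3)[rule_format, OF v] by (simp_all add: D1_def)
        qed
        show "tseq_norm p0 q0 (\<lambda>i. ennreal (a i * (b i / 2))) \<le> ennreal (C0 * C1 * Km) * tseq_norm p1 q1 (\<lambda>i. ennreal (a i))"
        \<comment> \<open>The multiplier norm ignores \<open>v\<close> of norm zero; then
          \<open>a\<close> vanishes and there is nothing to prove.\<close>
        proof (cases "?N1 v = 0")
          case True
          then have "D1 = 0" using N1(2) by simp
          then have "a i = 0" for i using tseq_norm_eq_0_imp[OF P(2) Q'(2), of "\<lambda>i. ennreal (a i)" i] an[of i] by (simp add: D1_def)
          then have "(\<lambda>i. ennreal (a i * (b i / 2))) = (\<lambda>i. 0 * 0)" by simp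
          then show ?thesis using tseq_norm_cmult_le[OF P(1) Q'(1), of 0 "\<lambda>_. 0"] by simp
        next
          case False
          have "ennreal C1 * D1 < top" using D1fin by (simp add: ennreal_mult_less_top)
          then have N1fin: "?N1 v < top" using N1(1) by (rule le_less_trans[rotated])
          have "v \<in> {v \<in> ?X1. ?N1 v \<noteq> 0}" using vm N1fin False by (simp add: wtent_def)
          then have "?N0 (\<lambda>x. v x * w x) / ?N1 v \<le> ennreal Km"
            unfolding Km(1)[symmetric] mult_norm_def by (rule SUP_upper)
          then have "?N0 (\<lambda>x. v x * w x) / ?N1 v * ?N1 v \<le> ennreal Km * ?N1 v" by (rule mult_right_mono) simp
          then have N0: "?N0 (\<lambda>x. v x * w x) \<le> ennreal Km * ?N1 v"
            using False N1fin by (simp add: ennreal_divide_times ennreal_divide_self)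
          have "tseq_norm p0 q0 (\<lambda>i. ennreal (a i * (b i / 2))) \<le> tseq_norm p0 q0 (qavg r0 (\<lambda>x. ennreal (g x) * u2 x))"
            by (intro tseq_norm_mono P Q' q0)
          also have "\<dots> \<le> ennreal C0 * ?N0 (\<lambda>x. v x * w x)"
            by (rule C0(3)[rule_format, OF represents_mult[OF v u2]])
          also have "\<dots> \<le> ennreal C0 * (ennreal Km * (ennreal C1 * D1))"
            by (intro mult_left_mono order_trans[OF N0] N1) auto
          also have "\<dots> = ennreal (C0 * C1 * Km) * D1"
            using C0(1) C1(1) Km(2) by (simp add: ennreal_mult mult_ac)
          finally show ?thesis by (simp add: D1_def)
        qed
      qed
      then have half: "tseq_norm p2 q2 (\<lambda>i. ennreal (b i / 2)) \<le> ennreal (C3 * (C0 * C1 * Km))"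
        by (rule C3(2)[rule_format, OF supp2])
      have "(\<lambda>i. ennreal (b i)) = (\<lambda>i. 2 * ennreal (b i / 2))"
        using bn by (auto simp: ennreal_mult[of 2, symmetric, simplified])
      then have "tseq_norm p2 q2 (\<lambda>i. ennreal (b i)) \<le> 2 * tseq_norm p2 q2 (\<lambda>i. ennreal (b i / 2))"
        using tseq_norm_cmult_le[OF P(3) Q'(3), of 2 "\<lambda>i. ennreal (b i / 2)"] by simp
      also have "\<dots> \<le> 2 * ennreal (C3 * (C0 * C1 * Km))" by (intro mult_left_mono half) simp
      finally show "tseq_norm p2 q2 (\<lambda>i. ennreal (b i)) \<le> 2 * ennreal (C3 * (C0 * C1 * Km))" .
    qed
    then have "ennreal C2 * tseq_norm p2 q2 (qavg r2 u2) \<le> ennreal C2 * (2 * ennreal (C3 * (C0 * C1 * Km)))"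
      by (rule mult_left_mono) simp
    also have "\<dots> = ennreal C * ennreal Km"
      using C0(1) C1(1) C2(1) C3(1) Km(2) by (simp add: C_def ennreal_mult mult_ac)
    finally show ?thesis using C2(2)[rule_format, OF u2] by (simp add: Km(1))
  qed
  moreover have "0 < C" using C0(1) C1(1) C2(1) C3(1) by (simp add: C_def)
  ultimately show ?thesis by blast
qed

end

text \<open>The two one-sided estimates also give the equality of the spaces, since each transfers
  finiteness from one norm to the other. Here both conjuncts are tied to the same dimension
  type.\<close>

lemma multiplier_weighted_tent:
  fixes \<alpha>1 \<alpha>2 :: real
    and p q r :: "nat \<Rightarrow> ennreal"
    and \<beta> :: "nat \<Rightarrow> real"
  assumes "0 < \<alpha>1" "\<alpha>1 < 1 / \<alpha>2" "1 / \<alpha>2 < 1"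
    and "\<And>i. i \<le> 2 \<Longrightarrow> 1 \<le> p i \<and> 1 \<le> q i \<and> 1 \<le> r i"
    and "inverse (p 0) = inverse (p 1) + inverse (p 2)"
    and "inverse (q 0) = inverse (q 1) + inverse (q 2)"
    and "inverse (r 0) = inverse (r 1) + inverse (r 2)"
    and "\<beta> 0 = \<beta> 1 + \<beta> 2"
  shows "(wtent \<alpha>1 \<alpha>2 (p 2) (q 2) (r 2) (\<beta> 2) :: ('a::euclidean_space \<times> real \<Rightarrow> complex) set)
           = mult_space (wtent \<alpha>1 \<alpha>2 (p 1) (q 1) (r 1) (\<beta> 1))
               (wtent_norm \<alpha>1 \<alpha>2 (p 1) (q 1) (r 1) (\<beta> 1))
               (wtent_norm \<alpha>1 \<alpha>2 (p 0) (q 0) (r 0) (\<beta> 0))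
       \<and> (\<exists>C::real. C > 0 \<and>
           (\<forall>w \<in> (wtent \<alpha>1 \<alpha>2 (p 2) (q 2) (r 2) (\<beta> 2) :: ('a \<times> real \<Rightarrow> complex) set).
              wtent_norm \<alpha>1 \<alpha>2 (p 2) (q 2) (r 2) (\<beta> 2) w \<le>
                ennreal C * mult_norm (wtent \<alpha>1 \<alpha>2 (p 1) (q 1) (r 1) (\<beta> 1))
                  (wtent_norm \<alpha>1 \<alpha>2 (p 1) (q 1) (r 1) (\<beta> 1))
                  (wtent_norm \<alpha>1 \<alpha>2 (p 0) (q 0) (r 0) (\<beta> 0)) w
            \<and> mult_norm (wtent \<alpha>1 \<alpha>2 (p 1) (q 1) (r 1) (\<beta> 1))
                  (wtent_norm \<alpha>1 \<alpha>2 (p 1) (q 1) (r 1) (\<beta> 1))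
                  (wtent_norm \<alpha>1 \<alpha>2 (p 0) (q 0) (r 0) (\<beta> 0)) w
                \<le> ennreal C * wtent_norm \<alpha>1 \<alpha>2 (p 2) (q 2) (r 2) (\<beta> 2) w))"
proof -
  \<comment> \<open>A nonpositive \<open>\<alpha>2\<close> would make \<open>1 / \<alpha>2\<close>
    nonpositive, against \<open>0 < \<alpha>1 < 1 / \<alpha>2\<close>.\<close>
  have pos: "0 < \<alpha>2" using assms(1,2) by (cases "0 < \<alpha>2") (auto simp: divide_le_0_iff not_less dest: less_trans)
  have \<alpha>: "0 < \<alpha>1" "\<alpha>1 < 1" "1 < \<alpha>2"
    using assms(1) less_trans[OF assms(2,3)] assms(3) pos by (simp_all add: field_simps)
  obtain c :: "nat \<Rightarrow> 'a" and t Q \<kappa> where "whitney_boxes \<alpha>1 \<alpha>2 c t Q \<kappa>"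
    using whitney_boxes_exist[OF \<alpha>] by blast
  then interpret whitney_boxes \<alpha>1 \<alpha>2 c t Q \<kappa> .
  have cp: "Holder_triple (p 0) (p 1) (p 2)" and cq: "Holder_triple (q 0) (q 1) (q 2)" and cr: "Holder_triple (r 0) (r 1) (r 2)"
    using assms(4)[of 0] assms(4)[of 1] assms(4)[of 2] assms(5,6,7) by (auto intro: Holder_tripleI)
  let ?T = "wtent \<alpha>1 \<alpha>2 (p 2) (q 2) (r 2) (\<beta> 2) :: ('a \<times> real \<Rightarrow> complex) set"
  let ?N = "wtent_norm \<alpha>1 \<alpha>2 (p 2) (q 2) (r 2) (\<beta> 2) :: ('a \<times> real \<Rightarrow> complex) \<Rightarrow> ennreal"
  let ?M = "mult_norm (wtent \<alpha>1 \<alpha>2 (p 1) (q 1) (r 1) (\<beta> 1)) (wtent_norm \<alpha>1 \<alpha>2 (p 1) (q 1) (r 1) (\<beta> 1))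
    (wtent_norm \<alpha>1 \<alpha>2 (p 0) (q 0) (r 0) (\<beta> 0)) :: ('a \<times> real \<Rightarrow> complex) \<Rightarrow> ennreal"
  let ?S = "mult_space (wtent \<alpha>1 \<alpha>2 (p 1) (q 1) (r 1) (\<beta> 1)) (wtent_norm \<alpha>1 \<alpha>2 (p 1) (q 1) (r 1) (\<beta> 1))
    (wtent_norm \<alpha>1 \<alpha>2 (p 0) (q 0) (r 0) (\<beta> 0)) :: ('a \<times> real \<Rightarrow> complex) set"
  obtain A where A: "A > 0" "\<forall>w. w \<in> ?T \<longrightarrow> ?M w \<le> ennreal A * ?N w"
    using mult_norm_le[OF cp cq cr, where ?\<beta>1.0 = "\<beta> 1" and ?\<beta>2.0 = "\<beta> 2", folded assms(8)] by (elim exE conjE) (rule that)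
  obtain A' where A': "A' > 0" "\<forall>w. w \<in> ?S \<longrightarrow> ?N w \<le> ennreal A' * ?M w"
    using le_mult_norm[OF cp cq cr, where ?\<beta>1.0 = "\<beta> 1" and ?\<beta>2.0 = "\<beta> 2", folded assms(8)] by (elim exE conjE) (rule that)
  have "?T \<subseteq> ?S"
  proof
    fix w assume w: "w \<in> ?T"
    then have "ennreal A * ?N w < top" by (simp add: wtent_def ennreal_mult_less_top)
    then have "?M w < top" using A(2)[rule_format, OF w] by (rule le_less_trans[rotated])
    then show "w \<in> ?S" using w by (simp add: wtent_def mult_space_def)
  qed
  moreover have "?S \<subseteq> ?T"
  proof
    fix w assume w: "w \<in> ?S"
    then have "ennreal A' * ?M w < top" by (simp add: mult_space_def ennreal_mult_less_top)
    then have "?N w < top" using A'(2)[rule_format, OF w] by (rule le_less_trans[rotated])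
    then show "w \<in> ?T" using w by (simp add: wtent_def mult_space_def)
  qed
  ultimately have TS: "?T = ?S" by blast
  have "?N w \<le> ennreal (max A A') * ?M w \<and> ?M w \<le> ennreal (max A A') * ?N w" if w: "w \<in> ?T" for w
  proof
    have "ennreal A' * ?M w \<le> ennreal (max A A') * ?M w" by (intro mult_right_mono ennreal_leI) auto
    then show "?N w \<le> ennreal (max A A') * ?M w" using A'(2)[rule_format, OF w[unfolded TS]] by (rule order_trans[rotated])
    have "ennreal A * ?N w \<le> ennreal (max A A') * ?N w" by (intro mult_right_mono ennreal_leI) auto
    then show "?M w \<le> ennreal (max A A') * ?N w" using A(2)[rule_format, OF w] by (rule order_trans[rotated])
  qed
  then have "\<forall>w\<in>?T. ?N w \<le> ennreal (max A A') * ?M w \<and> ?M w \<le> ennreal (max A A') * ?N w" by blast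
  moreover have "0 < max A A'" using A(1) by simp
  ultimately have "\<exists>C>0. \<forall>w\<in>?T. ?N w \<le> ennreal C * ?M w \<and> ?M w \<le> ennreal C * ?N w"
    by (intro exI[of _ "max A A'"] conjI)
  with TS show ?thesis by (rule conjI)
qed

text \<open>Only the first conjunct mentions \<open>'a\<close>: the norm equivalence is stated over a second, independent dimension type.\<close>
theorem theorem5p2:
  fixes \<alpha>1 \<alpha>2 :: real
    and p q r :: "nat \<Rightarrow> ennreal"
    and \<beta> :: "nat \<Rightarrow> real"
  assumes "0 < \<alpha>1" "\<alpha>1 < 1 / \<alpha>2" "1 / \<alpha>2 < 1"
    and "\<And>i. i \<le> 2 \<Longrightarrow> 1 \<le> p i \<and> 1 \<le> q i \<and> 1 \<le> r i"
    and "inverse (p 0) = inverse (p 1) + inverse (p 2)"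
    and "inverse (q 0) = inverse (q 1) + inverse (q 2)"
    and "inverse (r 0) = inverse (r 1) + inverse (r 2)"
    and "\<beta> 0 = \<beta> 1 + \<beta> 2"
  shows "(wtent \<alpha>1 \<alpha>2 (p 2) (q 2) (r 2) (\<beta> 2) :: ('a::euclidean_space \<times> real \<Rightarrow> complex) set)
           = mult_space (wtent \<alpha>1 \<alpha>2 (p 1) (q 1) (r 1) (\<beta> 1))
               (wtent_norm \<alpha>1 \<alpha>2 (p 1) (q 1) (r 1) (\<beta> 1))
               (wtent_norm \<alpha>1 \<alpha>2 (p 0) (q 0) (r 0) (\<beta> 0))
       \<and> (\<exists>C::real. C > 0 \<and>
           (\<forall>w \<in> wtent \<alpha>1 \<alpha>2 (p 2) (q 2) (r 2) (\<beta> 2).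
              wtent_norm \<alpha>1 \<alpha>2 (p 2) (q 2) (r 2) (\<beta> 2) w \<le>
                ennreal C * mult_norm (wtent \<alpha>1 \<alpha>2 (p 1) (q 1) (r 1) (\<beta> 1))
                  (wtent_norm \<alpha>1 \<alpha>2 (p 1) (q 1) (r 1) (\<beta> 1))
                  (wtent_norm \<alpha>1 \<alpha>2 (p 0) (q 0) (r 0) (\<beta> 0)) w
            \<and> mult_norm (wtent \<alpha>1 \<alpha>2 (p 1) (q 1) (r 1) (\<beta> 1))
                  (wtent_norm \<alpha>1 \<alpha>2 (p 1) (q 1) (r 1) (\<beta> 1))
                  (wtent_norm \<alpha>1 \<alpha>2 (p 0) (q 0) (r 0) (\<beta> 0)) w
                \<le> ennreal C * wtent_norm \<alpha>1 \<alpha>2 (p 2) (q 2) (r 2) (\<beta> 2) w))"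
  using multiplier_weighted_tent[OF assms, THEN conjunct1] multiplier_weighted_tent[OF assms, THEN conjunct2]
  by (rule conjI)

end
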